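(* Let $\Bbbk$ be an algebraically closed field of characteristic zero, $G$ a finite abelian group and $\Phi$ a normalized $3$-cocycle on $G$. Let $V=V_1\oplus\cdots\oplus V_\theta\in{}_{\Bbbk G}^{\Bbbk G}\mathcal{YD}^{\Phi}$ be a direct sum of simple objects with $\theta\ge3$, and let $\mathcal P(V)$ be a graded pre-Nichols algebra of $V$, with $\deg(V_i)=e_i$ for $1\le i\le\theta$. Let $i,j,k\in\{1,\dots,\theta\}$ be pairwise distinct, define $$W=\operatorname{ad}_{V_i}(\operatorname{ad}_{V_j}(V_k))+\operatorname{ad}_{V_j}(\operatorname{ad}_{V_i}(V_k))\subset\mathcal P(V),$$ and let $A(W)$ be the subalgebra of $\mathcal P(V)$ generated by $W$. If $W$ is nonzero, then $A(W)$ is a pre-Nichols algebra of $W$.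
   Context: A normalized $3$-cocycle on $G$ is a map $\Phi:G^3\to\Bbbk^*$ with $\Phi(ef,g,h)\Phi(e,f,gh)=\Phi(e,f,g)\Phi(e,fg,h)\Phi(f,g,h)$ and $\Phi(f,1,g)=1$. For $g\in G$ put $\Phi_g(x,y)=\frac{\Phi(g,x,y)\Phi(x,y,g)}{\Phi(x,g,y)}$, a $2$-cocycle on $G$. The category ${}_{\Bbbk G}^{\Bbbk G}\mathcal{YD}^{\Phi}$ of twisted Yetter-Drinfeld modules: objects are $G$-graded vector spaces $V=\bigoplus_{g\in G}V_g$ where each $V_g$ is a projective $G$-representation with respect to $\Phi_g$, i.e. $e\triangleright(f\triangleright v)=\Phi_g(e,f)\,(ef)\triangleright v$ and $1\triangleright v=v$ for $v\in V_g$; morphisms are linear maps preserving grading and action. The tensor product has the product grading and $e\triangleright(X\otimes Y)=\Phi_e(g,h)(e\triangleright X)\otimes(e\triangleright Y)$ for $X,Y$ of degrees $g,h$. For $X,Y,Z$ of degrees $e,f,g$ the associativity constraint is $(X\otimes Y)\otimes Z\mapsto\Phi(e,f,g)^{-1}X\otimes(Y\otimes Z)$ and the braiding is $\mathcal R(X\otimes Y)=(e\triangleright Y)\otimes X$. Algebras and braided Hopf algebras are taken in this braided monoidal category. A simple object is concentrated in a single $G$-degree. For a finite-dimensional object $V$, $T(V)=\bigoplus_{n\ge0}V^{\otimes n}$ (tensor powers bracketed to the left) is the tensor algebra in the category; it is an $\mathbb N_0$-graded braided Hopf algebra in which the elements of $V$ are primitive. A pre-Nichols algebra of $V$ is a quotient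 braided Hopf algebra $\mathcal P(V)=T(V)/I$ with $I$ an $\mathbb N_0$-homogeneous Hopf ideal contained in $\bigoplus_{n\ge2}V^{\otimes n}$; equivalently, a connected $\mathbb N_0$-graded braided Hopf algebra generated by its degree-one part $V$. For $V=V_1\oplus\cdots\oplus V_\theta$ a direct sum of simple objects, $\mathcal P(V)$ is called graded if it is an $\mathbb N_0^\theta$-graded braided Hopf algebra with $\deg(V_i)=e_i$, where $e_1,\dots,e_\theta$ is the standard basis of $\mathbb N_0^\theta$. Adjoint action: for $X\in V_i$ of $G$-degree $g_i$ and $Y\in\mathcal P(V)$, $\operatorname{ad}_X(Y)=XY-(g_i\triangleright Y)X$; for a subspace $U\subset\mathcal P(V)$, $\operatorname{ad}_{V_i}(U)$ is the span of all $\operatorname{ad}_X(Y)$ with $X\in V_i$, $Y\in U$. "$A(W)$ is a pre-Nichols algebra of $W$" means: the algebra $A(W)$, graded with $W$ in degree $1$, carries a comultiplication making it a connected $\mathbb N_0$-graded braided Hopf algebra in ${}_{\Bbbk G}^{\Bbbk G}\mathcal{YD}^{\Phi}$ generated by $W$ in degree one, with the elements of $W$ primitive. (This comultiplication is in general not the restriction of that of $\mathcal P(V)$.) *)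

theory Defs
  imports
    "HOL-Computational_Algebra.Computational_Algebra"
    "HOL-Library.Function_Algebras"
begin

text \<open>
  Conventions. The finite abelian group \<open>G\<close> is a type of sort \<open>{finite, ab_group_add}\<close>; it is
  written additively, so its neutral element is \<open>0\<close>. A vector space is a linear subspace of a
  type of sort \<open>ab_group_add\<close> carrying a scalar multiplication that satisfies
  \<^locale>\<open>vector_space\<close>. Maps are only constrained on the carriers of their domains.
\<close>

section \<open>Linear algebra\<close>

definition linear_on ::
  "('k \<Rightarrow> 'v \<Rightarrow> 'v) \<Rightarrow> ('k \<Rightarrow> 'w \<Rightarrow> 'w) \<Rightarrow> 'v set \<Rightarrow> 'w set \<Rightarrow> ('v::plus \<Rightarrow> 'w::plus) \<Rightarrow> bool"
  where "linear_on s t C D f \<longleftrightarrow>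
    (\<forall>x\<in>C. f x \<in> D) \<and>
    (\<forall>x\<in>C. \<forall>y\<in>C. f (x + y) = f x + f y) \<and>
    (\<forall>c. \<forall>x\<in>C. f (s c x) = t c (f x))"

definition internal_direct_sum ::
  "('k::field \<Rightarrow> 'v::ab_group_add \<Rightarrow> 'v) \<Rightarrow> 'v set \<Rightarrow> ('m \<Rightarrow> 'v set) \<Rightarrow> bool"
  where "internal_direct_sum s C U \<longleftrightarrow>
    (\<forall>m. module.subspace s (U m)) \<and>
    C = module.span s (\<Union>m. U m) \<and>
    (\<forall>F f. finite F \<and> (\<forall>m\<in>F. f m \<in> U m) \<and> (\<Sum>m\<in>F. f m) = 0 \<longrightarrow> (\<forall>m\<in>F. f m = 0))"

text \<open>
  The tensor product of two vector spaces over a field is realised inside the dual of the space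
  of bilinear forms: the pure tensor of \<open>x\<close> and \<open>y\<close> is evaluation at \<open>(x, y)\<close>. Over a field the
  span of these evaluations is a tensor product, and the tensor product of subspaces is
  the span of the corresponding pure tensors; see \<open>tensor_lift\<close> below.
\<close>

type_synonym ('k, 'v, 'w) tensor = "('v \<Rightarrow> 'w \<Rightarrow> 'k) \<Rightarrow> 'k"

definition bilinear_form ::
  "('k::field \<Rightarrow> 'v::ab_group_add \<Rightarrow> 'v) \<Rightarrow> ('k \<Rightarrow> 'w::ab_group_add \<Rightarrow> 'w) \<Rightarrow> ('v \<Rightarrow> 'w \<Rightarrow> 'k) \<Rightarrow> bool"
  where "bilinear_form s t \<beta> \<longleftrightarrow>
    (\<forall>x. Vector_Spaces.linear t (*) (\<beta> x)) \<and> (\<forall>y. Vector_Spaces.linear s (*) (\<lambda>x. \<beta> x y))"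

definition pure_tensor ::
  "('k::field \<Rightarrow> 'v::ab_group_add \<Rightarrow> 'v) \<Rightarrow> ('k \<Rightarrow> 'w::ab_group_add \<Rightarrow> 'w)
    \<Rightarrow> 'v \<Rightarrow> 'w \<Rightarrow> ('k, 'v, 'w) tensor"
  where "pure_tensor s t x y = (\<lambda>\<beta>. if bilinear_form s t \<beta> then \<beta> x y else 0)"

definition tensor_scale :: "'k::field \<Rightarrow> ('k, 'v, 'w) tensor \<Rightarrow> ('k, 'v, 'w) tensor"
  where "tensor_scale c T = (\<lambda>\<beta>. c * T \<beta>)"

lemma vector_space_tensor_scale:
  "vector_space (tensor_scale :: 'k::field \<Rightarrow> ('k, 'v, 'w) tensor \<Rightarrow> _)"
  by unfold_locales (auto simp: tensor_scale_def fun_eq_iff algebra_simps)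

lemma pure_tensor_bilinear:
  shows "pure_tensor s t (x + x') y = pure_tensor s t x y + pure_tensor s t x' y"
    and "pure_tensor s t x (y + y') = pure_tensor s t x y + pure_tensor s t x y'"
    and "pure_tensor s t (s c x) y = tensor_scale c (pure_tensor s t x y)"
    and "pure_tensor s t x (t c y) = tensor_scale c (pure_tensor s t x y)"
proof -
  have "\<beta> (x + x') y = \<beta> x y + \<beta> x' y" "\<beta> x (y + y') = \<beta> x y + \<beta> x y'"
    "\<beta> (s c x) y = c * \<beta> x y" "\<beta> x (t c y) = c * \<beta> x y" if "bilinear_form s t \<beta>" for \<beta>
  proof -
    interpret l: Vector_Spaces.linear t "(*)" "\<beta> x" for x using that by (simp add: bilinear_form_def)
    interpret m: Vector_Spaces.linear s "(*)" "\<lambda>x. \<beta> x y" for y using that by (simp add: bilinear_form_def)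
    show "\<beta> (x + x') y = \<beta> x y + \<beta> x' y" "\<beta> x (y + y') = \<beta> x y + \<beta> x y'"
      "\<beta> (s c x) y = c * \<beta> x y" "\<beta> x (t c y) = c * \<beta> x y"
      by (rule m.add l.add m.scale l.scale)+
  qed
  then show "pure_tensor s t (x + x') y = pure_tensor s t x y + pure_tensor s t x' y"
    and "pure_tensor s t x (y + y') = pure_tensor s t x y + pure_tensor s t x y'"
    and "pure_tensor s t (s c x) y = tensor_scale c (pure_tensor s t x y)"
    and "pure_tensor s t x (t c y) = tensor_scale c (pure_tensor s t x y)"
    by (simp_all add: pure_tensor_def tensor_scale_def fun_eq_iff)
qed

lemma internal_direct_sum_basis:
  assumes "vector_space s" and U: "internal_direct_sum s C U"
  obtains B idx where "\<not> module.dependent s (\<Union>m. B m)"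
    and "\<And>m. module.span s (B m) = U m" and "\<And>m b. b \<in> B m \<Longrightarrow> idx b = m"
proof -
  interpret vector_space s by fact
  have sub: "subspace (U m)" for m using U by (auto simp: internal_direct_sum_def)
  have dir: "f m = 0" if "finite F" "\<And>m. m \<in> F \<Longrightarrow> f m \<in> U m" "(\<Sum>m\<in>F. f m) = 0" "m \<in> F" for F f m
    using U that unfolding internal_direct_sum_def by blast
  have "\<exists>B. independent B \<and> span B = U m" for m
    by (metis basis_exists sub span_subspace)
  then obtain B where B: "\<And>m. independent (B m)" "\<And>m. span (B m) = U m" by metis
  have BU: "b \<in> U m" if "b \<in> B m" for b m using B(2) that span_base by blast
  have uniq: "m = n" if "b \<in> B m" "b \<in> B n" for b m n
  proof (rule ccontr)
    assume mn: "m \<noteq> n"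
    define f where "f = (\<lambda>l. if l = m then b else - b)"
    have "f m = 0"
      by (rule dir[of "{m, n}"]) (use mn that BU sub in \<open>auto simp: f_def subspace_neg\<close>)
    then have "b = 0" by (simp add: f_def)
    then show False using that B(1) dependent_zero by blast
  qed
  define idx where "idx = (\<lambda>b. SOME m. b \<in> B m)"
  have idx: "idx b = m" if "b \<in> B m" for b m
    unfolding idx_def using that uniq by (metis (mono_tags) someI_ex)
  have "independent (\<Union>m. B m)"
  proof
    assume "dependent (\<Union>m. B m)"
    then obtain T u v where T: "finite T" "T \<subseteq> (\<Union>m. B m)" "v \<in> T" "u v \<noteq> 0" "(\<Sum>v\<in>T. s (u v) v) = 0"
      unfolding dependent_explicit by blast
    define f where "f = (\<lambda>m. \<Sum>w\<in>{w\<in>T. idx w = m}. s (u w) w)"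
    have mem: "w \<in> B (idx w)" if "w \<in> T" for w using T(2) idx that by blast
    have "(\<Sum>m\<in>idx ` T. f m) = 0"
      unfolding f_def using T(1,5) by (subst sum.group) auto
    moreover have "f m \<in> U m" for m
      unfolding f_def using mem BU by (auto intro!: subspace_sum subspace_scale sub)
    ultimately have "f (idx v) = 0" using dir[of "idx ` T" f "idx v"] T by auto
    moreover have "{w\<in>T. idx w = idx v} \<subseteq> B (idx v)" by (clarsimp, metis mem)
    ultimately have "dependent (B (idx v))"
      unfolding dependent_explicit f_def using T
      by (intro exI[of _ "{w\<in>T. idx w = idx v}"] exI[of _ u]) auto
    then show False using B by blast
  qed
  then show ?thesis using that B(2) idx by blast
qed

lemma bilinear_form_mult:
  assumes "Vector_Spaces.linear s (*) p" "Vector_Spaces.linear t (*) q"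
  shows "bilinear_form s t (\<lambda>x y. p x * q y)"
proof -
  have "p (x + y) = p x + p y" "p (s c x) = c * p x" for x y c
    using assms(1) unfolding Vector_Spaces.linear_iff by auto
  moreover have "q (x + y) = q x + q y" "q (t c x) = c * q x" for x y c
    using assms(2) unfolding Vector_Spaces.linear_iff by auto
  ultimately show ?thesis
    using assms unfolding bilinear_form_def Vector_Spaces.linear_iff by (auto simp: algebra_simps)
qed

lemma independent_pure_tensors:
  fixes s :: "'k::field \<Rightarrow> 'v::ab_group_add \<Rightarrow> 'v" and t :: "'k \<Rightarrow> 'w::ab_group_add \<Rightarrow> 'w"
  assumes "vector_space s" "vector_space t" "\<not> module.dependent s B" "\<not> module.dependent t B'"
  shows "\<not> module.dependent tensor_scale ((\<lambda>(b, c). pure_tensor s t b c) ` (B \<times> B'))"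
    and "inj_on (\<lambda>(b, c). pure_tensor s t b c) (B \<times> B')"
proof -
  interpret v: vector_space s by fact
  interpret w: vector_space t by fact
  interpret T: vector_space "tensor_scale :: 'k \<Rightarrow> ('k, 'v, 'w) tensor \<Rightarrow> _"
    by (rule vector_space_tensor_scale)
  have k: "vector_space ((*) :: 'k \<Rightarrow> 'k \<Rightarrow> 'k)" by unfold_locales (auto simp: algebra_simps)
  interpret pv: vector_space_pair s "(*)" by (intro vector_space_pair.intro assms k)
  interpret pw: vector_space_pair t "(*)" by (intro vector_space_pair.intro assms k)
  have "\<exists>\<beta>. bilinear_form s t \<beta> \<and> (\<forall>b\<in>B. \<forall>c\<in>B'. \<beta> b c = (if b = b0 \<and> c = c0 then 1 else 0))"
    for b0 c0
  proof -
    obtain p where p: "Vector_Spaces.linear s (*) p" "\<And>b. b \<in> B \<Longrightarrow> p b = (if b = b0 then 1 else 0)"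
      using pv.linear_independent_extend[OF assms(3), of "\<lambda>b. if b = b0 then 1 else 0"] by blast
    obtain q where q: "Vector_Spaces.linear t (*) q" "\<And>c. c \<in> B' \<Longrightarrow> q c = (if c = c0 then 1 else 0)"
      using pw.linear_independent_extend[OF assms(4), of "\<lambda>b. if b = c0 then 1 else 0"] by blast
    show ?thesis
    proof (intro exI[of _ "\<lambda>x y. p x * q y"] conjI ballI)
      show "bilinear_form s t (\<lambda>x y. p x * q y)" using p(1) q(1) by (rule bilinear_form_mult)
    next
      fix b c assume "b \<in> B" "c \<in> B'"
      then show "p b * q c = (if b = b0 \<and> c = c0 then 1 else 0)" by (simp add: p(2) q(2))
    qed
  qed
  then obtain \<beta> where \<beta>: "\<And>b0 c0. bilinear_form s t (\<beta> b0 c0)"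
    "\<And>b0 c0 b c. b \<in> B \<Longrightarrow> c \<in> B' \<Longrightarrow> \<beta> b0 c0 b c = (if b = b0 \<and> c = c0 then 1 else 0)"
    by metis
  have ev: "pure_tensor s t b c (\<beta> b0 c0) = (if b = b0 \<and> c = c0 then 1 else 0)"
    if "b \<in> B" "c \<in> B'" for b c b0 c0
    using \<beta> that by (auto simp: pure_tensor_def)
  show inj: "inj_on (\<lambda>(b, c). pure_tensor s t b c) (B \<times> B')"
  proof (rule inj_onI, clarify)
    fix b c b' c' assume "b \<in> B" "c \<in> B'" "b' \<in> B" "c' \<in> B'" "pure_tensor s t b c = pure_tensor s t b' c'"
    then show "b = b' \<and> c = c'"
      using ev[of b c b c] ev[of b' c' b c] by (metis zero_neq_one)
  qed
  show "\<not> T.dependent ((\<lambda>(b, c). pure_tensor s t b c) ` (B \<times> B'))"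
  proof
    assume "T.dependent ((\<lambda>(b, c). pure_tensor s t b c) ` (B \<times> B'))"
    then obtain Q u v where Q: "finite Q" "Q \<subseteq> (\<lambda>(b, c). pure_tensor s t b c) ` (B \<times> B')"
      "v \<in> Q" "u v \<noteq> 0" "(\<Sum>v\<in>Q. tensor_scale (u v) v) = 0"
      unfolding T.dependent_explicit by blast
    obtain b0 c0 where v: "v = pure_tensor s t b0 c0" "b0 \<in> B" "c0 \<in> B'" using Q by auto
    have "(\<Sum>w\<in>Q. tensor_scale (u w) w) (\<beta> b0 c0) = (\<Sum>w\<in>Q. u w * w (\<beta> b0 c0))"
      using Q(1) by (induction Q) (auto simp: tensor_scale_def)
    also have "\<dots> = (\<Sum>w\<in>Q. if w = v then u w else 0)"
    proof (rule sum.cong[OF refl])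
      fix w assume "w \<in> Q"
      then obtain b c where "w = pure_tensor s t b c" "b \<in> B" "c \<in> B'" using Q by auto
      then show "u w * w (\<beta> b0 c0) = (if w = v then u w else 0)"
        using ev[of b c b0 c0] ev[of b0 c0 b0 c0] v by auto
    qed
    also have "\<dots> = u v" using Q by simp
    finally show False using Q by simp
  qed
qed

lemma tensor_lift:
  fixes s :: "'k::field \<Rightarrow> 'v::ab_group_add \<Rightarrow> 'v" and t :: "'k \<Rightarrow> 'w::ab_group_add \<Rightarrow> 'w"
    and r :: "'k \<Rightarrow> 'x::ab_group_add \<Rightarrow> 'x"
  assumes vs: "vector_space s" "vector_space t" "vector_space r"
    and U: "internal_direct_sum s C U" and W: "internal_direct_sum t D W"
    and F: "\<And>m n x. x \<in> U m \<Longrightarrow> linear_on t r (W n) UNIV (F m n x)"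
      "\<And>m n y. y \<in> W n \<Longrightarrow> linear_on s r (U m) UNIV (\<lambda>x. F m n x y)"
  shows "\<exists>h. Vector_Spaces.linear tensor_scale r h \<and>
    (\<forall>m n. \<forall>x\<in>U m. \<forall>y\<in>W n. h (pure_tensor s t x y) = F m n x y)"
proof -
  interpret v: vector_space s by fact
  interpret w: vector_space t by fact
  interpret r: vector_space r by fact
  interpret T: vector_space "tensor_scale :: 'k \<Rightarrow> ('k, 'v, 'w) tensor \<Rightarrow> _"
    by (rule vector_space_tensor_scale)
  interpret Tr: vector_space_pair "tensor_scale :: 'k \<Rightarrow> ('k, 'v, 'w) tensor \<Rightarrow> _" r ..
  obtain B idx where B: "\<not> v.dependent (\<Union>m. B m)" "\<And>m. v.span (B m) = U m"
    "\<And>m b. b \<in> B m \<Longrightarrow> idx b = m"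
    by (rule internal_direct_sum_basis[OF vs(1) U]) blast
  obtain B' idx' where B': "\<not> w.dependent (\<Union>m. B' m)" "\<And>m. w.span (B' m) = W m"
    "\<And>m b. b \<in> B' m \<Longrightarrow> idx' b = m"
    by (rule internal_direct_sum_basis[OF vs(2) W]) blast
  let ?p = "\<lambda>(b, c). pure_tensor s t b c"
  let ?Q = "(\<Union>m. B m) \<times> (\<Union>m. B' m)"
  note ind = independent_pure_tensors[OF vs(1,2) B(1) B'(1)]
  define f where "f z = (case inv_into ?Q ?p z of (b, c) \<Rightarrow> F (idx b) (idx' c) b c)" for z
  obtain h where h: "Vector_Spaces.linear tensor_scale r h" "\<And>z. z \<in> ?p ` ?Q \<Longrightarrow> h z = f z"
    using Tr.linear_independent_extend[OF ind(1), of f] by blast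
  have h_add: "h (a + b) = h a + h b" and h_scale: "h (tensor_scale k a) = r k (h a)" for a b k
    using h(1) unfolding Vector_Spaces.linear_iff by blast+
  have base: "h (pure_tensor s t b c) = F m n b c" if "b \<in> B m" "c \<in> B' n" for b c m n
  proof -
    have Q: "(b, c) \<in> ?Q" using that by blast
    have "inv_into ?Q ?p (?p (b, c)) = (b, c)" by (rule inv_into_f_f[OF ind(2) Q])
    then have "f (pure_tensor s t b c) = F m n b c"
      by (simp add: f_def B(3)[OF that(1)] B'(3)[OF that(2)])
    moreover have "h (pure_tensor s t b c) = f (pure_tensor s t b c)"
      using Q by (intro h(2)) (rule image_eqI[of _ _ "(b, c)"], simp)
    ultimately show ?thesis by simp
  qed
  have hz: "h (pure_tensor s t 0 y) = 0" "h (pure_tensor s t x 0) = 0" for x y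
    using h_add[of "pure_tensor s t 0 y" "pure_tensor s t 0 y"]
      h_add[of "pure_tensor s t x 0" "pure_tensor s t x 0"]
    by (simp add: pure_tensor_bilinear(1)[symmetric], simp add: pure_tensor_bilinear(2)[symmetric])
  have hl: "h (pure_tensor s t (s k a + x) y) = r k (h (pure_tensor s t a y)) + h (pure_tensor s t x y)"
    for k a x y
    unfolding pure_tensor_bilinear(1,3) h_add h_scale ..
  have hr: "h (pure_tensor s t x (t k a + y)) = r k (h (pure_tensor s t x a)) + h (pure_tensor s t x y)"
    for k a x y
    unfolding pure_tensor_bilinear(2,4) h_add h_scale ..
  have left: "h (pure_tensor s t x c) = F m n x c" if "x \<in> U m" "c \<in> B' n" for x c m n
  proof -
    have "c \<in> W n" using B'(2)[of n] w.span_base[OF that(2)] by simp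
    note lin = F(2)[OF this, of m, unfolded linear_on_def]
    have "x \<in> v.span (B m)" using B(2) that by simp
    then have "x \<in> U m \<and> h (pure_tensor s t x c) = F m n x c"
    proof (induction rule: v.span_induct_alt)
      case base
      have "0 \<in> U m" using v.span_zero[of "B m"] B(2) by simp
      moreover from this have "F m n (0 + 0) c = F m n 0 c + F m n 0 c" using lin by blast
      ultimately show ?case by (simp add: hz)
    next
      case (step k a y)
      have a: "a \<in> U m" using B(2)[of m] v.span_base[OF step(1)] by simp
      have ka: "s k a \<in> U m" using a B(2)[of m] v.span_scale[of a "B m" k] by simp
      have y: "y \<in> U m" using step by simp
      have kay: "s k a + y \<in> U m" using ka y B(2)[of m] v.span_add[of "s k a" "B m" y] by simp
      have "F m n (s k a + y) c = F m n (s k a) c + F m n y c" using lin ka y by blast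
      moreover have "F m n (s k a) c = r k (F m n a c)" using lin a by blast
      ultimately show ?case
        using kay step base[OF step(1) that(2)] by (simp add: hl)
    qed
    then show ?thesis by simp
  qed
  have "h (pure_tensor s t x y) = F m n x y" if "x \<in> U m" "y \<in> W n" for x y m n
  proof -
    note lin = F(1)[OF that(1), of n, unfolded linear_on_def]
    have "y \<in> w.span (B' n)" using B'(2) that by simp
    then have "y \<in> W n \<and> h (pure_tensor s t x y) = F m n x y"
    proof (induction rule: w.span_induct_alt)
      case base
      have "0 \<in> W n" using w.span_zero[of "B' n"] B'(2) by simp
      moreover from this have "F m n x (0 + 0) = F m n x 0 + F m n x 0" using lin by blast
      ultimately show ?case by (simp add: hz)
    next
      case (step k a y)
      have a: "a \<in> W n" using B'(2)[of n] w.span_base[OF step(1)] by simp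
      have ka: "t k a \<in> W n" using a B'(2)[of n] w.span_scale[of a "B' n" k] by simp
      have y: "y \<in> W n" using step by simp
      have kay: "t k a + y \<in> W n" using ka y B'(2)[of n] w.span_add[of "t k a" "B' n" y] by simp
      have "F m n x (t k a + y) = F m n x (t k a) + F m n x y" using lin ka y by blast
      moreover have "F m n x (t k a) = r k (F m n x a)" using lin a by blast
      ultimately show ?case
        using kay step left[OF that(1) step(1)] by (simp add: hr)
    qed
    then show ?thesis by simp
  qed
  then show ?thesis using h(1) by blast
qed

section \<open>The category of twisted Yetter-Drinfeld modules\<close>

definition normalized_3cocycle :: "('g::ab_group_add \<Rightarrow> 'g \<Rightarrow> 'g \<Rightarrow> 'k::field) \<Rightarrow> bool"
  where "normalized_3cocycle \<Phi> \<longleftrightarrow>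
    (\<forall>e f g. \<Phi> e f g \<noteq> 0) \<and>
    (\<forall>e f g h. \<Phi> (e + f) g h * \<Phi> e f (g + h) = \<Phi> e f g * \<Phi> e (f + g) h * \<Phi> f g h) \<and>
    (\<forall>f g. \<Phi> f 0 g = 1)"

definition cocycle_at :: "('g \<Rightarrow> 'g \<Rightarrow> 'g \<Rightarrow> 'k::field) \<Rightarrow> 'g \<Rightarrow> 'g \<Rightarrow> 'g \<Rightarrow> 'k"
  where "cocycle_at \<Phi> g x y = \<Phi> g x y * \<Phi> x y g / \<Phi> x g y"

record ('g, 'k, 'v) yd =
  scl :: "'k \<Rightarrow> 'v \<Rightarrow> 'v"
  carr :: "'v set"
  hpart :: "'g \<Rightarrow> 'v set"
  act :: "'g \<Rightarrow> 'v \<Rightarrow> 'v"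

definition yd_module ::
  "('g::ab_group_add \<Rightarrow> 'g \<Rightarrow> 'g \<Rightarrow> 'k::field) \<Rightarrow> ('g, 'k, 'v::ab_group_add, 'z) yd_scheme \<Rightarrow> bool"
  where "yd_module \<Phi> V \<longleftrightarrow>
    vector_space (scl V) \<and>
    internal_direct_sum (scl V) (carr V) (hpart V) \<and>
    (\<forall>e. linear_on (scl V) (scl V) (carr V) (carr V) (act V e)) \<and>
    (\<forall>e g. \<forall>v\<in>hpart V g. act V e v \<in> hpart V g) \<and>
    (\<forall>e f g. \<forall>v\<in>hpart V g. act V e (act V f v) = scl V (cocycle_at \<Phi> g e f) (act V (e + f) v)) \<and>
    (\<forall>v\<in>carr V. act V 0 v = v)"

definition yd_hom ::
  "('g, 'k, 'v::plus, 'y) yd_scheme \<Rightarrow> ('g, 'k, 'w::plus, 'z) yd_scheme \<Rightarrow> ('v \<Rightarrow> 'w) \<Rightarrow> bool"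
  where "yd_hom V W f \<longleftrightarrow>
    linear_on (scl V) (scl W) (carr V) (carr W) f \<and>
    (\<forall>g. \<forall>v\<in>hpart V g. f v \<in> hpart W g) \<and>
    (\<forall>e. \<forall>v\<in>carr V. f (act V e v) = act W e (f v))"

definition yd_restrict :: "('g, 'k, 'v, 'z) yd_scheme \<Rightarrow> 'v set \<Rightarrow> ('g, 'k, 'v, 'z) yd_scheme"
  where "yd_restrict V U = V\<lparr>carr := U, hpart := (\<lambda>g. hpart V g \<inter> U)\<rparr>"

definition yd_subobject ::
  "('g::ab_group_add \<Rightarrow> 'g \<Rightarrow> 'g \<Rightarrow> 'k::field) \<Rightarrow> ('g, 'k, 'v::ab_group_add, 'z) yd_scheme
    \<Rightarrow> 'v set \<Rightarrow> bool"
  where "yd_subobject \<Phi> V U \<longleftrightarrow> U \<subseteq> carr V \<and> yd_module \<Phi> (yd_restrict V U)"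

definition yd_simple ::
  "('g::ab_group_add \<Rightarrow> 'g \<Rightarrow> 'g \<Rightarrow> 'k::field) \<Rightarrow> ('g, 'k, 'v::ab_group_add, 'z) yd_scheme \<Rightarrow> bool"
  where "yd_simple \<Phi> V \<longleftrightarrow>
    yd_module \<Phi> V \<and> carr V \<noteq> {0} \<and> (\<forall>U. yd_subobject \<Phi> V U \<longrightarrow> U = {0} \<or> U = carr V)"

subsection \<open>Monoidal structure\<close>

abbreviation ptens ::
  "('g, 'k::field, 'v::ab_group_add, 'y) yd_scheme \<Rightarrow> ('g, 'k, 'w::ab_group_add, 'z) yd_scheme
    \<Rightarrow> 'v \<Rightarrow> 'w \<Rightarrow> ('k, 'v, 'w) tensor"
  where "ptens V W \<equiv> pure_tensor (scl V) (scl W)"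

text \<open>
  In this subsection each \<open>SOME h\<close> picks a linear map with prescribed values on the
  (homogeneous) pure tensors of the carriers. Such a map exists by (iterated) \<open>tensor_lift\<close>, and its
  restriction to the carrier of the tensor product is unique.
\<close>

definition yd_tensor ::
  "('g::ab_group_add \<Rightarrow> 'g \<Rightarrow> 'g \<Rightarrow> 'k::field) \<Rightarrow> ('g, 'k, 'v::ab_group_add, 'y) yd_scheme
    \<Rightarrow> ('g, 'k, 'w::ab_group_add, 'z) yd_scheme \<Rightarrow> ('g, 'k, ('k, 'v, 'w) tensor) yd"
  where "yd_tensor \<Phi> V W =
    \<lparr>scl = tensor_scale,
     carr = module.span tensor_scale {ptens V W x y |x y. x \<in> carr V \<and> y \<in> carr W},
     hpart = (\<lambda>g. module.span tensor_scale
       {ptens V W x y |x y e f. x \<in> hpart V e \<and> y \<in> hpart W f \<and> e + f = g}),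
     act = (\<lambda>e. SOME h. Vector_Spaces.linear tensor_scale tensor_scale h \<and>
       (\<forall>g f. \<forall>x\<in>hpart V g. \<forall>y\<in>hpart W f.
          h (ptens V W x y) = tensor_scale (cocycle_at \<Phi> e g f) (ptens V W (act V e x) (act W e y))))\<rparr>"

definition yd_unit :: "('g::ab_group_add, 'k::field, 'k) yd"
  where "yd_unit =
    \<lparr>scl = (*), carr = UNIV, hpart = (\<lambda>g. if g = 0 then UNIV else {0}), act = (\<lambda>e c. c)\<rparr>"

definition tensor_map ::
  "('g, 'k::field, 'v::ab_group_add, 'a) yd_scheme \<Rightarrow> ('g, 'k, 'w::ab_group_add, 'b) yd_scheme
    \<Rightarrow> ('g, 'k, 'x::ab_group_add, 'c) yd_scheme \<Rightarrow> ('g, 'k, 'y::ab_group_add, 'd) yd_scheme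
    \<Rightarrow> ('v \<Rightarrow> 'x) \<Rightarrow> ('w \<Rightarrow> 'y) \<Rightarrow> ('k, 'v, 'w) tensor \<Rightarrow> ('k, 'x, 'y) tensor"
  where "tensor_map V W X Y p q =
    (SOME h. Vector_Spaces.linear tensor_scale tensor_scale h \<and>
       (\<forall>x\<in>carr V. \<forall>y\<in>carr W. h (ptens V W x y) = ptens X Y (p x) (q y)))"

definition left_unitor ::
  "('g::ab_group_add, 'k::field, 'v::ab_group_add, 'z) yd_scheme \<Rightarrow> ('k, 'k, 'v) tensor \<Rightarrow> 'v"
  where "left_unitor V =
    (SOME h. Vector_Spaces.linear tensor_scale (scl V) h \<and>
       (\<forall>c. \<forall>x\<in>carr V. h (ptens yd_unit V c x) = scl V c x))"

definition right_unitor ::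
  "('g::ab_group_add, 'k::field, 'v::ab_group_add, 'z) yd_scheme \<Rightarrow> ('k, 'v, 'k) tensor \<Rightarrow> 'v"
  where "right_unitor V =
    (SOME h. Vector_Spaces.linear tensor_scale (scl V) h \<and>
       (\<forall>c. \<forall>x\<in>carr V. h (ptens V yd_unit x c) = scl V c x))"

definition associator ::
  "('g::ab_group_add \<Rightarrow> 'g \<Rightarrow> 'g \<Rightarrow> 'k::field) \<Rightarrow> ('g, 'k, 'v::ab_group_add, 'a) yd_scheme
    \<Rightarrow> ('g, 'k, 'w::ab_group_add, 'b) yd_scheme \<Rightarrow> ('g, 'k, 'x::ab_group_add, 'c) yd_scheme
    \<Rightarrow> ('k, ('k, 'v, 'w) tensor, 'x) tensor \<Rightarrow> ('k, 'v, ('k, 'w, 'x) tensor) tensor"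
  where "associator \<Phi> V W X =
    (SOME h. Vector_Spaces.linear tensor_scale tensor_scale h \<and>
       (\<forall>e f g. \<forall>x\<in>hpart V e. \<forall>y\<in>hpart W f. \<forall>z\<in>hpart X g.
          h (ptens (yd_tensor \<Phi> V W) X (ptens V W x y) z) =
          tensor_scale (inverse (\<Phi> e f g)) (ptens V (yd_tensor \<Phi> W X) x (ptens W X y z))))"

definition associator_inv ::
  "('g::ab_group_add \<Rightarrow> 'g \<Rightarrow> 'g \<Rightarrow> 'k::field) \<Rightarrow> ('g, 'k, 'v::ab_group_add, 'a) yd_scheme
    \<Rightarrow> ('g, 'k, 'w::ab_group_add, 'b) yd_scheme \<Rightarrow> ('g, 'k, 'x::ab_group_add, 'c) yd_scheme
    \<Rightarrow> ('k, 'v, ('k, 'w, 'x) tensor) tensor \<Rightarrow> ('k, ('k, 'v, 'w) tensor, 'x) tensor"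
  where "associator_inv \<Phi> V W X =
    (SOME h. Vector_Spaces.linear tensor_scale tensor_scale h \<and>
       (\<forall>e f g. \<forall>x\<in>hpart V e. \<forall>y\<in>hpart W f. \<forall>z\<in>hpart X g.
          h (ptens V (yd_tensor \<Phi> W X) x (ptens W X y z)) =
          tensor_scale (\<Phi> e f g) (ptens (yd_tensor \<Phi> V W) X (ptens V W x y) z)))"

definition braiding ::
  "('g, 'k::field, 'v::ab_group_add, 'a) yd_scheme \<Rightarrow> ('g, 'k, 'w::ab_group_add, 'b) yd_scheme
    \<Rightarrow> ('k, 'v, 'w) tensor \<Rightarrow> ('k, 'w, 'v) tensor"
  where "braiding V W =
    (SOME h. Vector_Spaces.linear tensor_scale tensor_scale h \<and>
       (\<forall>e. \<forall>x\<in>hpart V e. \<forall>y\<in>carr W. h (ptens V W x y) = ptens W V (act W e y) x))"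

section \<open>Braided Hopf algebras\<close>

record ('g, 'k, 'v) hopf = "('g, 'k, 'v) yd" +
  mu :: "('k, 'v, 'v) tensor \<Rightarrow> 'v"
  unt :: 'v
  comul :: "'v \<Rightarrow> ('k, 'v, 'v) tensor"
  counit :: "'v \<Rightarrow> 'k"

abbreviation prd :: "('g, 'k::field, 'v::ab_group_add, 'z) hopf_scheme \<Rightarrow> 'v \<Rightarrow> 'v \<Rightarrow> 'v"
  where "prd A x y \<equiv> mu A (ptens A A x y)"

definition braided_algebra ::
  "('g::ab_group_add \<Rightarrow> 'g \<Rightarrow> 'g \<Rightarrow> 'k::field) \<Rightarrow> ('g, 'k, 'v::ab_group_add, 'z) hopf_scheme \<Rightarrow> bool"
  where "braided_algebra \<Phi> A \<longleftrightarrow>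
    yd_module \<Phi> A \<and>
    yd_hom (yd_tensor \<Phi> A A) A (mu A) \<and>
    yd_hom yd_unit A (\<lambda>c. scl A c (unt A)) \<and>
    (\<forall>T\<in>carr (yd_tensor \<Phi> (yd_tensor \<Phi> A A) A).
       mu A (tensor_map (yd_tensor \<Phi> A A) A A A (mu A) id T) =
       mu A (tensor_map A (yd_tensor \<Phi> A A) A A id (mu A) (associator \<Phi> A A A T))) \<and>
    (\<forall>x\<in>carr A. prd A (unt A) x = x \<and> prd A x (unt A) = x)"

definition braided_coalgebra ::
  "('g::ab_group_add \<Rightarrow> 'g \<Rightarrow> 'g \<Rightarrow> 'k::field) \<Rightarrow> ('g, 'k, 'v::ab_group_add, 'z) hopf_scheme \<Rightarrow> bool"
  where "braided_coalgebra \<Phi> A \<longleftrightarrow>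
    yd_module \<Phi> A \<and>
    yd_hom A (yd_tensor \<Phi> A A) (comul A) \<and>
    yd_hom A yd_unit (counit A) \<and>
    (\<forall>x\<in>carr A.
       associator \<Phi> A A A (tensor_map A A (yd_tensor \<Phi> A A) A (comul A) id (comul A x)) =
       tensor_map A A A (yd_tensor \<Phi> A A) id (comul A) (comul A x)) \<and>
    (\<forall>x\<in>carr A. left_unitor A (tensor_map A A yd_unit A (counit A) id (comul A x)) = x \<and>
                right_unitor A (tensor_map A A A yd_unit id (counit A) (comul A x)) = x)"

text \<open>
  \<open>(A \<otimes> A) \<otimes> (A \<otimes> A) \<rightarrow> A \<otimes> (A \<otimes> (A \<otimes> A)) \<rightarrow> A \<otimes> ((A \<otimes> A) \<otimes> A) \<rightarrow> A \<otimes> ((A \<otimes> A) \<otimes> A)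
  \<rightarrow> A \<otimes> (A \<otimes> (A \<otimes> A)) \<rightarrow> (A \<otimes> A) \<otimes> (A \<otimes> A) \<rightarrow> A \<otimes> A\<close>, where the third map braids the two
  middle factors and the last one is \<open>mu \<otimes> mu\<close>: the multiplication of the algebra \<open>A \<otimes> A\<close>.
\<close>

definition tensor_square_mu ::
  "('g::ab_group_add \<Rightarrow> 'g \<Rightarrow> 'g \<Rightarrow> 'k::field) \<Rightarrow> ('g, 'k, 'v::ab_group_add, 'z) hopf_scheme
    \<Rightarrow> ('k, ('k, 'v, 'v) tensor, ('k, 'v, 'v) tensor) tensor \<Rightarrow> ('k, 'v, 'v) tensor"
  where "tensor_square_mu \<Phi> A =
    (let AA = yd_tensor \<Phi> A A; L = yd_tensor \<Phi> AA A; R = yd_tensor \<Phi> A AA in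
      tensor_map AA AA A A (mu A) (mu A) \<circ>
      associator_inv \<Phi> A A AA \<circ>
      tensor_map A L A R id (associator \<Phi> A A A) \<circ>
      tensor_map A L A L id (tensor_map AA A AA A (braiding A A) id) \<circ>
      tensor_map A R A L id (associator_inv \<Phi> A A A) \<circ>
      associator \<Phi> A A AA)"

definition braided_bialgebra ::
  "('g::ab_group_add \<Rightarrow> 'g \<Rightarrow> 'g \<Rightarrow> 'k::field) \<Rightarrow> ('g, 'k, 'v::ab_group_add, 'z) hopf_scheme \<Rightarrow> bool"
  where "braided_bialgebra \<Phi> A \<longleftrightarrow>
    braided_algebra \<Phi> A \<and> braided_coalgebra \<Phi> A \<and>
    (\<forall>T\<in>carr (yd_tensor \<Phi> A A). comul A (mu A T) =
       tensor_square_mu \<Phi> A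
         (tensor_map A A (yd_tensor \<Phi> A A) (yd_tensor \<Phi> A A) (comul A) (comul A) T)) \<and>
    comul A (unt A) = ptens A A (unt A) (unt A) \<and>
    (\<forall>x\<in>carr A. \<forall>y\<in>carr A. counit A (prd A x y) = counit A x * counit A y) \<and>
    counit A (unt A) = 1"

definition antipode ::
  "('g::ab_group_add, 'k::field, 'v::ab_group_add, 'z) hopf_scheme \<Rightarrow> ('v \<Rightarrow> 'v) \<Rightarrow> bool"
  where "antipode A S \<longleftrightarrow>
    yd_hom A A S \<and>
    (\<forall>x\<in>carr A. mu A (tensor_map A A A A S id (comul A x)) = scl A (counit A x) (unt A) \<and>
                mu A (tensor_map A A A A id S (comul A x)) = scl A (counit A x) (unt A))"

text \<open>
  The antipode is unique, so it is not part of the data.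

  Hopf algebras graded by a commutative monoid: \<open>\<nat>\<^sub>0\<close> is the type \<^typ>\<open>nat\<close>, and \<open>\<nat>\<^sub>0\<^sup>\<theta>\<close> is
  \<open>'n \<Rightarrow> nat\<close> with pointwise addition, for a finite type \<open>'n\<close> with \<open>\<theta>\<close> elements.
\<close>

definition graded_braided_hopf ::
  "('g::ab_group_add \<Rightarrow> 'g \<Rightarrow> 'g \<Rightarrow> 'k::field) \<Rightarrow> ('g, 'k, 'v::ab_group_add, 'z) hopf_scheme
    \<Rightarrow> ('m::comm_monoid_add \<Rightarrow> 'v set) \<Rightarrow> bool"
  where "graded_braided_hopf \<Phi> A gr \<longleftrightarrow>
    braided_bialgebra \<Phi> A \<and>
    internal_direct_sum (scl A) (carr A) gr \<and>
    (\<forall>m. yd_subobject \<Phi> A (gr m)) \<and>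
    unt A \<in> gr 0 \<and>
    (\<forall>m n. \<forall>x\<in>gr m. \<forall>y\<in>gr n. prd A x y \<in> gr (m + n)) \<and>
    (\<forall>m. \<forall>x\<in>gr m. comul A x \<in>
       module.span tensor_scale {ptens A A y z |y z p q. y \<in> gr p \<and> z \<in> gr q \<and> p + q = m}) \<and>
    (\<forall>m. m \<noteq> 0 \<longrightarrow> (\<forall>x\<in>gr m. counit A x = 0)) \<and>
    (\<exists>S. antipode A S \<and> (\<forall>m. \<forall>x\<in>gr m. S x \<in> gr m))"

definition subalgebra ::
  "('g, 'k::field, 'v::ab_group_add, 'z) hopf_scheme \<Rightarrow> 'v set \<Rightarrow> bool"
  where "subalgebra A B \<longleftrightarrow>
    module.subspace (scl A) B \<and> B \<subseteq> carr A \<and> unt A \<in> B \<and> (\<forall>x\<in>B. \<forall>y\<in>B. prd A x y \<in> B)"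

abbreviation subalgebra_generated ::
  "('g, 'k::field, 'v::ab_group_add, 'z) hopf_scheme \<Rightarrow> 'v set \<Rightarrow> 'v set"
  where "subalgebra_generated A S \<equiv> subalgebra A hull S"

definition primitive :: "('g, 'k::field, 'v::ab_group_add, 'z) hopf_scheme \<Rightarrow> 'v \<Rightarrow> bool"
  where "primitive A x \<longleftrightarrow> comul A x = ptens A A x (unt A) + ptens A A (unt A) x"

section \<open>Pre-Nichols algebras\<close>

text \<open>
  The object \<open>V\<close> is identified with the degree-one part of its pre-Nichols algebra, so that
  it inherits its grading and action from \<open>A\<close>.
\<close>

definition pre_Nichols ::
  "('g::ab_group_add \<Rightarrow> 'g \<Rightarrow> 'g \<Rightarrow> 'k::field) \<Rightarrow> ('g, 'k, 'v::ab_group_add, 'z) hopf_scheme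
    \<Rightarrow> 'v set \<Rightarrow> bool"
  where "pre_Nichols \<Phi> A V \<longleftrightarrow>
    (\<exists>B. finite B \<and> V = module.span (scl A) B) \<and>
    (\<exists>gr :: nat \<Rightarrow> 'v set.
       graded_braided_hopf \<Phi> A gr \<and> gr 0 = range (\<lambda>c. scl A c (unt A)) \<and> gr 1 = V) \<and>
    subalgebra_generated A V = carr A \<and>
    (\<forall>x\<in>V. primitive A x)"

definition unit_vec :: "'n \<Rightarrow> 'n \<Rightarrow> nat"
  where "unit_vec i = (\<lambda>j. if j = i then 1 else 0)"

definition graded_pre_Nichols ::
  "('g::ab_group_add \<Rightarrow> 'g \<Rightarrow> 'g \<Rightarrow> 'k::field) \<Rightarrow> ('g, 'k, 'v::ab_group_add, 'z) hopf_scheme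
    \<Rightarrow> 'v set \<Rightarrow> ('n \<Rightarrow> 'v set) \<Rightarrow> bool"
  where "graded_pre_Nichols \<Phi> A V Vs \<longleftrightarrow>
    pre_Nichols \<Phi> A V \<and>
    (\<exists>gr :: ('n \<Rightarrow> nat) \<Rightarrow> 'v set. graded_braided_hopf \<Phi> A gr \<and> (\<forall>i. Vs i \<subseteq> gr (unit_vec i)))"

text \<open>
  The span of all \<open>ad\<^sub>X(Y) = XY - (g \<triangleright> Y)X\<close> with \<open>X \<in> U\<close> homogeneous, \<open>g\<close> the \<open>G\<close>-degree of \<open>X\<close>, and
  \<open>Y \<in> S\<close>. If \<open>U\<close> is simple, then every \<open>X \<in> U\<close> is homogeneous.
\<close>

definition ad_span ::
  "('g, 'k::field, 'v::ab_group_add, 'z) hopf_scheme \<Rightarrow> 'v set \<Rightarrow> 'v set \<Rightarrow> 'v set"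
  where "ad_span A U S = module.span (scl A)
    {prd A X Y - prd A (act A g Y) X |X Y g. X \<in> U \<and> X \<in> hpart A g \<and> Y \<in> S}"

end

theory Submission
  imports Defs
begin

text \<open>
  Let \<open>\<delta>\<close> be the additive map \<open>\<nat>\<^sub>0\<^sup>\<theta> \<rightarrow> \<int>\<close> with \<open>\<delta>(e\<^sub>k) = - 2\<close> and \<open>\<delta>(e\<^sub>l) = 1\<close> for \<open>l \<noteq> k\<close>. The algebra
  \<open>A(W)\<close> lives in degrees that are multiples of \<open>e\<^sub>i + e\<^sub>j + e\<^sub>k\<close>, where \<open>\<delta>\<close> vanishes. If \<open>N\<close> denotes
  the span of all \<open>y \<otimes> z\<close> with \<open>y\<close> of degree \<open>m\<close> and \<open>\<delta>(m) > 0\<close>, then \<open>ad\<^sub>X(Y)\<close> is primitive modulo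
  \<open>N\<close> whenever \<open>X \<in> V\<^sub>l\<close>, \<open>l \<noteq> k\<close>, and \<open>Y\<close> is primitive modulo \<open>N\<close>: the terms of \<open>\<Delta>(ad\<^sub>X(Y))\<close> whose
  left factor could have negative degree cancel. Hence the elements of \<open>W\<close> are primitive modulo \<open>N\<close>,
  and by multiplicativity \<open>\<Delta>(A(W)) \<subseteq> A(W) \<otimes> A(W) + N\<close>. Projecting the left factor to \<open>\<delta> = 0\<close> removes
  \<open>N\<close> and turns \<open>\<Delta>\<close> into a comultiplication of \<open>A(W)\<close>; its coassociativity is obtained by projecting
  the first two of the three tensor factors in the coassociativity of \<open>\<Delta>\<close>. The result is a connected
  graded bialgebra, so it has an antipode.
\<close>

section \<open>Graded vector spaces and tensor products\<close>

text \<open>The obstacle is that the comultiplication of \<open>P\<close> need not map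
  \<open>A(W)\<close> into \<open>A(W) \<otimes> A(W)\<close>. For \<open>X\<close> in
  \<open>V_i\<close>, the coproduct of \<open>XY\<close> contains, besides
  \<open>XY \<otimes> 1\<close> and \<open>1 \<otimes> XY\<close>, cross terms
  \<open>X \<otimes> Y\<close> and \<open>(g \<triangleright> Y) \<otimes> X\<close>. The commutator
  removes the second kind, but terms with left factor in \<open>V_i\<close> survive. The weights are
  chosen to make these survivors visible: weight 1 on \<open>e_i\<close> and \<open>e_j\<close> puts
  them into \<open>N\<close>, and the weight -2 of \<open>e_k\<close> is then forced by weight 0 on
  \<open>e_i + e_j + e_k\<close>. Only left factors are constrained because left degrees add in the
  product of \<open>P \<otimes> P\<close>; so \<open>N\<close> is an ideal among the tensors with
  left weight at least 0, and the projected comultiplication stays multiplicative on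
  \<open>A(W)\<close>. The category is not strict, and its structure maps are chosen by
  \<open>SOME\<close> separately for each object. All identities are therefore reduced to
  homogeneous pure tensors, where \<open>\<Phi>\<close> enters as a scalar depending on degrees
  only. The projection preserves \<open>G\<close>-degrees, hence commutes with the
  associators.\<close>

lemma linear_imp_linear_on: "Vector_Spaces.linear s t h \<Longrightarrow> linear_on s t C UNIV h"
  by (auto simp: Vector_Spaces.linear_iff linear_on_def)

lemma linear_onD:
  assumes "linear_on s t C D f" and "x \<in> C"
  shows "f x \<in> D" and "y \<in> C \<Longrightarrow> f (x + y) = f x + f y" and "f (s c x) = t c (f x)"
  using assms by (auto simp: linear_on_def)

lemma linear_on_0:
  fixes f :: "'v::ab_group_add \<Rightarrow> 'w::ab_group_add"
  assumes "linear_on s t C D f" "0 \<in> C"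
  shows "f 0 = 0"
proof -
  have "f (0 + 0) = f 0 + f 0" using assms unfolding linear_on_def by blast
  then show ?thesis by simp
qed

lemma linear_on_weaken: "linear_on s t C D f \<Longrightarrow> C' \<subseteq> C \<Longrightarrow> D \<subseteq> D' \<Longrightarrow> linear_on s t C' D' f"
  by (auto simp: linear_on_def subset_iff)

lemma linear_on_comp:
  "linear_on s t C D f \<Longrightarrow> linear_on t r D E g \<Longrightarrow> linear_on s r C E (\<lambda>x. g (f x))"
  by (auto simp: linear_on_def)

lemma linear_on_id: "linear_on s s C C id"
  by (auto simp: linear_on_def)

lemma vector_space_mult: "vector_space ((*) :: 'k::field \<Rightarrow> 'k \<Rightarrow> 'k)"
  by unfold_locales (auto simp: algebra_simps)

lemma linear_on_eq_on_span:
  fixes f g :: "'v::ab_group_add \<Rightarrow> 'w::ab_group_add"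
  assumes "vector_space s" "linear_on s t C D f" "linear_on s t C E g" "module.subspace s C" "S \<subseteq> C"
    and eq: "\<And>x. x \<in> S \<Longrightarrow> f x = g x" and x: "x \<in> module.span s S"
  shows "f x = g x"
proof -
  interpret vector_space s by fact
  have "subspace {x \<in> C. f x = g x}"
    using assms(2-4) by (auto simp: subspace_def linear_on_def linear_on_0)
  then have "span S \<subseteq> {x \<in> C. f x = g x}"
    by (intro span_minimal) (use eq assms(5) in auto)
  then show ?thesis using x by auto
qed

lemma linear_on_span_into:
  fixes f :: "'v::ab_group_add \<Rightarrow> 'w::ab_group_add"
  assumes "vector_space s" "vector_space t" "linear_on s t C D f" "module.subspace s C" "S \<subseteq> C"
    and sub: "module.subspace t E" and into: "\<And>x. x \<in> S \<Longrightarrow> f x \<in> E" and x: "x \<in> module.span s S"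
  shows "f x \<in> E"
proof -
  interpret vector_space s by fact
  interpret t: vector_space t by fact
  have "subspace {x \<in> C. f x \<in> E}"
    using assms(3,4) sub linear_on_0[OF assms(3)]
    by (auto simp: subspace_def linear_on_def t.subspace_0 t.subspace_add t.subspace_scale)
  then have "span S \<subseteq> {x \<in> C. f x \<in> E}"
    by (intro span_minimal) (use into assms(5) in auto)
  then show ?thesis using x by auto
qed

section \<open>Direct sums: lifts, projections, refinement\<close>

lemma internal_direct_sum_subspace:
  assumes "vector_space s" "internal_direct_sum s C U"
  shows "module.subspace s (U m)" and "module.subspace s C" and "U m \<subseteq> C"
    and "C = module.span s (\<Union>m. U m)"
proof -
  interpret vector_space s by fact
  show "subspace (U m)" and C: "C = span (\<Union>m. U m)"
    using assms(2) by (auto simp: internal_direct_sum_def)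
  show "subspace C" "U m \<subseteq> C" unfolding C using span_superset[of "\<Union>m. U m"] by auto
qed

text \<open>With the one-element index type \<open>unit\<close>, the graded lifting lemma
  \<open>tensor_lift\<close> also covers maps prescribed on a whole carrier.\<close>

lemma internal_direct_sum_single:
  assumes "vector_space s" "module.subspace s C"
  shows "internal_direct_sum s C (\<lambda>_::unit. C)"
  unfolding internal_direct_sum_def
proof (intro conjI allI impI ballI assms(2))
  interpret vector_space s by fact
  have "span C = C" using assms(2) by (simp only: span_eq_iff)
  then show "C = span (\<Union>_::unit. C)" by (simp del: span_eq_iff)
  fix F and f :: "unit \<Rightarrow> _" and m
  assume f: "finite F \<and> (\<forall>m\<in>F. f m \<in> C) \<and> (\<Sum>m\<in>F. f m) = 0" and "m \<in> F"
  then have "F = {()}" by auto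
  with f show "f m = 0" by simp
qed

text \<open>Comes from \<open>tensor_lift\<close> by tensoring with the ground field: the bilinear
  maps sending \<open>x\<close> and \<open>c\<close> to \<open>r c (F m x)\<close> are lifted, and
  the lift is evaluated at \<open>x \<otimes> 1\<close>.\<close>

lemma internal_direct_sum_lift:
  fixes s :: "'k::field \<Rightarrow> 'v::ab_group_add \<Rightarrow> 'v" and r :: "'k \<Rightarrow> 'x::ab_group_add \<Rightarrow> 'x"
  assumes "vector_space s" "vector_space r" "internal_direct_sum s C U"
    and F: "\<And>m. linear_on s r (U m) UNIV (F m)"
  shows "\<exists>h. Vector_Spaces.linear s r h \<and> (\<forall>m. \<forall>x\<in>U m. h x = F m x)"
proof -
  interpret s: vector_space s by fact
  interpret r: vector_space r by fact
  interpret k: vector_space "(*) :: 'k \<Rightarrow> 'k \<Rightarrow> 'k" by (rule vector_space_mult)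
  have 1: "internal_direct_sum ((*) :: 'k \<Rightarrow> 'k \<Rightarrow> 'k) UNIV (\<lambda>_::unit. UNIV)"
    by (rule internal_direct_sum_single[OF vector_space_mult]) simp
  obtain h where h: "Vector_Spaces.linear tensor_scale r h"
    "\<And>m n x c. x \<in> U m \<Longrightarrow> h (pure_tensor s (*) x c) = r c (F m x)"
    using tensor_lift[OF assms(1) vector_space_mult assms(2,3) 1, of "\<lambda>m n x c. r c (F m x)"] F
    by (auto simp: linear_on_def r.scale_left_distrib r.scale_right_distrib mult.commute)
  have "Vector_Spaces.linear s r (\<lambda>x. h (pure_tensor s (*) x 1))"
    using h(1) assms(1) by (simp add: Vector_Spaces.linear_iff pure_tensor_bilinear)
  with h(2) show ?thesis by (intro exI[of _ "\<lambda>x. h (pure_tensor s (*) x 1)"]) auto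
qed

lemma internal_direct_sum_proj:
  assumes "vector_space s" "internal_direct_sum s C U"
  obtains h where "Vector_Spaces.linear s s h" "\<And>m x. x \<in> U m \<Longrightarrow> h x = (if Q m then x else 0)"
proof -
  interpret vector_space s by fact
  have "linear_on s s (U m) UNIV (\<lambda>x. if Q m then x else 0)" for m
    by (auto simp: linear_on_def)
  from internal_direct_sum_lift[OF assms(1,1,2) this] that show ?thesis by blast
qed

text \<open>Applying the projection with index \<open>m\<close> to a vanishing sum isolates the
  summand \<open>f m\<close>.\<close>

lemma internal_direct_sumI:
  assumes "vector_space s" "\<And>m. module.subspace s (U m)" "C = module.span s (\<Union>m. U m)"
    and proj: "\<And>m. \<exists>h. Vector_Spaces.linear s s h \<and> (\<forall>n. \<forall>x\<in>U n. h x = (if n = m then x else 0))"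
  shows "internal_direct_sum s C U"
  unfolding internal_direct_sum_def
proof (intro conjI allI impI ballI assms(2,3))
  fix F f m assume f: "finite F \<and> (\<forall>m\<in>F. f m \<in> U m) \<and> (\<Sum>m\<in>F. f m) = 0" and m: "m \<in> F"
  obtain h where h: "Vector_Spaces.linear s s h" "\<And>n x. x \<in> U n \<Longrightarrow> h x = (if n = m then x else 0)"
    using proj by blast
  interpret h: Vector_Spaces.linear s s h by fact
  have "0 = h (\<Sum>m\<in>F. f m)" using f h.zero by simp
  also have "\<dots> = (\<Sum>n\<in>F. if n = m then f n else 0)"
    unfolding h.sum using f h(2) by (intro sum.cong) auto
  also have "\<dots> = f m" using f m by simp
  finally show "f m = 0" by simp
qed

text \<open>The projection onto \<open>U' m\<close> maps every \<open>U n\<close> into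
  \<open>U m\<close> and fixes \<open>x\<close>. This passes from a degree measured in an ambient
  family to the same degree in a family of smaller spaces.\<close>

lemma internal_direct_sum_refine:
  assumes "vector_space s" "internal_direct_sum s C U'" "\<And>m. U m \<subseteq> U' m"
    "\<And>m. module.subspace s (U m)" "x \<in> module.span s (\<Union>m. U m)" "x \<in> U' m"
  shows "x \<in> U m"
proof -
  interpret vector_space s by fact
  obtain h where h: "Vector_Spaces.linear s s h" "\<And>n x. x \<in> U' n \<Longrightarrow> h x = (if n = m then x else 0)"
    by (rule internal_direct_sum_proj[OF assms(1,2), of "\<lambda>n. n = m"]) blast
  have "h x \<in> U m"
  proof (rule linear_on_span_into[OF assms(1,1) linear_imp_linear_on[OF h(1), of UNIV]])
    show "h y \<in> U m" if "y \<in> (\<Union>m. U m)" for y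
    proof -
      obtain n where n: "y \<in> U n" using \<open>y \<in> (\<Union>m. U m)\<close> by auto
      then have "h y = (if n = m then y else 0)" using h(2) assms(3) by blast
      then show ?thesis using n subspace_0[OF assms(4)] by auto
    qed
  qed (use assms in auto)
  then show ?thesis using h(2)[OF assms(6)] by simp
qed

lemma internal_direct_sum_sub:
  assumes "vector_space s" "internal_direct_sum s C U'" "\<And>m. U m \<subseteq> U' m"
    "\<And>m. module.subspace s (U m)" "D = module.span s (\<Union>m. U m)"
  shows "internal_direct_sum s D U"
proof (rule internal_direct_sumI[OF assms(1,4,5)])
  fix m
  obtain h where h: "Vector_Spaces.linear s s h" "\<And>n x. x \<in> U' n \<Longrightarrow> h x = (if n = m then x else 0)"
    by (rule internal_direct_sum_proj[OF assms(1,2), of "\<lambda>n. n = m"]) blast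
  then show "\<exists>h. Vector_Spaces.linear s s h \<and> (\<forall>n. \<forall>x\<in>U n. h x = (if n = m then x else 0))"
    using assms(3) by blast
qed

lemma linear_on_add:
  fixes f g :: "'v::ab_group_add \<Rightarrow> 'w::ab_group_add"
  assumes "vector_space t" "linear_on s t C UNIV f" "linear_on s t C UNIV g"
  shows "linear_on s t C UNIV (\<lambda>x. f x + g x)"
  using assms(2,3) vector_space.vector_space_assms(1)[OF assms(1)] by (simp add: linear_on_def ac_simps)

lemma linear_on_scale:
  fixes f :: "'v::ab_group_add \<Rightarrow> 'w::ab_group_add"
  assumes "vector_space t" "linear_on s t C UNIV f"
  shows "linear_on s t C UNIV (\<lambda>x. t c (f x))"
  using assms(2) vector_space.vector_space_assms(1,3)[OF assms(1)] by (simp add: linear_on_def mult.commute)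

section \<open>Spans of pure tensors, their gradings, and maps out of triple tensor products\<close>

interpretation tensor: vector_space "tensor_scale :: 'k::field \<Rightarrow> ('k, 'v, 'w) tensor \<Rightarrow> _"
  by (rule vector_space_tensor_scale)

abbreviation tensor_span ::
  "('k::field \<Rightarrow> 'v::ab_group_add \<Rightarrow> 'v) \<Rightarrow> ('k \<Rightarrow> 'w::ab_group_add \<Rightarrow> 'w) \<Rightarrow> 'v set \<Rightarrow> 'w set
    \<Rightarrow> ('k, 'v, 'w) tensor set"
  where "tensor_span s t C D \<equiv>
    module.span tensor_scale {pure_tensor s t x y |x y. x \<in> C \<and> y \<in> D}"

lemma pure_tensor_zero [simp]:
  "pure_tensor s t 0 y = 0" "pure_tensor s t x 0 = 0"
  using pure_tensor_bilinear(1)[of s t 0 0 y] pure_tensor_bilinear(2)[of s t x 0 0] by simp_all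

lemma pure_tensor_uminus:
  "pure_tensor s t (- x) y = - pure_tensor s t x y" "pure_tensor s t x (- y) = - pure_tensor s t x y"
  using pure_tensor_bilinear(1)[of s t x "- x" y] pure_tensor_bilinear(2)[of s t x y "- y"]
  by (simp_all add: eq_neg_iff_add_eq_0 add.commute)

lemma pure_tensor_diff:
  "pure_tensor s t (x - x') y = pure_tensor s t x y - pure_tensor s t x' y"
  "pure_tensor s t x (y - y') = pure_tensor s t x y - pure_tensor s t x y'"
  using pure_tensor_bilinear(1)[of s t x "- x'" y] pure_tensor_bilinear(2)[of s t x y "- y'"]
  by (simp_all add: pure_tensor_uminus)

lemma linear_on_pure_tensor:
  "linear_on s tensor_scale C UNIV (\<lambda>x. pure_tensor s t x y)"
  "linear_on t tensor_scale D UNIV (pure_tensor s t x)"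
  by (auto simp: linear_on_def pure_tensor_bilinear)

lemma pure_tensor_in_tensor_span: "x \<in> C \<Longrightarrow> y \<in> D \<Longrightarrow> pure_tensor s t x y \<in> tensor_span s t C D"
  by (rule tensor.span_base, intro CollectI exI conjI, rule refl)

lemma pure_tensor_in_graded_part:
  "x \<in> U m \<Longrightarrow> y \<in> W n \<Longrightarrow> \<phi> m n = p \<Longrightarrow> pure_tensor s t x y \<in>
    module.span tensor_scale {pure_tensor s t x y |x y m n. x \<in> U m \<and> y \<in> W n \<and> \<phi> m n = p}"
  by (rule tensor.span_base, intro CollectI exI conjI, rule refl)

lemma tensor_span_mono:
  "C \<subseteq> C' \<Longrightarrow> D \<subseteq> D' \<Longrightarrow> tensor_span s t C D \<subseteq> tensor_span s t C' D'"
  by (rule tensor.span_mono) blast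

lemma tensor_span_span:
  fixes s :: "'k::field \<Rightarrow> 'v::ab_group_add \<Rightarrow> 'v" and t :: "'k \<Rightarrow> 'w::ab_group_add \<Rightarrow> 'w"
  assumes "vector_space s" "vector_space t"
  shows "tensor_span s t (module.span s S) (module.span t S') = tensor_span s t S S'"
proof
  interpret s: vector_space s by fact
  interpret t: vector_space t by fact
  have *: "pure_tensor s t x y \<in> tensor_span s t S S'" if "x \<in> s.span S" "y \<in> S'" for x y
    by (rule linear_on_span_into[OF assms(1) vector_space_tensor_scale linear_on_pure_tensor(1)
          s.subspace_UNIV subset_UNIV tensor.subspace_span _ that(1)])
      (rule pure_tensor_in_tensor_span[OF _ that(2)])
  have **: "pure_tensor s t x y \<in> tensor_span s t S S'" if "x \<in> s.span S" "y \<in> t.span S'" for x y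
    by (rule linear_on_span_into[OF assms(2) vector_space_tensor_scale linear_on_pure_tensor(2)
          t.subspace_UNIV subset_UNIV tensor.subspace_span _ that(2)])
      (rule *[OF that(1)])
  show "tensor_span s t (s.span S) (t.span S') \<subseteq> tensor_span s t S S'"
    by (intro tensor.span_minimal tensor.subspace_span subsetI) (elim CollectE exE conjE, simp only: **)
  show "tensor_span s t S S' \<subseteq> tensor_span s t (s.span S) (t.span S')"
    by (intro tensor_span_mono s.span_superset t.span_superset)
qed

lemma pure_tensors_subset:
  "C' \<subseteq> C \<Longrightarrow> D' \<subseteq> D \<Longrightarrow>
    {pure_tensor s t x y |x y. x \<in> C' \<and> y \<in> D'} \<subseteq> tensor_span s t C D"
  using tensor_span_mono tensor.span_superset by (rule order_trans[rotated])

lemma linear_on_eq_on_tensor_span: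
  fixes f g :: "('k::field, 'v::ab_group_add, 'w::ab_group_add) tensor \<Rightarrow> 'x::ab_group_add"
  assumes "linear_on tensor_scale r (tensor_span s t C D) E f"
    "linear_on tensor_scale r (tensor_span s t C D) E' g"
    "\<And>x y. x \<in> C' \<Longrightarrow> y \<in> D' \<Longrightarrow> f (pure_tensor s t x y) = g (pure_tensor s t x y)"
    "C' \<subseteq> C" "D' \<subseteq> D" "T \<in> tensor_span s t C' D'"
  shows "f T = g T"
  by (rule linear_on_eq_on_span[OF vector_space_tensor_scale assms(1,2) tensor.subspace_span
        pure_tensors_subset[OF assms(4,5)] _ assms(6)])
    (elim CollectE exE conjE, simp only: assms(3))

lemma linear_on_tensor_span_into:
  fixes f :: "('k::field, 'v::ab_group_add, 'w::ab_group_add) tensor \<Rightarrow> 'x::ab_group_add"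
  assumes "vector_space r" "linear_on tensor_scale r (tensor_span s t C D) F f"
    "module.subspace r E"
    "\<And>x y. x \<in> C' \<Longrightarrow> y \<in> D' \<Longrightarrow> f (pure_tensor s t x y) \<in> E"
    "C' \<subseteq> C" "D' \<subseteq> D" "T \<in> tensor_span s t C' D'"
  shows "f T \<in> E"
  by (rule linear_on_span_into[OF vector_space_tensor_scale assms(1,2) tensor.subspace_span
        pure_tensors_subset[OF assms(5,6)] assms(3) _ assms(7)])
    (elim CollectE exE conjE, simp only: assms(4))

lemma tensor_span_graded:
  assumes "vector_space s" "vector_space t" "internal_direct_sum s C U" "internal_direct_sum t D W"
  shows "tensor_span s t C D = tensor_span s t (\<Union>m. U m) (\<Union>n. W n)"
  unfolding internal_direct_sum_subspace(4)[OF assms(1,3)] internal_direct_sum_subspace(4)[OF assms(2,4)]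
  by (rule tensor_span_span[OF assms(1,2)])

text \<open>\<open>\<phi>\<close> merges a pair of degrees into one. The projection onto the part
  with \<open>\<phi> m n = p\<close> is the lift of the bilinear maps that keep the pure tensor for
  such pairs and vanish for all others.\<close>

lemma internal_direct_sum_tensor:
  fixes s :: "'k::field \<Rightarrow> 'v::ab_group_add \<Rightarrow> 'v" and t :: "'k \<Rightarrow> 'w::ab_group_add \<Rightarrow> 'w"
  assumes vs: "vector_space s" "vector_space t"
    and U: "internal_direct_sum s C U" and W: "internal_direct_sum t D W"
  shows "internal_direct_sum tensor_scale (tensor_span s t C D)
    (\<lambda>p. module.span tensor_scale {pure_tensor s t x y |x y m n. x \<in> U m \<and> y \<in> W n \<and> \<phi> m n = p})"
    (is "internal_direct_sum _ _ ?T")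
proof (rule internal_direct_sumI[OF vector_space_tensor_scale])
  show "tensor_span s t C D = tensor.span (\<Union>p. ?T p)"
  proof
    show "tensor_span s t C D \<subseteq> tensor.span (\<Union>p. ?T p)"
      unfolding tensor_span_graded[OF assms]
      by (intro tensor.span_minimal tensor.subspace_span subsetI, elim CollectE exE conjE UN_E)
        (simp only:, rule tensor.span_base, rule UN_I[OF UNIV_I],
          rule pure_tensor_in_graded_part[where U = U and W = W and \<phi> = \<phi>, OF _ _ refl])
    have "?T p \<subseteq> tensor_span s t C D" for p
      by (rule tensor.span_mono)
        (use internal_direct_sum_subspace(3)[OF vs(1) U] internal_direct_sum_subspace(3)[OF vs(2) W] in blast)
    then show "tensor.span (\<Union>p. ?T p) \<subseteq> tensor_span s t C D"
      by (rule tensor.span_minimal[OF UN_least tensor.subspace_span])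
  qed
  fix p
  let ?F = "\<lambda>m n x y. if \<phi> m n = p then pure_tensor s t x y else 0"
  have "linear_on t tensor_scale (W n) UNIV (?F m n x)"
    "linear_on s tensor_scale (U m) UNIV (\<lambda>x. ?F m n x y)" for m n x y
    by (simp_all add: linear_on_def pure_tensor_bilinear)
  then obtain h where h: "Vector_Spaces.linear tensor_scale tensor_scale h"
    "\<And>m n x y. x \<in> U m \<Longrightarrow> y \<in> W n \<Longrightarrow>
       h (pure_tensor s t x y) = (if \<phi> m n = p then pure_tensor s t x y else 0)"
    using tensor_lift[OF vs vector_space_tensor_scale U W, of ?F] by blast
  have "h T = (if q = p then T else 0)" if "T \<in> ?T q" for q T
  proof (rule linear_on_eq_on_span[OF vector_space_tensor_scale linear_imp_linear_on[OF h(1)]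
        _ tensor.subspace_UNIV subset_UNIV _ that])
    show "linear_on tensor_scale tensor_scale UNIV UNIV (\<lambda>T. if q = p then T else 0)"
      by (simp add: linear_on_def)
  qed (elim CollectE exE conjE, simp only: h(2))
  with h(1) show "\<exists>h. Vector_Spaces.linear tensor_scale tensor_scale h \<and>
      (\<forall>q. \<forall>T\<in>?T q. h T = (if q = p then T else 0))" by blast
qed (rule tensor.subspace_span)

lemma tensor_lift3_left:
  fixes s :: "'k::field \<Rightarrow> 'v::ab_group_add \<Rightarrow> 'v" and t :: "'k \<Rightarrow> 'w::ab_group_add \<Rightarrow> 'w"
    and u :: "'k \<Rightarrow> 'u::ab_group_add \<Rightarrow> 'u" and r :: "'k \<Rightarrow> 'x::ab_group_add \<Rightarrow> 'x"
  assumes vs: "vector_space s" "vector_space t" "vector_space u" "vector_space r"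
    and U: "internal_direct_sum s C U" and W: "internal_direct_sum t D W"
    and Z: "internal_direct_sum u E Z"
    and F: "\<And>l m n y z. y \<in> W m \<Longrightarrow> z \<in> Z n \<Longrightarrow> linear_on s r (U l) UNIV (\<lambda>x. F l m n x y z)"
      "\<And>l m n x z. x \<in> U l \<Longrightarrow> z \<in> Z n \<Longrightarrow> linear_on t r (W m) UNIV (\<lambda>y. F l m n x y z)"
      "\<And>l m n x y. x \<in> U l \<Longrightarrow> y \<in> W m \<Longrightarrow> linear_on u r (Z n) UNIV (\<lambda>z. F l m n x y z)"
  shows "\<exists>h. Vector_Spaces.linear tensor_scale r h \<and> (\<forall>l m n. \<forall>x\<in>U l. \<forall>y\<in>W m. \<forall>z\<in>Z n.
    h (pure_tensor tensor_scale u (pure_tensor s t x y) z) = F l m n x y z)"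
proof -
  interpret r: vector_space r by fact
  define Q where "Q = (\<lambda>n z h. Vector_Spaces.linear tensor_scale r h \<and>
      (\<forall>l m. \<forall>x\<in>U l. \<forall>y\<in>W m. h (pure_tensor s t x y) = F l m n x y z))"
  define H where "H = (\<lambda>n z. SOME h. Q n z h)"
  have "\<exists>h. Q n z h" if "z \<in> Z n" for n z
    unfolding Q_def using that F(1,2) by (intro tensor_lift[OF vs(1,2,4) U W, of "\<lambda>l m x y. F l m n x y z"])
  then have QH: "Q n z (H n z)" if "z \<in> Z n" for n z
    unfolding H_def by (rule someI_ex) (rule that)
  have H: "Vector_Spaces.linear tensor_scale r (H n z)"
    "\<And>l m x y. x \<in> U l \<Longrightarrow> y \<in> W m \<Longrightarrow> H n z (pure_tensor s t x y) = F l m n x y z"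
    if "z \<in> Z n" for n z
    using QH[OF that] unfolding Q_def by simp_all
  have lin: "linear_on tensor_scale r UNIV UNIV (H n z)" if "z \<in> Z n" for n z
    using linear_imp_linear_on[OF H(1)[OF that]] .
  note Z' = internal_direct_sum_subspace(1)[OF vs(3) Z]
  interpret u: vector_space u by fact
  have eqI: "H n z T = f T" if "z \<in> Z n" "linear_on tensor_scale r UNIV UNIV f" "T \<in> tensor_span s t C D"
    "\<And>l m x y. x \<in> U l \<Longrightarrow> y \<in> W m \<Longrightarrow> F l m n x y z = f (pure_tensor s t x y)" for n z f T
    by (rule linear_on_eq_on_span[OF vector_space_tensor_scale lin[OF that(1)] that(2)
          tensor.subspace_UNIV subset_UNIV _ that(3)[unfolded tensor_span_graded[OF vs(1,2) U W]]])
      (elim CollectE exE conjE UN_E, simp only: H(2)[OF that(1)] that(4))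
  \<comment> \<open>Outside \<open>tensor_span s t C D\<close> the choice of \<open>H n z\<close> is
    arbitrary, so linearity in \<open>z\<close> is claimed only for \<open>T\<close> in this span.
    The second lift therefore takes the span, as a one-part direct sum, for its first
    factor.\<close>
  have "linear_on u r (Z n) UNIV (\<lambda>z. H n z T)" if T: "T \<in> tensor_span s t C D" for n T
    unfolding linear_on_def
  proof (intro conjI ballI allI UNIV_I)
    fix z z' assume z: "z \<in> Z n" "z' \<in> Z n"
    have "F l m n x y (z + z') = H n z (pure_tensor s t x y) + H n z' (pure_tensor s t x y)"
      if "x \<in> U l" "y \<in> W m" for l m x y
      unfolding H(2)[OF z(1) that] H(2)[OF z(2) that] by (rule linear_onD(2)[OF F(3)[OF that] z])
    with z show "H n (z + z') T = H n z T + H n z' T"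
      by (intro eqI[OF _ linear_on_add[OF vs(4) lin lin] T] u.subspace_add[OF Z'])
  next
    fix c z assume z: "z \<in> Z n"
    have "F l m n x y (u c z) = r c (H n z (pure_tensor s t x y))"
      if "x \<in> U l" "y \<in> W m" for l m x y
      unfolding H(2)[OF z that] by (rule linear_onD(3)[OF F(3)[OF that] z])
    with z show "H n (u c z) T = r c (H n z T)"
      by (intro eqI[OF _ linear_on_scale[OF vs(4) lin] T] u.subspace_scale[OF Z'])
  qed
  then have "\<exists>h. Vector_Spaces.linear tensor_scale r h \<and> (\<forall>(m::unit) n. \<forall>T\<in>tensor_span s t C D.
      \<forall>z\<in>Z n. h (pure_tensor tensor_scale u T z) = H n z T)"
    by (intro tensor_lift[OF vector_space_tensor_scale vs(3,4)
        internal_direct_sum_single[OF vector_space_tensor_scale tensor.subspace_span] Z,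
        where F = "\<lambda>_ n T z. H n z T"] linear_on_weaken[OF lin subset_UNIV subset_UNIV])
  then obtain h where h: "Vector_Spaces.linear tensor_scale r h"
    "\<And>n T z. T \<in> tensor_span s t C D \<Longrightarrow> z \<in> Z n \<Longrightarrow> h (pure_tensor tensor_scale u T z) = H n z T"
    by auto
  have sub: "U l \<subseteq> C" "W m \<subseteq> D" for l m
    using internal_direct_sum_subspace(3)[OF vs(1) U] internal_direct_sum_subspace(3)[OF vs(2) W] by auto
  then show ?thesis
    using h(1) by (intro exI[of _ h] conjI allI ballI)
      (simp_all add: h(2)[OF pure_tensor_in_tensor_span[OF subsetD[OF sub(1)] subsetD[OF sub(2)]]] H(2))
qed

text \<open>Reduces to \<open>tensor_lift3_left\<close> for the factors in the order
  \<open>t\<close>, \<open>u\<close>, \<open>s\<close>, precomposed with the plain swap of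
  \<open>x\<close> and the inner tensor.\<close>

lemma tensor_lift3_right:
  fixes s :: "'k::field \<Rightarrow> 'v::ab_group_add \<Rightarrow> 'v" and t :: "'k \<Rightarrow> 'w::ab_group_add \<Rightarrow> 'w"
    and u :: "'k \<Rightarrow> 'u::ab_group_add \<Rightarrow> 'u" and r :: "'k \<Rightarrow> 'x::ab_group_add \<Rightarrow> 'x"
  assumes vs: "vector_space s" "vector_space t" "vector_space u" "vector_space r"
    and U: "internal_direct_sum s C U" and W: "internal_direct_sum t D W"
    and Z: "internal_direct_sum u E Z"
    and F: "\<And>l m n y z. y \<in> W m \<Longrightarrow> z \<in> Z n \<Longrightarrow> linear_on s r (U l) UNIV (\<lambda>x. F l m n x y z)"
      "\<And>l m n x z. x \<in> U l \<Longrightarrow> z \<in> Z n \<Longrightarrow> linear_on t r (W m) UNIV (\<lambda>y. F l m n x y z)"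
      "\<And>l m n x y. x \<in> U l \<Longrightarrow> y \<in> W m \<Longrightarrow> linear_on u r (Z n) UNIV (\<lambda>z. F l m n x y z)"
  shows "\<exists>h. Vector_Spaces.linear tensor_scale r h \<and> (\<forall>l m n. \<forall>x\<in>U l. \<forall>y\<in>W m. \<forall>z\<in>Z n.
    h (pure_tensor s tensor_scale x (pure_tensor t u y z)) = F l m n x y z)"
proof -
  obtain g where g: "Vector_Spaces.linear tensor_scale r g"
    "\<And>l m n x y z. x \<in> U l \<Longrightarrow> y \<in> W m \<Longrightarrow> z \<in> Z n \<Longrightarrow>
      g (pure_tensor tensor_scale s (pure_tensor t u y z) x) = F l m n x y z"
    using tensor_lift3_left[OF vs(2,3,1,4) W Z U, of "\<lambda>m n l y z x. F l m n x y z", OF F(2,3,1)]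
    by blast
  interpret s: vector_space s by fact
  obtain h where h: "Vector_Spaces.linear tensor_scale tensor_scale h"
    "\<And>x (T :: ('k, 'w, 'u) tensor). h (pure_tensor s tensor_scale x T) = pure_tensor tensor_scale s T x"
    using tensor_lift[OF vs(1) vector_space_tensor_scale vector_space_tensor_scale
        internal_direct_sum_single[OF vs(1) s.subspace_UNIV]
        internal_direct_sum_single[OF vector_space_tensor_scale tensor.subspace_UNIV],
        of "\<lambda>_ _ x T. pure_tensor tensor_scale s T x"]
    using linear_on_pure_tensor by blast
  have "Vector_Spaces.linear tensor_scale r (g \<circ> h)"
    using Vector_Spaces.linear_compose[OF h(1) g(1)] .
  then show ?thesis
    by (intro exI[of _ "g \<circ> h"] conjI allI ballI) (simp_all add: g(2) h(2))
qed

section \<open>Structure maps of the monoidal category\<close>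

definition vsp :: "('g, 'k::field, 'v::ab_group_add, 'z) yd_scheme \<Rightarrow> bool"
  where "vsp V \<longleftrightarrow> vector_space (scl V) \<and> module.subspace (scl V) (carr V)"

text \<open>Keeps the grading of a module and forgets the action. The structure maps are determined
  by their values on homogeneous pure tensors, so uniqueness arguments run on this notion, which
  passes to tensor products by \<open>hsp_tensor\<close>.\<close>

definition hsp :: "('g, 'k::field, 'v::ab_group_add, 'z) yd_scheme \<Rightarrow> bool"
  where "hsp V \<longleftrightarrow> vector_space (scl V) \<and> internal_direct_sum (scl V) (carr V) (hpart V)"

abbreviation Lin :: "('g, 'k::field, 'v::ab_group_add, 'y) yd_scheme
    \<Rightarrow> ('g, 'k, 'w::ab_group_add, 'z) yd_scheme \<Rightarrow> ('v \<Rightarrow> 'w) \<Rightarrow> bool"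
  where "Lin V W f \<equiv> linear_on (scl V) (scl W) (carr V) (carr W) f"

definition hmap :: "('g, 'k::field, 'v::ab_group_add, 'y) yd_scheme
    \<Rightarrow> ('g, 'k, 'w::ab_group_add, 'z) yd_scheme \<Rightarrow> ('v \<Rightarrow> 'w) \<Rightarrow> bool"
  where "hmap V W f \<longleftrightarrow> Lin V W f \<and> (\<forall>g. \<forall>v\<in>hpart V g. f v \<in> hpart W g)"

lemma vspD: "vsp V \<Longrightarrow> vector_space (scl V)" "vsp V \<Longrightarrow> module.subspace (scl V) (carr V)"
  by (auto simp: vsp_def)

lemma hspD: "hsp V \<Longrightarrow> vector_space (scl V)"
  "hsp V \<Longrightarrow> internal_direct_sum (scl V) (carr V) (hpart V)"
  by (auto simp: hsp_def)

lemma hsp_imp_vsp: "hsp V \<Longrightarrow> vsp V"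
  using internal_direct_sum_subspace(2)[of "scl V" "carr V" "hpart V"] by (simp add: hsp_def vsp_def)

lemma hpart_subset: "hsp V \<Longrightarrow> hpart V g \<subseteq> carr V"
  using internal_direct_sum_subspace(3)[of "scl V" "carr V" "hpart V"] by (simp add: hsp_def)

lemma hpart_carr: "hsp V \<Longrightarrow> x \<in> hpart V g \<Longrightarrow> x \<in> carr V"
  by (rule subsetD[OF hpart_subset])

lemma yd_module_hsp: "yd_module \<Phi> V \<Longrightarrow> hsp V"
  by (auto simp: yd_module_def hsp_def)

lemma hmapD: "hmap V W f \<Longrightarrow> Lin V W f" "hmap V W f \<Longrightarrow> v \<in> hpart V g \<Longrightarrow> f v \<in> hpart W g"
  by (auto simp: hmap_def)

lemma yd_hom_hmap: "yd_hom V W f \<Longrightarrow> hmap V W f"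
  by (auto simp: hmap_def yd_hom_def)

lemma hmap_id: "hmap V V id"
  by (auto simp: hmap_def linear_on_id)

lemma yd_tensor_simps [simp]:
  "scl (yd_tensor \<Phi> V W) = tensor_scale"
  "carr (yd_tensor \<Phi> V W) = tensor_span (scl V) (scl W) (carr V) (carr W)"
  "hpart (yd_tensor \<Phi> V W) g = module.span tensor_scale
       {ptens V W x y |x y e f. x \<in> hpart V e \<and> y \<in> hpart W f \<and> e + f = g}"
  by (simp_all add: yd_tensor_def)

lemma yd_unit_simps [simp]:
  "scl yd_unit = (*)" "carr yd_unit = UNIV" "hpart yd_unit g = (if g = 0 then UNIV else {0})"
  "act yd_unit e c = c"
  by (simp_all add: yd_unit_def)

lemma vsp_tensor: "vsp (yd_tensor \<Phi> V W)"
  by (simp add: vsp_def vector_space_tensor_scale)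

lemma vsp_unit: "vsp yd_unit"
proof -
  interpret vector_space "(*) :: 'b \<Rightarrow> 'b \<Rightarrow> 'b" by (rule vector_space_mult)
  show "vsp (yd_unit :: ('a, 'b, 'b) yd)" by (simp add: vsp_def vector_space_mult)
qed

lemma hsp_tensor:
  assumes "hsp V" "hsp W"
  shows "hsp (yd_tensor \<Phi> V W)"
proof -
  have "hpart (yd_tensor \<Phi> V W) = (\<lambda>g. module.span tensor_scale
       {ptens V W x y |x y e f. x \<in> hpart V e \<and> y \<in> hpart W f \<and> e + f = g})"
    by (simp add: yd_tensor_def)
  then show ?thesis
    using internal_direct_sum_tensor[OF hspD(1)[OF assms(1)] hspD(1)[OF assms(2)]
        hspD(2)[OF assms(1)] hspD(2)[OF assms(2)], of "(+)"]
    unfolding hsp_def by (simp only: yd_tensor_simps vector_space_tensor_scale simp_thms)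
qed

lemma ptens_carr: "x \<in> carr V \<Longrightarrow> y \<in> carr W \<Longrightarrow> ptens V W x y \<in> carr (yd_tensor \<Phi> V W)"
  by (simp add: pure_tensor_in_tensor_span)

lemma ptens_hpart:
  "x \<in> hpart V e \<Longrightarrow> y \<in> hpart W f \<Longrightarrow> ptens V W x y \<in> hpart (yd_tensor \<Phi> V W) (e + f)"
  unfolding yd_tensor_simps by (rule pure_tensor_in_graded_part) auto

lemma tensor_eqI:
  fixes F G :: "('k::field, 'v::ab_group_add, 'w::ab_group_add) tensor \<Rightarrow> 'x::ab_group_add"
  assumes "hsp V" "hsp W"
    and F: "linear_on tensor_scale r (carr (yd_tensor \<Phi> V W)) E F"
    and G: "linear_on tensor_scale r (carr (yd_tensor \<Phi> V W)) E' G"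
    and eq: "\<And>e f x y. x \<in> hpart V e \<Longrightarrow> y \<in> hpart W f \<Longrightarrow> F (ptens V W x y) = G (ptens V W x y)"
    and T: "T \<in> carr (yd_tensor \<Phi> V W)"
  shows "F T = G T"
proof -
  have T': "T \<in> tensor_span (scl V) (scl W) (\<Union>g. hpart V g) (\<Union>g. hpart W g)"
    using T tensor_span_graded[OF hspD(1)[OF assms(1)] hspD(1)[OF assms(2)]
        hspD(2)[OF assms(1)] hspD(2)[OF assms(2)]] by simp
  show ?thesis
    by (rule linear_on_eq_on_tensor_span[OF F[unfolded yd_tensor_simps] G[unfolded yd_tensor_simps]
          _ UN_least[OF hpart_subset[OF assms(1)]] UN_least[OF hpart_subset[OF assms(2)]] T'])
      (elim UN_E, rule eq)
qed

lemma tensor_map_props: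
  assumes "vsp V" "vsp W" "linear_on (scl V) (scl X) (carr V) UNIV p"
    "linear_on (scl W) (scl Y) (carr W) UNIV q"
  shows "Vector_Spaces.linear tensor_scale tensor_scale (tensor_map V W X Y p q)"
    and "\<And>x y. x \<in> carr V \<Longrightarrow> y \<in> carr W \<Longrightarrow> tensor_map V W X Y p q (ptens V W x y) = ptens X Y (p x) (q y)"
proof -
  have "\<exists>h. Vector_Spaces.linear tensor_scale tensor_scale h \<and>
      (\<forall>(m::unit) (n::unit). \<forall>x\<in>carr V. \<forall>y\<in>carr W. h (ptens V W x y) = ptens X Y (p x) (q y))"
    by (rule tensor_lift[OF vspD(1)[OF assms(1)] vspD(1)[OF assms(2)] vector_space_tensor_scale
          internal_direct_sum_single[OF vspD[OF assms(1)]] internal_direct_sum_single[OF vspD[OF assms(2)]]])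
      (use assms(3,4) in \<open>simp_all add: linear_on_def pure_tensor_bilinear\<close>)
  then have "\<exists>h. Vector_Spaces.linear tensor_scale tensor_scale h \<and>
      (\<forall>x\<in>carr V. \<forall>y\<in>carr W. h (ptens V W x y) = ptens X Y (p x) (q y))" by simp
  from someI_ex[OF this, folded tensor_map_def]
  show "Vector_Spaces.linear tensor_scale tensor_scale (tensor_map V W X Y p q)"
    and "\<And>x y. x \<in> carr V \<Longrightarrow> y \<in> carr W \<Longrightarrow> tensor_map V W X Y p q (ptens V W x y) = ptens X Y (p x) (q y)"
    by auto
qed

text \<open>\<open>\<Phi>\<close> and \<open>\<Phi>'\<close> are unrelated: the cocycle enters the
  action on a tensor product, but not its carrier, grading or scalar multiplication.\<close>

lemma Lin_tensor_map:
  assumes "vsp V" "vsp W" "Lin V X p" "Lin W Y q"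
  shows "Lin (yd_tensor \<Phi> V W) (yd_tensor \<Phi>' X Y) (tensor_map V W X Y p q)"
    and "\<And>x y. x \<in> carr V \<Longrightarrow> y \<in> carr W \<Longrightarrow> tensor_map V W X Y p q (ptens V W x y) = ptens X Y (p x) (q y)"
proof -
  note * = tensor_map_props[OF assms(1,2) linear_on_weaken[OF assms(3) order_refl subset_UNIV]
    linear_on_weaken[OF assms(4) order_refl subset_UNIV]]
  show "\<And>x y. x \<in> carr V \<Longrightarrow> y \<in> carr W \<Longrightarrow> tensor_map V W X Y p q (ptens V W x y) = ptens X Y (p x) (q y)"
    by (rule *(2))
  have "tensor_map V W X Y p q T \<in> carr (yd_tensor \<Phi>' X Y)" if "T \<in> carr (yd_tensor \<Phi> V W)" for T
  proof (rule linear_on_tensor_span_into[OF vector_space_tensor_scale linear_imp_linear_on[OF *(1)]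
        _ _ order_refl order_refl that[unfolded yd_tensor_simps]])
    show "tensor.subspace (carr (yd_tensor \<Phi>' X Y))" by simp
    fix x y assume "x \<in> carr V" "y \<in> carr W"
    then show "tensor_map V W X Y p q (ptens V W x y) \<in> carr (yd_tensor \<Phi>' X Y)"
      using ptens_carr[OF linear_onD(1)[OF assms(3)] linear_onD(1)[OF assms(4)]] by (simp only: *(2))
  qed
  then show "Lin (yd_tensor \<Phi> V W) (yd_tensor \<Phi>' X Y) (tensor_map V W X Y p q)"
    using linear_imp_linear_on[OF *(1)] unfolding linear_on_def yd_tensor_simps(1) by blast
qed

lemma hmap_tensor_map:
  assumes "hsp V" "hsp W" "hmap V X p" "hmap W Y q"
  shows "hmap (yd_tensor \<Phi> V W) (yd_tensor \<Phi>' X Y) (tensor_map V W X Y p q)"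
proof -
  note vs = hsp_imp_vsp[OF assms(1)] hsp_imp_vsp[OF assms(2)]
  note L = Lin_tensor_map[OF vs hmapD(1)[OF assms(3)] hmapD(1)[OF assms(4)]]
  have "tensor_map V W X Y p q T \<in> hpart (yd_tensor \<Phi>' X Y) g"
    if "T \<in> hpart (yd_tensor \<Phi> V W) g" for T g
  proof (rule linear_on_span_into[OF vector_space_tensor_scale vector_space_tensor_scale
        linear_imp_linear_on[OF tensor_map_props(1)] tensor.subspace_UNIV subset_UNIV
        _ _ that[unfolded yd_tensor_simps]])
    show "vsp V" "vsp W" by fact+
    show "linear_on (scl V) (scl X) (carr V) UNIV p" "linear_on (scl W) (scl Y) (carr W) UNIV q"
      by (rule linear_on_weaken[OF hmapD(1)[OF assms(3)] order_refl subset_UNIV],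
          rule linear_on_weaken[OF hmapD(1)[OF assms(4)] order_refl subset_UNIV])
    show "tensor.subspace (hpart (yd_tensor \<Phi>' X Y) g)" by simp
    fix T assume "T \<in> {ptens V W x y |x y e f. x \<in> hpart V e \<and> y \<in> hpart W f \<and> e + f = g}"
    then obtain x y e f where T: "T = ptens V W x y" "x \<in> hpart V e" "y \<in> hpart W f" "e + f = g"
      by blast
    then show "tensor_map V W X Y p q T \<in> hpart (yd_tensor \<Phi>' X Y) g"
      using ptens_hpart[OF hmapD(2)[OF assms(3) T(2)] hmapD(2)[OF assms(4) T(3)]] L(2)
        hpart_carr[OF assms(1) T(2)] hpart_carr[OF assms(2) T(3)] T(1,4) by simp
  qed
  then show ?thesis unfolding hmap_def using L(1) by blast
qed

lemma hmapI_tensor: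
  assumes "hsp V" "hsp W" "hsp Y" and h: "Vector_Spaces.linear tensor_scale (scl Y) h"
    and val: "\<And>e f x y. x \<in> hpart V e \<Longrightarrow> y \<in> hpart W f \<Longrightarrow> h (ptens V W x y) \<in> hpart Y (e + f)"
  shows "hmap (yd_tensor \<Phi> V W) Y h"
proof -
  note ids = internal_direct_sum_subspace[OF hspD[OF assms(3)]]
  have "h T \<in> carr Y" if T: "T \<in> carr (yd_tensor \<Phi> V W)" for T
  proof (rule linear_on_span_into[OF vector_space_tensor_scale hspD(1)[OF assms(3)]
        linear_imp_linear_on[OF h] tensor.subspace_UNIV subset_UNIV ids(2)])
    show "T \<in> tensor_span (scl V) (scl W) (\<Union>g. hpart V g) (\<Union>g. hpart W g)"
      using T tensor_span_graded[OF hspD(1)[OF assms(1)] hspD(1)[OF assms(2)]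
        hspD(2)[OF assms(1)] hspD(2)[OF assms(2)]] by simp
    fix T assume "T \<in> {ptens V W x y |x y. x \<in> (\<Union>g. hpart V g) \<and> y \<in> (\<Union>g. hpart W g)}"
    then obtain x y e f where "T = ptens V W x y" "x \<in> hpart V e" "y \<in> hpart W f" by blast
    then show "h T \<in> carr Y" using subsetD[OF ids(3) val] by simp
  qed
  moreover have "h T \<in> hpart Y g" if T: "T \<in> hpart (yd_tensor \<Phi> V W) g" for T g
  proof (rule linear_on_span_into[OF vector_space_tensor_scale hspD(1)[OF assms(3)]
        linear_imp_linear_on[OF h] tensor.subspace_UNIV subset_UNIV ids(1) _ T[unfolded yd_tensor_simps]])
    fix T assume "T \<in> {ptens V W x y |x y e f. x \<in> hpart V e \<and> y \<in> hpart W f \<and> e + f = g}"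
    then obtain x y e f where "T = ptens V W x y" "x \<in> hpart V e" "y \<in> hpart W f" "e + f = g" by blast
    then show "h T \<in> hpart Y g" using val by auto
  qed
  moreover have "linear_on tensor_scale (scl Y) (carr (yd_tensor \<Phi> V W)) UNIV h"
    using h by (rule linear_imp_linear_on)
  ultimately show ?thesis unfolding hmap_def linear_on_def yd_tensor_simps(1) by simp
qed

lemma hmapI_tensor3_left:
  assumes "hsp V" "hsp W" "hsp X" "hsp Y" and h: "Vector_Spaces.linear tensor_scale (scl Y) h"
    and val: "\<And>e f g x y z. x \<in> hpart V e \<Longrightarrow> y \<in> hpart W f \<Longrightarrow> z \<in> hpart X g \<Longrightarrow>
      h (ptens (yd_tensor \<Phi> V W) X (ptens V W x y) z) \<in> hpart Y (e + f + g)"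
  shows "hmap (yd_tensor \<Phi>' (yd_tensor \<Phi> V W) X) Y h"
proof (rule hmapI_tensor[OF hsp_tensor[OF assms(1,2)] assms(3,4) h])
  fix e g T z assume T: "T \<in> hpart (yd_tensor \<Phi> V W) e" and z: "z \<in> hpart X g"
  have lin: "linear_on tensor_scale (scl Y) UNIV UNIV (\<lambda>T. h (ptens (yd_tensor \<Phi> V W) X T z))"
    using linear_on_comp[OF linear_on_pure_tensor(1) linear_imp_linear_on[OF h]] by simp
  show "h (ptens (yd_tensor \<Phi> V W) X T z) \<in> hpart Y (e + g)"
  proof (rule linear_on_span_into[OF vector_space_tensor_scale hspD(1)[OF assms(4)] lin
        tensor.subspace_UNIV subset_UNIV internal_direct_sum_subspace(1)[OF hspD[OF assms(4)]]
        _ T[unfolded yd_tensor_simps]])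
    fix T assume "T \<in> {ptens V W x y |x y a b. x \<in> hpart V a \<and> y \<in> hpart W b \<and> a + b = e}"
    then obtain x y a b where "T = ptens V W x y" "x \<in> hpart V a" "y \<in> hpart W b" "a + b = e" by blast
    then show "h (ptens (yd_tensor \<Phi> V W) X T z) \<in> hpart Y (e + g)" using val z by auto
  qed
qed

lemma hmapI_tensor3_right:
  assumes "hsp V" "hsp W" "hsp X" "hsp Y" and h: "Vector_Spaces.linear tensor_scale (scl Y) h"
    and val: "\<And>e f g x y z. x \<in> hpart V e \<Longrightarrow> y \<in> hpart W f \<Longrightarrow> z \<in> hpart X g \<Longrightarrow>
      h (ptens V (yd_tensor \<Phi> W X) x (ptens W X y z)) \<in> hpart Y (e + (f + g))"
  shows "hmap (yd_tensor \<Phi>' V (yd_tensor \<Phi> W X)) Y h"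
proof (rule hmapI_tensor[OF assms(1) hsp_tensor[OF assms(2,3)] assms(4) h])
  fix e g T x assume T: "T \<in> hpart (yd_tensor \<Phi> W X) g" and x: "x \<in> hpart V e"
  have lin: "linear_on tensor_scale (scl Y) UNIV UNIV (\<lambda>T. h (ptens V (yd_tensor \<Phi> W X) x T))"
    using linear_on_comp[OF linear_on_pure_tensor(2) linear_imp_linear_on[OF h]] by simp
  show "h (ptens V (yd_tensor \<Phi> W X) x T) \<in> hpart Y (e + g)"
  proof (rule linear_on_span_into[OF vector_space_tensor_scale hspD(1)[OF assms(4)] lin
        tensor.subspace_UNIV subset_UNIV internal_direct_sum_subspace(1)[OF hspD[OF assms(4)]]
        _ T[unfolded yd_tensor_simps]])
    fix T assume "T \<in> {ptens W X x y |x y a b. x \<in> hpart W a \<and> y \<in> hpart X b \<and> a + b = g}"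
    then obtain y z a b where "T = ptens W X y z" "y \<in> hpart W a" "z \<in> hpart X b" "a + b = g" by blast
    then show "h (ptens V (yd_tensor \<Phi> W X) x T) \<in> hpart Y (e + g)" using val x by auto
  qed
qed

lemma tensor3_eqI_left:
  fixes F G :: "('k::field, ('k, 'v::ab_group_add, 'w::ab_group_add) tensor, 'u::ab_group_add) tensor
    \<Rightarrow> 'x::ab_group_add"
  assumes "hsp V" "hsp W" "hsp X"
    and F: "linear_on tensor_scale r (carr (yd_tensor \<Phi>' (yd_tensor \<Phi> V W) X)) E F"
    and G: "linear_on tensor_scale r (carr (yd_tensor \<Phi>' (yd_tensor \<Phi> V W) X)) E' G"
    and eq: "\<And>e f g x y z. x \<in> hpart V e \<Longrightarrow> y \<in> hpart W f \<Longrightarrow> z \<in> hpart X g \<Longrightarrow>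
      F (ptens (yd_tensor \<Phi> V W) X (ptens V W x y) z) = G (ptens (yd_tensor \<Phi> V W) X (ptens V W x y) z)"
    and T: "T \<in> carr (yd_tensor \<Phi>' (yd_tensor \<Phi> V W) X)"
  shows "F T = G T"
proof (rule tensor_eqI[OF hsp_tensor[OF assms(1,2)] assms(3) F G _ T])
  fix e g S z assume S: "S \<in> hpart (yd_tensor \<Phi> V W) e" and z: "z \<in> hpart X g"
  have zX: "z \<in> carr X" using hpart_carr[OF assms(3) z] .
  have pt: "linear_on tensor_scale tensor_scale (carr (yd_tensor \<Phi> V W))
      (carr (yd_tensor \<Phi>' (yd_tensor \<Phi> V W) X)) (\<lambda>T. ptens (yd_tensor \<Phi> V W) X T z)"
    using linear_on_pure_tensor(1)[of tensor_scale "carr (yd_tensor \<Phi> V W)" "scl X" z]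
      ptens_carr[OF _ zX, of _ "yd_tensor \<Phi> V W" \<Phi>']
    unfolding linear_on_def yd_tensor_simps(1) by simp
  show "F (ptens (yd_tensor \<Phi> V W) X S z) = G (ptens (yd_tensor \<Phi> V W) X S z)"
    by (rule tensor_eqI[OF assms(1,2) linear_on_comp[OF pt F] linear_on_comp[OF pt G] _
          hpart_carr[OF hsp_tensor[OF assms(1,2)] S]]) (rule eq[OF _ _ z])
qed

section \<open>Associators, braiding, unitors and action on homogeneous tensors\<close>

lemma associator_props:
  assumes V: "hsp V" and W: "hsp W" and X: "hsp X"
  shows associator_linear: "Vector_Spaces.linear tensor_scale tensor_scale (associator \<Phi> V W X)"
    and associator_ptens: "\<And>e f g x y z. x \<in> hpart V e \<Longrightarrow> y \<in> hpart W f \<Longrightarrow> z \<in> hpart X g \<Longrightarrow>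
      associator \<Phi> V W X (ptens (yd_tensor \<Phi> V W) X (ptens V W x y) z) =
      tensor_scale (inverse (\<Phi> e f g)) (ptens V (yd_tensor \<Phi> W X) x (ptens W X y z))"
    and hmap_associator: "hmap (yd_tensor \<Phi> (yd_tensor \<Phi> V W) X) (yd_tensor \<Phi> V (yd_tensor \<Phi> W X))
      (associator \<Phi> V W X)"
proof -
  have "\<exists>h. Vector_Spaces.linear tensor_scale tensor_scale h \<and>
    (\<forall>e f g. \<forall>x\<in>hpart V e. \<forall>y\<in>hpart W f. \<forall>z\<in>hpart X g.
      h (pure_tensor tensor_scale (scl X) (ptens V W x y) z) =
      tensor_scale (inverse (\<Phi> e f g)) (pure_tensor (scl V) tensor_scale x (ptens W X y z)))"
    by (rule tensor_lift3_left[OF hspD(1)[OF V] hspD(1)[OF W] hspD(1)[OF X] vector_space_tensor_scale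
          hspD(2)[OF V] hspD(2)[OF W] hspD(2)[OF X]])
      (simp_all add: linear_on_def pure_tensor_bilinear tensor.scale_right_distrib mult.commute)
  then have "\<exists>h. Vector_Spaces.linear tensor_scale tensor_scale h \<and>
    (\<forall>e f g. \<forall>x\<in>hpart V e. \<forall>y\<in>hpart W f. \<forall>z\<in>hpart X g.
      h (ptens (yd_tensor \<Phi> V W) X (ptens V W x y) z) =
      tensor_scale (inverse (\<Phi> e f g)) (ptens V (yd_tensor \<Phi> W X) x (ptens W X y z)))"
    unfolding yd_tensor_simps(1) .
  note * = someI_ex[OF this, folded associator_def]
  show 1: "Vector_Spaces.linear tensor_scale tensor_scale (associator \<Phi> V W X)"
    using * by (rule conjunct1)
  show 2: "associator \<Phi> V W X (ptens (yd_tensor \<Phi> V W) X (ptens V W x y) z) =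
      tensor_scale (inverse (\<Phi> e f g)) (ptens V (yd_tensor \<Phi> W X) x (ptens W X y z))"
    if "x \<in> hpart V e" "y \<in> hpart W f" "z \<in> hpart X g" for e f g x y z
    using * that by blast
  show "hmap (yd_tensor \<Phi> (yd_tensor \<Phi> V W) X) (yd_tensor \<Phi> V (yd_tensor \<Phi> W X)) (associator \<Phi> V W X)"
  proof (rule hmapI_tensor3_left[OF V W X hsp_tensor[OF V hsp_tensor[OF W X]]])
    fix e f g x y z assume *: "x \<in> hpart V e" "y \<in> hpart W f" "z \<in> hpart X g"
    then have "ptens V (yd_tensor \<Phi> W X) x (ptens W X y z) \<in>
        hpart (yd_tensor \<Phi> V (yd_tensor \<Phi> W X)) (e + (f + g))" by (intro ptens_hpart)
    then show "associator \<Phi> V W X (ptens (yd_tensor \<Phi> V W) X (ptens V W x y) z) \<in>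
        hpart (yd_tensor \<Phi> V (yd_tensor \<Phi> W X)) (e + f + g)"
      unfolding 2[OF *] add.assoc unfolding yd_tensor_simps(3) by (rule tensor.span_scale)
  qed (simp add: 1)
qed

lemma associator_inv_props:
  assumes V: "hsp V" and W: "hsp W" and X: "hsp X"
  shows associator_inv_linear: "Vector_Spaces.linear tensor_scale tensor_scale (associator_inv \<Phi> V W X)"
    and associator_inv_ptens: "\<And>e f g x y z. x \<in> hpart V e \<Longrightarrow> y \<in> hpart W f \<Longrightarrow> z \<in> hpart X g \<Longrightarrow>
      associator_inv \<Phi> V W X (ptens V (yd_tensor \<Phi> W X) x (ptens W X y z)) =
      tensor_scale (\<Phi> e f g) (ptens (yd_tensor \<Phi> V W) X (ptens V W x y) z)"
    and hmap_associator_inv: "hmap (yd_tensor \<Phi> V (yd_tensor \<Phi> W X)) (yd_tensor \<Phi> (yd_tensor \<Phi> V W) X)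
      (associator_inv \<Phi> V W X)"
proof -
  have "\<exists>h. Vector_Spaces.linear tensor_scale tensor_scale h \<and>
    (\<forall>e f g. \<forall>x\<in>hpart V e. \<forall>y\<in>hpart W f. \<forall>z\<in>hpart X g.
      h (pure_tensor (scl V) tensor_scale x (ptens W X y z)) =
      tensor_scale (\<Phi> e f g) (pure_tensor tensor_scale (scl X) (ptens V W x y) z))"
    by (rule tensor_lift3_right[OF hspD(1)[OF V] hspD(1)[OF W] hspD(1)[OF X] vector_space_tensor_scale
          hspD(2)[OF V] hspD(2)[OF W] hspD(2)[OF X]])
      (simp_all add: linear_on_def pure_tensor_bilinear tensor.scale_right_distrib mult.commute)
  then have "\<exists>h. Vector_Spaces.linear tensor_scale tensor_scale h \<and>
    (\<forall>e f g. \<forall>x\<in>hpart V e. \<forall>y\<in>hpart W f. \<forall>z\<in>hpart X g.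
      h (ptens V (yd_tensor \<Phi> W X) x (ptens W X y z)) =
      tensor_scale (\<Phi> e f g) (ptens (yd_tensor \<Phi> V W) X (ptens V W x y) z))"
    unfolding yd_tensor_simps(1) .
  note * = someI_ex[OF this, folded associator_inv_def]
  show 1: "Vector_Spaces.linear tensor_scale tensor_scale (associator_inv \<Phi> V W X)"
    using * by (rule conjunct1)
  show 2: "associator_inv \<Phi> V W X (ptens V (yd_tensor \<Phi> W X) x (ptens W X y z)) =
      tensor_scale (\<Phi> e f g) (ptens (yd_tensor \<Phi> V W) X (ptens V W x y) z)"
    if "x \<in> hpart V e" "y \<in> hpart W f" "z \<in> hpart X g" for e f g x y z
    using * that by blast
  show "hmap (yd_tensor \<Phi> V (yd_tensor \<Phi> W X)) (yd_tensor \<Phi> (yd_tensor \<Phi> V W) X) (associator_inv \<Phi> V W X)"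
  proof (rule hmapI_tensor3_right[OF V W X hsp_tensor[OF hsp_tensor[OF V W] X]])
    fix e f g x y z assume *: "x \<in> hpart V e" "y \<in> hpart W f" "z \<in> hpart X g"
    then have "ptens (yd_tensor \<Phi> V W) X (ptens V W x y) z \<in>
        hpart (yd_tensor \<Phi> (yd_tensor \<Phi> V W) X) (e + f + g)" by (intro ptens_hpart)
    then show "associator_inv \<Phi> V W X (ptens V (yd_tensor \<Phi> W X) x (ptens W X y z)) \<in>
        hpart (yd_tensor \<Phi> (yd_tensor \<Phi> V W) X) (e + (f + g))"
      unfolding 2[OF *] add.assoc unfolding yd_tensor_simps(3) by (rule tensor.span_scale)
  qed (simp add: 1)
qed

lemma braiding_props:
  assumes V: "hsp V" and W: "hsp W" and act: "\<And>e. hmap W W (act W e)"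
  shows braiding_ptens: "\<And>e x y. x \<in> hpart V e \<Longrightarrow> y \<in> carr W \<Longrightarrow>
      braiding V W (ptens V W x y) = ptens W V (act W e y) x"
    and hmap_braiding: "hmap (yd_tensor \<Phi> V W) (yd_tensor \<Phi> W V) (braiding V W)"
proof -
  have "\<exists>h. Vector_Spaces.linear tensor_scale tensor_scale h \<and>
    (\<forall>e (n::unit). \<forall>x\<in>hpart V e. \<forall>y\<in>carr W. h (ptens V W x y) = ptens W V (act W e y) x)"
    by (rule tensor_lift[OF hspD(1)[OF V] hspD(1)[OF W] vector_space_tensor_scale hspD(2)[OF V]
          internal_direct_sum_single[OF vspD[OF hsp_imp_vsp[OF W]]]])
      (use act in \<open>simp_all add: hmap_def linear_on_def pure_tensor_bilinear\<close>)
  then have "\<exists>h. Vector_Spaces.linear tensor_scale tensor_scale h \<and>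
    (\<forall>e. \<forall>x\<in>hpart V e. \<forall>y\<in>carr W. h (ptens V W x y) = ptens W V (act W e y) x)"
    by simp
  note * = someI_ex[OF this, folded braiding_def]
  show 1: "braiding V W (ptens V W x y) = ptens W V (act W e y) x" if "x \<in> hpart V e" "y \<in> carr W" for e x y
    using * that by blast
  show "hmap (yd_tensor \<Phi> V W) (yd_tensor \<Phi> W V) (braiding V W)"
  proof (rule hmapI_tensor[OF V W hsp_tensor[OF W V]])
    fix e f x y assume x: "x \<in> hpart V e" and y: "y \<in> hpart W f"
    show "braiding V W (ptens V W x y) \<in> hpart (yd_tensor \<Phi> W V) (e + f)"
      \<comment> \<open>The image has degree \<open>f + e\<close>; the braiding preserves degrees
        because the group is commutative.\<close>
      unfolding 1[OF x hpart_carr[OF W y]] add.commute[of e]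
      by (rule ptens_hpart[OF hmapD(2)[OF act y] x])
  qed (use * in simp)
qed

lemma left_unitor_props:
  assumes V: "vsp V"
  shows left_unitor_ptens: "\<And>c x. x \<in> carr V \<Longrightarrow> left_unitor V (ptens yd_unit V c x) = scl V c x"
    and Lin_left_unitor: "Lin (yd_tensor \<Phi> yd_unit V) V (left_unitor V)"
proof -
  interpret v: vector_space "scl V" using vspD(1)[OF V] .
  have "\<exists>h. Vector_Spaces.linear tensor_scale (scl V) h \<and>
    (\<forall>(m::unit) (n::unit). \<forall>c\<in>UNIV. \<forall>x\<in>carr V. h (pure_tensor (*) (scl V) c x) = scl V c x)"
    by (rule tensor_lift[OF vector_space_mult vspD(1)[OF V] vspD(1)[OF V]
          internal_direct_sum_single[OF vspD[OF vsp_unit], unfolded yd_unit_simps] internal_direct_sum_single[OF vspD[OF V]]])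
      (simp_all add: linear_on_def v.scale_left_distrib v.scale_right_distrib mult.commute)
  then have "\<exists>h. Vector_Spaces.linear tensor_scale (scl V) h \<and>
    (\<forall>c. \<forall>x\<in>carr V. h (ptens yd_unit V c x) = scl V c x)"
    by simp
  note * = someI_ex[OF this, folded left_unitor_def]
  show 1: "left_unitor V (ptens yd_unit V c x) = scl V c x" if "x \<in> carr V" for c x
    using * that by blast
  have lin: "linear_on tensor_scale (scl V) C UNIV (left_unitor V)" for C
    using * by (intro linear_imp_linear_on) simp
  have "left_unitor V T \<in> carr V" if T: "T \<in> carr (yd_tensor \<Phi> yd_unit V)" for T
    by (rule linear_on_tensor_span_into[OF vspD(1)[OF V] lin vspD(2)[OF V] _ order_refl order_refl
          T[unfolded yd_tensor_simps]])
      (use 1 v.subspace_scale[OF vspD(2)[OF V]] in simp)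
  then show "Lin (yd_tensor \<Phi> yd_unit V) V (left_unitor V)"
    using lin unfolding linear_on_def yd_tensor_simps(1) by blast
qed

lemma right_unitor_props:
  assumes V: "vsp V"
  shows right_unitor_ptens: "\<And>c x. x \<in> carr V \<Longrightarrow> right_unitor V (ptens V yd_unit x c) = scl V c x"
    and Lin_right_unitor: "Lin (yd_tensor \<Phi> V yd_unit) V (right_unitor V)"
proof -
  interpret v: vector_space "scl V" using vspD(1)[OF V] .
  have "\<exists>h. Vector_Spaces.linear tensor_scale (scl V) h \<and>
    (\<forall>(m::unit) (n::unit). \<forall>x\<in>carr V. \<forall>c\<in>UNIV. h (pure_tensor (scl V) (*) x c) = scl V c x)"
    by (rule tensor_lift[OF vspD(1)[OF V] vector_space_mult vspD(1)[OF V]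
          internal_direct_sum_single[OF vspD[OF V]] internal_direct_sum_single[OF vspD[OF vsp_unit], unfolded yd_unit_simps]])
      (simp_all add: linear_on_def v.scale_left_distrib v.scale_right_distrib mult.commute)
  then have "\<exists>h. Vector_Spaces.linear tensor_scale (scl V) h \<and>
    (\<forall>c. \<forall>x\<in>carr V. h (ptens V yd_unit x c) = scl V c x)"
    by (elim exE, rule_tac x = h in exI, simp)
  note * = someI_ex[OF this, folded right_unitor_def]
  show 1: "right_unitor V (ptens V yd_unit x c) = scl V c x" if "x \<in> carr V" for c x
    using * that by blast
  have lin: "linear_on tensor_scale (scl V) C UNIV (right_unitor V)" for C
    using * by (intro linear_imp_linear_on) simp
  have "right_unitor V T \<in> carr V" if T: "T \<in> carr (yd_tensor \<Phi> V yd_unit)" for T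
    by (rule linear_on_tensor_span_into[OF vspD(1)[OF V] lin vspD(2)[OF V] _ order_refl order_refl
          T[unfolded yd_tensor_simps]])
      (use 1 v.subspace_scale[OF vspD(2)[OF V]] in simp)
  then show "Lin (yd_tensor \<Phi> V yd_unit) V (right_unitor V)"
    using lin unfolding linear_on_def yd_tensor_simps(1) by blast
qed

lemma tensor_act_props:
  assumes V: "hsp V" and W: "hsp W" and act: "\<And>e. hmap V V (act V e)" "\<And>e. hmap W W (act W e)"
  shows tensor_act_ptens: "\<And>e g f x y. x \<in> hpart V g \<Longrightarrow> y \<in> hpart W f \<Longrightarrow> act (yd_tensor \<Phi> V W) e (ptens V W x y) =
      tensor_scale (cocycle_at \<Phi> e g f) (ptens V W (act V e x) (act W e y))"
    and hmap_tensor_act: "\<And>e. hmap (yd_tensor \<Phi> V W) (yd_tensor \<Phi> V W) (act (yd_tensor \<Phi> V W) e)"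
proof -
  have *: "Vector_Spaces.linear tensor_scale tensor_scale (act (yd_tensor \<Phi> V W) e) \<and>
    (\<forall>g f. \<forall>x\<in>hpart V g. \<forall>y\<in>hpart W f. act (yd_tensor \<Phi> V W) e (ptens V W x y) =
      tensor_scale (cocycle_at \<Phi> e g f) (ptens V W (act V e x) (act W e y)))" for e
  proof -
    have lin: "linear_on (scl V) (scl V) (hpart V g) UNIV (act V e)"
      "linear_on (scl W) (scl W) (hpart W g) UNIV (act W e)" for g
      by (rule linear_on_weaken[OF hmapD(1)[OF act(1)] hpart_subset[OF V] subset_UNIV],
          rule linear_on_weaken[OF hmapD(1)[OF act(2)] hpart_subset[OF W] subset_UNIV])
    have "\<exists>h. Vector_Spaces.linear tensor_scale tensor_scale h \<and>
      (\<forall>g f. \<forall>x\<in>hpart V g. \<forall>y\<in>hpart W f. h (ptens V W x y) =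
        tensor_scale (cocycle_at \<Phi> e g f) (ptens V W (act V e x) (act W e y)))"
      by (rule tensor_lift[OF hspD(1)[OF V] hspD(1)[OF W] vector_space_tensor_scale hspD(2)[OF V] hspD(2)[OF W]])
        (use lin in \<open>simp_all add: linear_on_def pure_tensor_bilinear tensor.scale_right_distrib mult.commute\<close>)
    then show ?thesis
      unfolding yd_tensor_def yd.simps by (rule someI_ex)
  qed
  show 1: "act (yd_tensor \<Phi> V W) e (ptens V W x y) =
      tensor_scale (cocycle_at \<Phi> e g f) (ptens V W (act V e x) (act W e y))"
    if "x \<in> hpart V g" "y \<in> hpart W f" for e g f x y
    using * that by blast
  show "hmap (yd_tensor \<Phi> V W) (yd_tensor \<Phi> V W) (act (yd_tensor \<Phi> V W) e)" for e
  proof (rule hmapI_tensor[OF V W hsp_tensor[OF V W]])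
    fix g f x y assume x: "x \<in> hpart V g" and y: "y \<in> hpart W f"
    show "act (yd_tensor \<Phi> V W) e (ptens V W x y) \<in> hpart (yd_tensor \<Phi> V W) (g + f)"
      unfolding 1[OF x y] unfolding yd_tensor_simps(3)
      by (rule tensor.span_scale, fold yd_tensor_simps(3)[of \<Phi>])
        (rule ptens_hpart[OF hmapD(2)[OF act(1) x] hmapD(2)[OF act(2) y]])
  qed (use * in simp)
qed

section \<open>Braided algebras and bialgebras\<close>

lemma hmap_comp:
  assumes "hmap V W p" "hmap W X q"
  shows "hmap V X (q \<circ> p)"
  using linear_on_comp[OF hmapD(1)[OF assms(1)] hmapD(1)[OF assms(2)]] hmapD(2)[OF assms(1)] hmapD(2)[OF assms(2)]
  by (simp add: hmap_def comp_def)

lemma hmap_tensor_scale: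
  assumes "hmap (yd_tensor \<Phi> V W) (yd_tensor \<Phi>' X Y) m" "T \<in> carr (yd_tensor \<Phi> V W)"
  shows "m (tensor_scale c T) = tensor_scale c (m T)"
  using linear_onD(3)[OF hmapD(1)[OF assms(1)] assms(2)] by simp

text \<open>Elementwise form of \<open>braided_algebra\<close>, with associativity up to the scalar
  \<open>\<Phi>\<close>. Both directions of the translation are proved below. A subalgebra inherits
  these identities at once, whereas the diagrams in \<open>braided_algebra\<close> involve structure
  maps that are chosen anew for the smaller carrier.\<close>

locale yd_alg =
  fixes \<Phi> :: "'g::ab_group_add \<Rightarrow> 'g \<Rightarrow> 'g \<Rightarrow> 'k::field"
    and A :: "('g, 'k, 'v::ab_group_add, 'z) hopf_scheme"
  assumes module: "yd_module \<Phi> A"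
    and Lin_mu: "Lin (yd_tensor \<Phi> A A) A (mu A)"
    and prd_hpart: "\<And>e f x y. x \<in> hpart A e \<Longrightarrow> y \<in> hpart A f \<Longrightarrow> prd A x y \<in> hpart A (e + f)"
    and act_prd: "\<And>e f g x y. x \<in> hpart A f \<Longrightarrow> y \<in> hpart A g \<Longrightarrow>
      act A e (prd A x y) = scl A (cocycle_at \<Phi> e f g) (prd A (act A e x) (act A e y))"
    and unt_hpart: "unt A \<in> hpart A 0"
    and act_unt: "\<And>e. act A e (unt A) = unt A"
    and prd_assoc: "\<And>e f g x y z. x \<in> hpart A e \<Longrightarrow> y \<in> hpart A f \<Longrightarrow> z \<in> hpart A g \<Longrightarrow>
      prd A (prd A x y) z = scl A (inverse (\<Phi> e f g)) (prd A x (prd A y z))"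
    and prd_unt: "\<And>x. x \<in> carr A \<Longrightarrow> prd A (unt A) x = x" "\<And>x. x \<in> carr A \<Longrightarrow> prd A x (unt A) = x"
begin

sublocale vs: vector_space "scl A"
  using module by (simp add: yd_module_def)

abbreviation AA where "AA \<equiv> yd_tensor \<Phi> A A"

lemma hsp: "hsp A" and hsp2: "hsp AA"
  using yd_module_hsp[OF module] hsp_tensor[OF yd_module_hsp[OF module] yd_module_hsp[OF module]] .

lemma vsp: "vsp A" and vsp2: "vsp AA"
  using hsp hsp2 hsp_imp_vsp by blast+

lemmas carr_subspace = vspD(2)[OF vsp]
lemmas hpart_subspace = internal_direct_sum_subspace(1)[OF hspD[OF hsp]]
lemmas carr_span = internal_direct_sum_subspace(4)[OF hspD[OF hsp]]
lemmas hcarr = hpart_carr[OF hsp]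
lemmas ptens_carr2 = ptens_carr[where V = A and W = A and \<Phi> = \<Phi>]

lemma unt_carr: "unt A \<in> carr A"
  using unt_hpart by (rule hcarr)

lemma hmap_act: "hmap A A (act A e)"
  using module by (simp add: yd_module_def hmap_def)

lemmas act_hpart = hmapD(2)[OF hmap_act]
lemmas Lin_act = hmapD(1)[OF hmap_act]

lemma act_act: "v \<in> hpart A g \<Longrightarrow> act A e (act A f v) = scl A (cocycle_at \<Phi> g e f) (act A (e + f) v)"
  using module by (simp add: yd_module_def)

lemma act_0: "v \<in> carr A \<Longrightarrow> act A 0 v = v"
  using module by (simp add: yd_module_def)

lemma prd_carr: "x \<in> carr A \<Longrightarrow> y \<in> carr A \<Longrightarrow> prd A x y \<in> carr A"
  by (rule linear_onD(1)[OF Lin_mu ptens_carr])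

lemma prd_add_left: "x \<in> carr A \<Longrightarrow> x' \<in> carr A \<Longrightarrow> y \<in> carr A \<Longrightarrow> prd A (x + x') y = prd A x y + prd A x' y"
  unfolding pure_tensor_bilinear by (rule linear_onD(2)[OF Lin_mu ptens_carr ptens_carr])

lemma prd_add_right: "x \<in> carr A \<Longrightarrow> y \<in> carr A \<Longrightarrow> y' \<in> carr A \<Longrightarrow> prd A x (y + y') = prd A x y + prd A x y'"
  unfolding pure_tensor_bilinear by (rule linear_onD(2)[OF Lin_mu ptens_carr ptens_carr])

lemma prd_scale_left: "x \<in> carr A \<Longrightarrow> y \<in> carr A \<Longrightarrow> prd A (scl A c x) y = scl A c (prd A x y)"
  unfolding pure_tensor_bilinear using linear_onD(3)[OF Lin_mu ptens_carr] by simp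

lemma prd_scale_right: "x \<in> carr A \<Longrightarrow> y \<in> carr A \<Longrightarrow> prd A x (scl A c y) = scl A c (prd A x y)"
  unfolding pure_tensor_bilinear using linear_onD(3)[OF Lin_mu ptens_carr] by simp

lemma linear_on_prd:
  "y \<in> carr A \<Longrightarrow> linear_on (scl A) (scl A) (carr A) (carr A) (\<lambda>x. prd A x y)"
  "x \<in> carr A \<Longrightarrow> linear_on (scl A) (scl A) (carr A) (carr A) (prd A x)"
  by (simp_all add: linear_on_def prd_carr prd_add_left prd_add_right prd_scale_left prd_scale_right)

lemma hmap_mu: "hmap AA A (mu A)"
proof -
  have "mu A T \<in> hpart A g" if T: "T \<in> hpart AA g" for T g
  proof (rule linear_on_span_into[OF vector_space_tensor_scale vs.vector_space_axioms
        Lin_mu[unfolded yd_tensor_simps(1)] _ _ hpart_subspace _ T[unfolded yd_tensor_simps]])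
    show "tensor.subspace (carr AA)" by simp
    show "{ptens A A x y |x y e f. x \<in> hpart A e \<and> y \<in> hpart A f \<and> e + f = g} \<subseteq> carr AA"
      by (intro subsetI, elim CollectE exE conjE, simp only: ptens_carr hcarr)
    fix T assume "T \<in> {ptens A A x y |x y e f. x \<in> hpart A e \<and> y \<in> hpart A f \<and> e + f = g}"
    then obtain x y e f where "T = ptens A A x y" "x \<in> hpart A e" "y \<in> hpart A f" "e + f = g" by blast
    then show "mu A T \<in> hpart A g" using prd_hpart by auto
  qed
  then show ?thesis using Lin_mu by (simp add: hmap_def)
qed

lemmas tensor_act = tensor_act_ptens[OF hsp hsp hmap_act hmap_act, where \<Phi> = \<Phi>]
lemmas hmap_tact = hmap_tensor_act[OF hsp hsp hmap_act hmap_act, where \<Phi> = \<Phi>]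

lemma mu_act: "T \<in> carr AA \<Longrightarrow> mu A (act AA e T) = act A e (mu A T)"
proof (rule tensor_eqI[OF hsp hsp, where F = "\<lambda>T. mu A (act AA e T)" and G = "\<lambda>T. act A e (mu A T)"])
  show "linear_on tensor_scale (scl A) (carr AA) (carr A) (\<lambda>T. mu A (act AA e T))"
    using linear_on_comp[OF hmapD(1)[OF hmap_tact] Lin_mu] by simp
  show "linear_on tensor_scale (scl A) (carr AA) (carr A) (\<lambda>T. act A e (mu A T))"
    using linear_on_comp[OF Lin_mu Lin_act] by simp
  fix f g x y assume *: "x \<in> hpart A f" "y \<in> hpart A g"
  have "ptens A A (act A e x) (act A e y) \<in> carr AA"
    by (rule ptens_carr[OF hcarr[OF act_hpart[OF *(1)]] hcarr[OF act_hpart[OF *(2)]]])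
  from linear_onD(3)[OF Lin_mu this]
  show "mu A (act AA e (ptens A A x y)) = act A e (prd A x y)"
    unfolding tensor_act[OF *] act_prd[OF *] by simp
qed

lemma mu_assoc:
  assumes "T \<in> carr (yd_tensor \<Phi> AA A)"
  shows "mu A (tensor_map AA A A A (mu A) id T) = mu A (tensor_map A AA A A id (mu A) (associator \<Phi> A A A T))"
proof -
  note tm1 = Lin_tensor_map[OF vsp2 vsp Lin_mu linear_on_id[of "scl A" "carr A"]]
  note tm2 = Lin_tensor_map[OF vsp vsp2 linear_on_id[of "scl A" "carr A"] Lin_mu]
  note as = hmap_associator[OF hsp hsp hsp, of \<Phi>]
  show ?thesis
  proof (rule tensor3_eqI_left[OF hsp hsp hsp, where F = "\<lambda>T. mu A (tensor_map AA A A A (mu A) id T)"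
        and G = "\<lambda>T. mu A (tensor_map A AA A A id (mu A) (associator \<Phi> A A A T))", OF _ _ _ assms])
    show "linear_on tensor_scale (scl A) (carr (yd_tensor \<Phi> AA A)) (carr A) (\<lambda>T. mu A (tensor_map AA A A A (mu A) id T))"
      using linear_on_comp[OF tm1(1) Lin_mu] by simp
    show "linear_on tensor_scale (scl A) (carr (yd_tensor \<Phi> AA A)) (carr A)
        (\<lambda>T. mu A (tensor_map A AA A A id (mu A) (associator \<Phi> A A A T)))"
      using linear_on_comp[OF hmapD(1)[OF as] linear_on_comp[OF tm2(1) Lin_mu]] by simp
    fix e f g x y z assume *: "x \<in> hpart A e" "y \<in> hpart A f" "z \<in> hpart A g"
    then have c: "x \<in> carr A" "y \<in> carr A" "z \<in> carr A" by (auto intro: hcarr)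
    have "mu A (tensor_map A AA A A id (mu A) (tensor_scale (inverse (\<Phi> e f g)) (ptens A AA x (ptens A A y z)))) =
      scl A (inverse (\<Phi> e f g)) (mu A (tensor_map A AA A A id (mu A) (ptens A AA x (ptens A A y z))))"
      using linear_onD(3)[OF linear_on_comp[OF tm2(1) Lin_mu] ptens_carr[OF c(1) ptens_carr[OF c(2,3)]]]
      by simp
    then show "mu A (tensor_map AA A A A (mu A) id (ptens AA A (ptens A A x y) z)) =
        mu A (tensor_map A AA A A id (mu A) (associator \<Phi> A A A (ptens AA A (ptens A A x y) z)))"
      unfolding associator_ptens[OF hsp hsp hsp *] tm1(2)[OF ptens_carr[OF c(1,2)] c(3)]
        tm2(2)[OF c(1) ptens_carr[OF c(2,3)]] id_apply prd_assoc[OF *] by simp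
  qed
qed

lemma braided_algebra: "braided_algebra \<Phi> A"
  unfolding braided_algebra_def
proof (intro conjI ballI module)
  show "yd_hom AA A (mu A)"
    using hmap_mu mu_act unfolding yd_hom_def hmap_def by blast
  have "scl A c (unt A) \<in> hpart A 0" for c by (rule vs.subspace_scale[OF hpart_subspace unt_hpart])
  moreover have "scl A c (unt A) \<in> carr A" for c by (rule vs.subspace_scale[OF carr_subspace unt_carr])
  moreover have "act A e (scl A c (unt A)) = scl A c (unt A)" for c e
    using linear_onD(3)[OF Lin_act unt_carr] by (simp add: act_unt)
  ultimately show "yd_hom yd_unit A (\<lambda>c. scl A c (unt A))"
    using vs.subspace_0[OF hpart_subspace]
    by (auto simp: yd_hom_def linear_on_def vs.scale_left_distrib)
qed (simp_all only: mu_assoc prd_unt)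

section \<open>The product of the braided tensor square\<close>

definition star :: "('k, 'v, 'v) tensor \<Rightarrow> ('k, 'v, 'v) tensor \<Rightarrow> ('k, 'v, 'v) tensor"
  where "star u v = tensor_square_mu \<Phi> A (ptens AA AA u v)"

text \<open>The scalars come from the four rebracketings in the order of the composite:
  \<open>\<Phi> e f (g + h)\<close> inverted, \<open>\<Phi> f g h\<close>, then after the braiding
  \<open>\<Phi> g f h\<close> inverted and \<open>\<Phi> e g (f + h)\<close>. The braiding moves
  \<open>b\<close> past \<open>c\<close> and so acts on \<open>c\<close> by the degree
  \<open>f\<close> of \<open>b\<close>; this leaves the degree \<open>g\<close> unchanged, so the
  later scalars can be read off from the original degrees.\<close>

lemma star_props:
  shows hmap_tensor_square_mu: "hmap (yd_tensor \<Phi> AA AA) AA (tensor_square_mu \<Phi> A)"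
    and star_ptens: "\<And>e f g h a b c d. a \<in> hpart A e \<Longrightarrow> b \<in> hpart A f \<Longrightarrow> c \<in> hpart A g \<Longrightarrow> d \<in> hpart A h \<Longrightarrow>
      star (ptens A A a b) (ptens A A c d) =
      tensor_scale (inverse (\<Phi> e f (g + h)) * \<Phi> f g h * inverse (\<Phi> g f h) * \<Phi> e g (f + h))
        (ptens A A (prd A a (act A f c)) (prd A b d))"
proof -
  define L R where "L = yd_tensor \<Phi> AA A" and "R = yd_tensor \<Phi> A AA"
  have hL: "hsp L" and hR: "hsp R" unfolding L_def R_def by (intro hsp_tensor hsp)+
  define m1 where "m1 = associator \<Phi> A A AA"
  define m2 where "m2 = tensor_map A R A L id (associator_inv \<Phi> A A A)"
  define m3 where "m3 = tensor_map A L A L id (tensor_map AA A AA A (braiding A A) id)"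
  define m4 where "m4 = tensor_map A L A R id (associator \<Phi> A A A)"
  define m5 where "m5 = associator_inv \<Phi> A A AA"
  define m6 where "m6 = tensor_map AA AA A A (mu A) (mu A)"
  have eq: "tensor_square_mu \<Phi> A = m6 \<circ> m5 \<circ> m4 \<circ> m3 \<circ> m2 \<circ> m1"
    unfolding tensor_square_mu_def Let_def m1_def m2_def m3_def m4_def m5_def m6_def L_def R_def ..
  have b: "hmap AA AA (braiding A A)" by (rule hmap_braiding[OF hsp hsp hmap_act])
  have b': "hmap L L (tensor_map AA A AA A (braiding A A) id)"
    unfolding L_def by (rule hmap_tensor_map[OF hsp2 hsp b hmap_id])
  have as: "hmap L R (associator \<Phi> A A A)" "hmap R L (associator_inv \<Phi> A A A)"
    unfolding L_def R_def by (rule hmap_associator[OF hsp hsp hsp], rule hmap_associator_inv[OF hsp hsp hsp])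
  have h1: "hmap (yd_tensor \<Phi> AA AA) (yd_tensor \<Phi> A R) m1"
    unfolding m1_def R_def by (rule hmap_associator[OF hsp hsp hsp2])
  have h2: "hmap (yd_tensor \<Phi> A R) (yd_tensor \<Phi> A L) m2"
    unfolding m2_def by (rule hmap_tensor_map[OF hsp hR hmap_id as(2)])
  have h3: "hmap (yd_tensor \<Phi> A L) (yd_tensor \<Phi> A L) m3"
    unfolding m3_def by (rule hmap_tensor_map[OF hsp hL hmap_id b'])
  have h4: "hmap (yd_tensor \<Phi> A L) (yd_tensor \<Phi> A R) m4"
    unfolding m4_def by (rule hmap_tensor_map[OF hsp hL hmap_id as(1)])
  have h5: "hmap (yd_tensor \<Phi> A R) (yd_tensor \<Phi> AA AA) m5"
    unfolding m5_def R_def by (rule hmap_associator_inv[OF hsp hsp hsp2])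
  have h6: "hmap (yd_tensor \<Phi> AA AA) AA m6"
    unfolding m6_def by (rule hmap_tensor_map[OF hsp2 hsp2 hmap_mu hmap_mu])
  show "hmap (yd_tensor \<Phi> AA AA) AA (tensor_square_mu \<Phi> A)"
    unfolding eq by (rule hmap_comp[OF h1 hmap_comp[OF h2 hmap_comp[OF h3 hmap_comp[OF h4 hmap_comp[OF h5 h6]]]], unfolded comp_assoc[symmetric]])
  fix e f g h a b c d
  assume H: "a \<in> hpart A e" "b \<in> hpart A f" "c \<in> hpart A g" "d \<in> hpart A h"
  note C = H[THEN hcarr]
  define c' where "c' = act A f c"
  have H': "c' \<in> hpart A g" unfolding c'_def by (rule act_hpart[OF H(3)])
  note C' = hcarr[OF H']
  have R_carr: "ptens A AA x (ptens A A y z) \<in> carr R" if "x \<in> carr A" "y \<in> carr A" "z \<in> carr A" for x y z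
    unfolding R_def using that by (intro ptens_carr)
  have L_carr: "ptens AA A (ptens A A x y) z \<in> carr L" if "x \<in> carr A" "y \<in> carr A" "z \<in> carr A" for x y z
    unfolding L_def using that by (intro ptens_carr)
  note vR = hsp_imp_vsp[OF hR] note vL = hsp_imp_vsp[OF hL]
  have s1: "m1 (ptens AA AA (ptens A A a b) (ptens A A c d)) =
      tensor_scale (inverse (\<Phi> e f (g + h))) (ptens A R a (ptens A AA b (ptens A A c d)))"
    unfolding m1_def R_def by (rule associator_ptens[OF hsp hsp hsp2 H(1,2) ptens_hpart[OF H(3,4)]])
  have s2: "m2 (ptens A R a (ptens A AA b (ptens A A c d))) =
      tensor_scale (\<Phi> f g h) (ptens A L a (ptens AA A (ptens A A b c) d))"
    unfolding m2_def Lin_tensor_map(2)[OF vsp vR linear_on_id[of "scl A" "carr A"] hmapD(1)[OF as(2)] C(1) R_carr[OF C(2-4)]]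
      associator_inv_ptens[OF hsp hsp hsp H(2-4)] id_apply
    unfolding L_def yd_tensor_simps(1) pure_tensor_bilinear ..
  have s3: "m3 (ptens A L a (ptens AA A (ptens A A b c) d)) = ptens A L a (ptens AA A (ptens A A c' b) d)"
    unfolding m3_def c'_def Lin_tensor_map(2)[OF vsp vL linear_on_id[of "scl A" "carr A"] hmapD(1)[OF b'] C(1) L_carr[OF C(2-4)]]
      Lin_tensor_map(2)[OF vsp2 vsp hmapD(1)[OF b] linear_on_id[of "scl A" "carr A"] ptens_carr[OF C(2,3)] C(4)]
      braiding_ptens[OF hsp hsp hmap_act H(2) C(3)] id_apply ..
  have s4: "m4 (ptens A L a (ptens AA A (ptens A A c' b) d)) =
      tensor_scale (inverse (\<Phi> g f h)) (ptens A R a (ptens A AA c' (ptens A A b d)))"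
    unfolding m4_def Lin_tensor_map(2)[OF vsp vL linear_on_id[of "scl A" "carr A"] hmapD(1)[OF as(1)] C(1) L_carr[OF C' C(2,4)]]
      associator_ptens[OF hsp hsp hsp H' H(2,4)] id_apply
    unfolding R_def yd_tensor_simps(1) pure_tensor_bilinear ..
  have s5: "m5 (ptens A R a (ptens A AA c' (ptens A A b d))) =
      tensor_scale (\<Phi> e g (f + h)) (ptens AA AA (ptens A A a c') (ptens A A b d))"
    unfolding m5_def R_def by (rule associator_inv_ptens[OF hsp hsp hsp2 H(1) H' ptens_hpart[OF H(2,4)]])
  have s6: "m6 (ptens AA AA (ptens A A a c') (ptens A A b d)) = ptens A A (prd A a c') (prd A b d)"
    unfolding m6_def by (rule Lin_tensor_map(2)[OF vsp2 vsp2 Lin_mu Lin_mu ptens_carr[OF C(1) C'] ptens_carr[OF C(2,4)]])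
  note sc = hmap_tensor_scale
  show "star (ptens A A a b) (ptens A A c d) =
      tensor_scale (inverse (\<Phi> e f (g + h)) * \<Phi> f g h * inverse (\<Phi> g f h) * \<Phi> e g (f + h))
        (ptens A A (prd A a (act A f c)) (prd A b d))"
    unfolding c'_def[symmetric] star_def eq comp_apply s1
      sc[OF h2 ptens_carr[OF C(1) R_carr[OF C(2-4)]]] s2 tensor.scale_scale
      sc[OF h3 ptens_carr[OF C(1) L_carr[OF C(2-4)]]] s3
      sc[OF h4 ptens_carr[OF C(1) L_carr[OF C' C(2,4)]]] s4
      sc[OF h5 ptens_carr[OF C(1) R_carr[OF C' C(2,4)]]] s5
      sc[OF h6 ptens_carr[OF ptens_carr[OF C(1) C'] ptens_carr[OF C(2,4)]]] s6
    by (simp only: tensor.scale_scale)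
qed

lemma star_bilinear:
  assumes "w \<in> carr AA"
  shows linear_on_star_left: "linear_on tensor_scale tensor_scale (carr AA) (carr AA) (\<lambda>u. star u w)"
    and linear_on_star_right: "linear_on tensor_scale tensor_scale (carr AA) (carr AA) (star w)"
proof -
  note L = hmapD(1)[OF hmap_tensor_square_mu, unfolded yd_tensor_simps(1)]
  have *: "ptens AA AA u v \<in> carr (yd_tensor \<Phi> AA AA)" if "u \<in> carr AA" "v \<in> carr AA" for u v
    using that by (rule ptens_carr)
  show "linear_on tensor_scale tensor_scale (carr AA) (carr AA) (\<lambda>u. star u w)"
    unfolding linear_on_def star_def yd_tensor_simps(1) pure_tensor_bilinear
    using linear_onD[OF L *[OF _ assms]] *[OF _ assms] by (simp only: yd_tensor_simps(1)) blast
  show "linear_on tensor_scale tensor_scale (carr AA) (carr AA) (star w)"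
    unfolding linear_on_def star_def yd_tensor_simps(1) pure_tensor_bilinear
    using linear_onD[OF L *[OF assms]] *[OF assms] by (simp only: yd_tensor_simps(1)) blast
qed

end

lemma braided_algebra_imp_yd_alg:
  assumes "braided_algebra \<Phi> A"
  shows "yd_alg \<Phi> A"
proof
  have m: "yd_module \<Phi> A" and mu: "yd_hom (yd_tensor \<Phi> A A) A (mu A)"
    and u: "yd_hom yd_unit A (\<lambda>c. scl A c (unt A))"
    and as: "\<And>T. T \<in> carr (yd_tensor \<Phi> (yd_tensor \<Phi> A A) A) \<Longrightarrow>
       mu A (tensor_map (yd_tensor \<Phi> A A) A A A (mu A) id T) =
       mu A (tensor_map A (yd_tensor \<Phi> A A) A A id (mu A) (associator \<Phi> A A A T))"
    and un: "\<And>x. x \<in> carr A \<Longrightarrow> prd A (unt A) x = x" "\<And>x. x \<in> carr A \<Longrightarrow> prd A x (unt A) = x"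
    using assms unfolding braided_algebra_def by blast+
  note hm = yd_hom_hmap[OF mu]
  note hsp = yd_module_hsp[OF m]
  interpret vs: vector_space "scl A" using hspD(1)[OF hsp] .
  have act: "hmap A A (act A e)" for e using m by (simp add: yd_module_def hmap_def)
  note vsp = hsp_imp_vsp[OF hsp] note vsp2 = hsp_imp_vsp[OF hsp_tensor[OF hsp hsp, of \<Phi>]]
  show "yd_module \<Phi> A" by fact
  show Lmu: "Lin (yd_tensor \<Phi> A A) A (mu A)" using hmapD(1)[OF hm] .
  show "prd A x y \<in> hpart A (e + f)" if "x \<in> hpart A e" "y \<in> hpart A f" for e f x y
    by (rule hmapD(2)[OF hm ptens_hpart[OF that]])
  show "act A e (prd A x y) = scl A (cocycle_at \<Phi> e f g) (prd A (act A e x) (act A e y))"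
    if xy: "x \<in> hpart A f" "y \<in> hpart A g" for e f g x y
  proof -
    have c: "ptens A A x y \<in> carr (yd_tensor \<Phi> A A)"
      "ptens A A (act A e x) (act A e y) \<in> carr (yd_tensor \<Phi> A A)"
      using xy hmapD(2)[OF act] by (auto intro!: ptens_carr hpart_carr[OF hsp] simp del: yd_tensor_simps)
    have "act A e (prd A x y) = mu A (act (yd_tensor \<Phi> A A) e (ptens A A x y))"
      using mu c(1) unfolding yd_hom_def by simp
    also have "\<dots> = scl A (cocycle_at \<Phi> e f g) (prd A (act A e x) (act A e y))"
      unfolding tensor_act_ptens[OF hsp hsp act act xy]
      using linear_onD(3)[OF Lmu c(2)] by simp
    finally show ?thesis .
  qed
  have "scl A 1 (unt A) \<in> hpart A 0"
    using hmapD(2)[OF yd_hom_hmap[OF u], of 1 0] by simp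
  then show "unt A \<in> hpart A 0" by simp
  show "act A e (unt A) = unt A" for e
  proof -
    have "scl A (act yd_unit e 1) (unt A) = act A e (scl A 1 (unt A))"
      using u unfolding yd_hom_def yd_unit_simps by blast
    then show ?thesis by simp
  qed
  show "prd A (prd A x y) z = scl A (inverse (\<Phi> e f g)) (prd A x (prd A y z))"
    if *: "x \<in> hpart A e" "y \<in> hpart A f" "z \<in> hpart A g" for e f g x y z
  proof -
    note c = *[THEN hpart_carr[OF hsp]]
    note tm1 = Lin_tensor_map[OF vsp2 vsp Lmu linear_on_id[of "scl A" "carr A"]]
    note tm2 = Lin_tensor_map[OF vsp vsp2 linear_on_id[of "scl A" "carr A"] Lmu]
    have "prd A (prd A x y) z = mu A (tensor_map A (yd_tensor \<Phi> A A) A A id (mu A)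
        (tensor_scale (inverse (\<Phi> e f g)) (ptens A (yd_tensor \<Phi> A A) x (ptens A A y z))))"
      using as[OF ptens_carr[OF ptens_carr[OF c(1,2)] c(3)]]
      unfolding associator_ptens[OF hsp hsp hsp *] tm1(2)[OF ptens_carr[OF c(1,2)] c(3)] id_apply .
    also have "\<dots> = scl A (inverse (\<Phi> e f g)) (mu A (tensor_map A (yd_tensor \<Phi> A A) A A id (mu A)
        (ptens A (yd_tensor \<Phi> A A) x (ptens A A y z))))"
      using linear_onD(3)[OF linear_on_comp[OF tm2(1) Lmu] ptens_carr[OF c(1) ptens_carr[OF c(2,3)]]] by simp
    finally show ?thesis unfolding tm2(2)[OF c(1) ptens_carr[OF c(2,3)]] id_apply .
  qed
  show "\<And>x. x \<in> carr A \<Longrightarrow> prd A (unt A) x = x" "\<And>x. x \<in> carr A \<Longrightarrow> prd A x (unt A) = x"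
    by (fact un)+
qed

section \<open>Functoriality, naturality, and restriction of the structure maps to
  subobjects\<close>

lemma tensor_map_cong:
  assumes "\<And>x. x \<in> carr V \<Longrightarrow> p x = p' x" "\<And>y. y \<in> carr W \<Longrightarrow> q y = q' y"
  shows "tensor_map V W X Y p q = tensor_map V W X Y p' q'"
  \<comment> \<open>The two \<open>SOME\<close> terms have equivalent predicates, so they are equal
    as functions, not only on the carrier.\<close>
  unfolding tensor_map_def using assms by (simp cong: ball_cong)

lemma tensor_map_comp:
  assumes "vsp V" "vsp W" "vsp X" "vsp Y" "Lin V X p" "Lin W Y q" "Lin X X' p'" "Lin Y Y' q'"
    and T: "T \<in> carr (yd_tensor \<Phi> V W)"
  shows "tensor_map X Y X' Y' p' q' (tensor_map V W X Y p q T) = tensor_map V W X' Y' (\<lambda>x. p' (p x)) (\<lambda>y. q' (q y)) T"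
proof -
  note 1 = Lin_tensor_map[OF assms(1,2,5,6)]
  note 2 = Lin_tensor_map[OF assms(3,4,7,8)]
  note 3 = Lin_tensor_map[OF assms(1,2) linear_on_comp[OF assms(5,7)] linear_on_comp[OF assms(6,8)]]
  show ?thesis
  proof (rule linear_on_eq_on_tensor_span[OF _ _ _ order_refl order_refl T[unfolded yd_tensor_simps]])
    show "linear_on tensor_scale tensor_scale (tensor_span (scl V) (scl W) (carr V) (carr W))
        (carr (yd_tensor \<Phi> X' Y')) (\<lambda>T. tensor_map X Y X' Y' p' q' (tensor_map V W X Y p q T))"
      using linear_on_comp[OF 1(1)[of \<Phi> \<Phi>] 2(1)[of \<Phi> \<Phi>]] by simp
    show "linear_on tensor_scale tensor_scale (tensor_span (scl V) (scl W) (carr V) (carr W))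
        (carr (yd_tensor \<Phi> X' Y')) (tensor_map V W X' Y' (\<lambda>x. p' (p x)) (\<lambda>y. q' (q y)))"
      using 3(1)[of \<Phi> \<Phi>] by simp
    fix x y assume "x \<in> carr V" "y \<in> carr W"
    then show "tensor_map X Y X' Y' p' q' (tensor_map V W X Y p q (ptens V W x y)) =
        tensor_map V W X' Y' (\<lambda>x. p' (p x)) (\<lambda>y. q' (q y)) (ptens V W x y)"
      using linear_onD(1)[OF assms(5)] linear_onD(1)[OF assms(6)] by (simp add: 1(2) 2(2) 3(2))
  qed
qed

text \<open>\<open>p\<close>, \<open>q\<close> and \<open>r\<close> preserve degrees, so the
  associator contributes the same scalar before and after applying them.\<close>

lemma associator_natural:
  assumes V: "hsp V" and W: "hsp W" and X: "hsp X" and V': "hsp V'" and W': "hsp W'" and X': "hsp X'"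
    and p: "hmap V V' p" and q: "hmap W W' q" and r: "hmap X X' r"
    and T: "T \<in> carr (yd_tensor \<Phi> (yd_tensor \<Phi> V W) X)"
  shows "associator \<Phi> V' W' X' (tensor_map (yd_tensor \<Phi> V W) X (yd_tensor \<Phi> V' W') X' (tensor_map V W V' W' p q) r T) =
    tensor_map V (yd_tensor \<Phi> W X) V' (yd_tensor \<Phi> W' X') p (tensor_map W X W' X' q r) (associator \<Phi> V W X T)"
proof -
  note pq = hmap_tensor_map[OF V W p q, of \<Phi> \<Phi>] note qr = hmap_tensor_map[OF W X q r, of \<Phi> \<Phi>]
  note vs = V[THEN hsp_imp_vsp] W[THEN hsp_imp_vsp] X[THEN hsp_imp_vsp]
  note L = Lin_tensor_map[OF vsp_tensor vs(3) hmapD(1)[OF pq] hmapD(1)[OF r]]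
  note R = Lin_tensor_map[OF vs(1) vsp_tensor hmapD(1)[OF p] hmapD(1)[OF qr]]
  note as = hmap_associator[OF V W X, of \<Phi>] note as' = hmap_associator[OF V' W' X', of \<Phi>]
  show ?thesis
  proof (rule tensor3_eqI_left[OF V W X linear_on_comp[OF L(1)[unfolded yd_tensor_simps(1)] hmapD(1)[OF as', unfolded yd_tensor_simps(1)]]
        linear_on_comp[OF hmapD(1)[OF as, unfolded yd_tensor_simps(1)] R(1)[unfolded yd_tensor_simps(1)]] _ T])
    fix e f g x y z assume *: "x \<in> hpart V e" "y \<in> hpart W f" "z \<in> hpart X g"
    note c = hpart_carr[OF V *(1)] hpart_carr[OF W *(2)] hpart_carr[OF X *(3)]
    note H' = hmapD(2)[OF p *(1)] hmapD(2)[OF q *(2)] hmapD(2)[OF r *(3)]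
    show "associator \<Phi> V' W' X' (tensor_map (yd_tensor \<Phi> V W) X (yd_tensor \<Phi> V' W') X' (tensor_map V W V' W' p q) r
        (ptens (yd_tensor \<Phi> V W) X (ptens V W x y) z)) =
      tensor_map V (yd_tensor \<Phi> W X) V' (yd_tensor \<Phi> W' X') p (tensor_map W X W' X' q r)
        (associator \<Phi> V W X (ptens (yd_tensor \<Phi> V W) X (ptens V W x y) z))"
      unfolding associator_ptens[OF V W X *] L(2)[OF ptens_carr[OF c(1,2)] c(3)]
        Lin_tensor_map(2)[OF vs(1,2) hmapD(1)[OF p] hmapD(1)[OF q] c(1,2)] associator_ptens[OF V' W' X' H']
        hmap_tensor_scale[OF hmap_tensor_map[OF V hsp_tensor[OF W X] p qr] ptens_carr[OF c(1) ptens_carr[OF c(2,3)]]]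
        R(2)[OF c(1) ptens_carr[OF c(2,3)]]
        Lin_tensor_map(2)[OF vs(2,3) hmapD(1)[OF q] hmapD(1)[OF r] c(2,3)] ..
  qed
qed

lemma tensor_map_act:
  assumes V: "hsp V" and W: "hsp W" and X: "hsp X" and Y: "hsp Y"
    and act: "\<And>e. hmap V V (act V e)" "\<And>e. hmap W W (act W e)" "\<And>e. hmap X X (act X e)" "\<And>e. hmap Y Y (act Y e)"
    and p: "yd_hom V X p" and q: "yd_hom W Y q" and T: "T \<in> carr (yd_tensor \<Phi> V W)"
  shows "tensor_map V W X Y p q (act (yd_tensor \<Phi> V W) e T) = act (yd_tensor \<Phi> X Y) e (tensor_map V W X Y p q T)"
proof -
  note pm = yd_hom_hmap[OF p] note qm = yd_hom_hmap[OF q]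
  note pq = hmap_tensor_map[OF V W pm qm, of \<Phi> \<Phi>]
  note tm = Lin_tensor_map(2)[OF V[THEN hsp_imp_vsp] W[THEN hsp_imp_vsp] hmapD(1)[OF pm] hmapD(1)[OF qm]]
  note t1 = tensor_act_props[OF V W act(1,2), where \<Phi> = \<Phi>] note t2 = tensor_act_props[OF X Y act(3,4), where \<Phi> = \<Phi>]
  have pa: "p (act V e x) = act X e (p x)" if "x \<in> carr V" for x using p that by (simp add: yd_hom_def)
  have qa: "q (act W e x) = act Y e (q x)" if "x \<in> carr W" for x using q that by (simp add: yd_hom_def)
  show ?thesis
  proof (rule tensor_eqI[OF V W linear_on_comp[OF hmapD(1)[OF t1(2), unfolded yd_tensor_simps(1)] hmapD(1)[OF pq, unfolded yd_tensor_simps(1)]]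
       linear_on_comp[OF hmapD(1)[OF pq, unfolded yd_tensor_simps(1)] hmapD(1)[OF t2(2), unfolded yd_tensor_simps(1)]] _ T])
    fix g f x y assume *: "x \<in> hpart V g" "y \<in> hpart W f"
    note c = hpart_carr[OF V *(1)] hpart_carr[OF W *(2)]
    note ca = linear_onD(1)[OF hmapD(1)[OF act(1)] c(1)] linear_onD(1)[OF hmapD(1)[OF act(2)] c(2)]
    show "tensor_map V W X Y p q (act (yd_tensor \<Phi> V W) e (ptens V W x y)) =
        act (yd_tensor \<Phi> X Y) e (tensor_map V W X Y p q (ptens V W x y))"
      unfolding t1(1)[OF *] hmap_tensor_scale[OF pq ptens_carr[OF ca]] tm[OF c] tm[OF ca]
        t2(1)[OF hmapD(2)[OF pm *(1)] hmapD(2)[OF qm *(2)]] pa[OF c(1)] qa[OF c(2)] ..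
  qed
qed

text \<open>Pure tensors depend only on the scalar multiplications, so the tensors of a subobject
  are literally tensors of the ambient object. The maps chosen by \<open>SOME\<close> for the two
  objects need not be equal as functions, but they agree on the smaller tensor product; this is what
  \<open>tensor_map_sub\<close>, \<open>associator_sub\<close>, \<open>tensor_act_sub\<close> and
  the unitor versions record.\<close>

definition sub_hsp :: "('g, 'k::field, 'v::ab_group_add, 'y) yd_scheme
    \<Rightarrow> ('g, 'k, 'v, 'z) yd_scheme \<Rightarrow> bool"
  where "sub_hsp V' V \<longleftrightarrow> scl V' = scl V \<and> carr V' \<subseteq> carr V \<and> (\<forall>g. hpart V' g \<subseteq> hpart V g)"

lemma sub_hspD: "sub_hsp V' V \<Longrightarrow> scl V' = scl V" "sub_hsp V' V \<Longrightarrow> carr V' \<subseteq> carr V"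
  "sub_hsp V' V \<Longrightarrow> hpart V' g \<subseteq> hpart V g"
  by (auto simp: sub_hsp_def)

lemma sub_hsp_tensor:
  assumes "sub_hsp V' V" "sub_hsp W' W"
  shows "sub_hsp (yd_tensor \<Phi> V' W') (yd_tensor \<Phi> V W)"
  unfolding sub_hsp_def yd_tensor_simps sub_hspD(1)[OF assms(1)] sub_hspD(1)[OF assms(2)]
proof (intro conjI allI refl tensor_span_mono sub_hspD(2)[OF assms(1)] sub_hspD(2)[OF assms(2)] tensor.span_mono)
  fix g
  show "{ptens V W x y |x y e f. x \<in> hpart V' e \<and> y \<in> hpart W' f \<and> e + f = g}
    \<subseteq> {ptens V W x y |x y e f. x \<in> hpart V e \<and> y \<in> hpart W f \<and> e + f = g}"
    using assms unfolding sub_hsp_def by blast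
qed

text \<open>The targets \<open>X'\<close> and \<open>X\<close> need to share only their scalar
  multiplication, since that is all the pure tensors in the target refer to.\<close>

lemma tensor_map_sub:
  assumes sub: "sub_hsp V' V" "sub_hsp W' W" and vs: "vsp V'" "vsp W'" "vsp V" "vsp W"
    and s: "scl X' = scl X" "scl Y' = scl Y"
    and p: "linear_on (scl V) (scl X) (carr V) UNIV p" and q: "linear_on (scl W) (scl Y) (carr W) UNIV q"
    and T: "T \<in> carr (yd_tensor \<Phi> V' W')"
  shows "tensor_map V' W' X' Y' p q T = tensor_map V W X Y p q T"
proof -
  have p': "linear_on (scl V') (scl X') (carr V') UNIV p"
    using linear_on_weaken[OF p sub_hspD(2)[OF sub(1)] order_refl] by (simp add: s sub_hspD(1)[OF sub(1)])
  have q': "linear_on (scl W') (scl Y') (carr W') UNIV q"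
    using linear_on_weaken[OF q sub_hspD(2)[OF sub(2)] order_refl] by (simp add: s sub_hspD(1)[OF sub(2)])
  note 1 = tensor_map_props[OF vs(1,2) p' q'] note 2 = tensor_map_props[OF vs(3,4) p q]
  show ?thesis
  proof (rule linear_on_eq_on_tensor_span[OF linear_imp_linear_on[OF 1(1)] linear_imp_linear_on[OF 2(1)] _ order_refl order_refl
        T[unfolded yd_tensor_simps]])
    fix x y assume xy: "x \<in> carr V'" "y \<in> carr W'"
    show "tensor_map V' W' X' Y' p q (ptens V' W' x y) = tensor_map V W X Y p q (ptens V' W' x y)"
      unfolding 1(2)[OF xy] unfolding sub_hspD(1)[OF sub(1)] sub_hspD(1)[OF sub(2)] s
        2(2)[OF subsetD[OF sub_hspD(2)[OF sub(1)] xy(1)] subsetD[OF sub_hspD(2)[OF sub(2)] xy(2)]] ..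
  qed
qed

lemma associator_sub:
  assumes sub: "sub_hsp V' V" "sub_hsp W' W" "sub_hsp X' X"
    and hs: "hsp V'" "hsp W'" "hsp X'" "hsp V" "hsp W" "hsp X"
    and T: "T \<in> carr (yd_tensor \<Phi> (yd_tensor \<Phi> V' W') X')"
  shows "associator \<Phi> V' W' X' T = associator \<Phi> V W X T"
proof (rule tensor3_eqI_left[OF hs(1-3) linear_imp_linear_on[OF associator_linear[OF hs(1-3)]]
      linear_imp_linear_on[OF associator_linear[OF hs(4-6)]] _ T])
  fix e f g x y z assume *: "x \<in> hpart V' e" "y \<in> hpart W' f" "z \<in> hpart X' g"
  show "associator \<Phi> V' W' X' (ptens (yd_tensor \<Phi> V' W') X' (ptens V' W' x y) z) =
      associator \<Phi> V W X (ptens (yd_tensor \<Phi> V' W') X' (ptens V' W' x y) z)"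
    unfolding associator_ptens[OF hs(1-3) *]
    using associator_ptens[OF hs(4-6) subsetD[OF sub_hspD(3)[OF sub(1)] *(1)]
        subsetD[OF sub_hspD(3)[OF sub(2)] *(2)] subsetD[OF sub_hspD(3)[OF sub(3)] *(3)], of \<Phi>]
    by (simp add: sub_hspD(1)[OF sub(1)] sub_hspD(1)[OF sub(2)] sub_hspD(1)[OF sub(3)])
qed

lemma tensor_act_sub:
  assumes sub: "sub_hsp V' V" "sub_hsp W' W" and hs: "hsp V'" "hsp W'" "hsp V" "hsp W"
    and act: "\<And>e. hmap V' V' (act V' e)" "\<And>e. hmap W' W' (act W' e)" "\<And>e. hmap V V (act V e)" "\<And>e. hmap W W (act W e)"
    and eq: "act V' = act V" "act W' = act W" and T: "T \<in> carr (yd_tensor \<Phi> V' W')"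
  shows "act (yd_tensor \<Phi> V' W') e T = act (yd_tensor \<Phi> V W) e T"
proof -
  note t1 = tensor_act_props[OF hs(1,2) act(1,2), where \<Phi> = \<Phi>] note t2 = tensor_act_props[OF hs(3,4) act(3,4), where \<Phi> = \<Phi>]
  note L2 = linear_on_weaken[OF hmapD(1)[OF t2(2), unfolded yd_tensor_simps(1)] sub_hspD(2)[OF sub_hsp_tensor[OF sub]] order_refl]
  show ?thesis
  proof (rule tensor_eqI[OF hs(1,2) hmapD(1)[OF t1(2), unfolded yd_tensor_simps(1)] L2 _ T])
    fix g f x y assume *: "x \<in> hpart V' g" "y \<in> hpart W' f"
    note H' = subsetD[OF sub_hspD(3)[OF sub(1)] *(1)] subsetD[OF sub_hspD(3)[OF sub(2)] *(2)]
    show "act (yd_tensor \<Phi> V' W') e (ptens V' W' x y) = act (yd_tensor \<Phi> V W) e (ptens V' W' x y)"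
      unfolding t1(1)[OF *] unfolding sub_hspD(1)[OF sub(1)] sub_hspD(1)[OF sub(2)] t2(1)[OF H'] eq ..
  qed
qed

locale yd_bialg = yd_alg \<Phi> A
  for \<Phi> :: "'g::ab_group_add \<Rightarrow> 'g \<Rightarrow> 'g \<Rightarrow> 'k::field"
    and A :: "('g, 'k, 'v::ab_group_add, 'z) hopf_scheme" +
  assumes coalg: "braided_coalgebra \<Phi> A"
    and comul_prd: "\<And>x y. x \<in> carr A \<Longrightarrow> y \<in> carr A \<Longrightarrow> comul A (prd A x y) = star (comul A x) (comul A y)"
    and comul_unt: "comul A (unt A) = ptens A A (unt A) (unt A)"
    and counit_prd: "\<And>x y. x \<in> carr A \<Longrightarrow> y \<in> carr A \<Longrightarrow> counit A (prd A x y) = counit A x * counit A y"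
    and counit_unt: "counit A (unt A) = 1"
begin

lemma yd_hom_comul: "yd_hom A AA (comul A)"
  and yd_hom_counit: "yd_hom A yd_unit (counit A)"
  and coassoc: "\<And>x. x \<in> carr A \<Longrightarrow>
       associator \<Phi> A A A (tensor_map A A AA A (comul A) id (comul A x)) =
       tensor_map A A A AA id (comul A) (comul A x)"
  and counit_left: "\<And>x. x \<in> carr A \<Longrightarrow> left_unitor A (tensor_map A A yd_unit A (counit A) id (comul A x)) = x"
  and counit_right: "\<And>x. x \<in> carr A \<Longrightarrow> right_unitor A (tensor_map A A A yd_unit id (counit A) (comul A x)) = x"
  using coalg unfolding braided_coalgebra_def by blast+

lemmas hmap_comul = yd_hom_hmap[OF yd_hom_comul]
lemmas Lin_comul = hmapD(1)[OF hmap_comul]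
lemmas Lin_counit = hmapD(1)[OF yd_hom_hmap[OF yd_hom_counit]]
lemmas comul_carr = linear_onD(1)[OF Lin_comul]

lemma braided_bialgebra: "braided_bialgebra \<Phi> A"
  unfolding braided_bialgebra_def
proof (intro conjI ballI braided_algebra coalg comul_unt counit_prd counit_unt)
  note tm = Lin_tensor_map[OF vsp vsp Lin_comul Lin_comul]
  fix T assume T: "T \<in> carr AA"
  have L: "linear_on tensor_scale tensor_scale (carr AA) (carr AA) (\<lambda>T. comul A (mu A T))"
    using linear_on_comp[OF Lin_mu Lin_comul] by simp
  have R: "linear_on tensor_scale tensor_scale (carr AA) (carr AA)
      (\<lambda>T. tensor_square_mu \<Phi> A (tensor_map A A AA AA (comul A) (comul A) T))"
    using linear_on_comp[OF tm(1)[of \<Phi> \<Phi>] hmapD(1)[OF hmap_tensor_square_mu]] by simp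
  show "comul A (mu A T) = tensor_square_mu \<Phi> A (tensor_map A A AA AA (comul A) (comul A) T)"
  proof (rule tensor_eqI[OF hsp hsp L R _ T])
    fix e f x y assume "x \<in> hpart A e" "y \<in> hpart A f"
    note c = this[THEN hcarr]
    show "comul A (prd A x y) = tensor_square_mu \<Phi> A (tensor_map A A AA AA (comul A) (comul A) (ptens A A x y))"
      unfolding tm(2)[OF c] comul_prd[OF c] star_def ..
  qed
qed

end

lemma braided_bialgebra_imp_yd_bialg:
  assumes "braided_bialgebra \<Phi> A"
  shows "yd_bialg \<Phi> A"
proof -
  have alg: "braided_algebra \<Phi> A" and coalg: "braided_coalgebra \<Phi> A"
    using assms unfolding braided_bialgebra_def by blast+
  interpret yd_alg \<Phi> A by (rule braided_algebra_imp_yd_alg[OF alg])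
  have "yd_hom A AA (comul A)" using coalg unfolding braided_coalgebra_def by blast
  note L = hmapD(1)[OF yd_hom_hmap[OF this]]
  show ?thesis
  proof
    fix x y assume xy: "x \<in> carr A" "y \<in> carr A"
    have "comul A (prd A x y) = tensor_square_mu \<Phi> A (tensor_map A A AA AA (comul A) (comul A) (ptens A A x y))"
      using assms ptens_carr2[OF xy] unfolding braided_bialgebra_def by blast
    then show "comul A (prd A x y) = star (comul A x) (comul A y)"
      unfolding Lin_tensor_map(2)[OF vsp vsp L L xy] star_def .
  qed (use assms in \<open>auto simp: braided_bialgebra_def\<close>)
qed

section \<open>The antipode of a connected graded bialgebra\<close>

context yd_bialg
begin

definition conv :: "('v \<Rightarrow> 'v) \<Rightarrow> ('v \<Rightarrow> 'v) \<Rightarrow> 'v \<Rightarrow> 'v"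
  where "conv f g x = mu A (tensor_map A A A A f g (comul A x))"

definition eta :: "'v \<Rightarrow> 'v"
  where "eta x = scl A (counit A x) (unt A)"

lemma Lin_mu_tensor_map:
  assumes "Lin A A f" "Lin A A g"
  shows "linear_on tensor_scale (scl A) (carr AA) (carr A) (\<lambda>T. mu A (tensor_map A A A A f g T))"
  using linear_on_comp[OF Lin_tensor_map(1)[OF vsp vsp assms, of \<Phi> \<Phi>] Lin_mu] by simp

lemmas tensor_map_A = Lin_tensor_map(2)[where V = A and W = A and X = A and Y = A, OF vsp vsp]

lemma Lin_conv: "Lin A A f \<Longrightarrow> Lin A A g \<Longrightarrow> Lin A A (conv f g)"
  unfolding conv_def using linear_on_comp[OF Lin_comul[unfolded yd_tensor_simps(1)] Lin_mu_tensor_map] by simp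

lemma hmap_conv: "hmap A A f \<Longrightarrow> hmap A A g \<Longrightarrow> hmap A A (conv f g)"
  using hmap_comp[OF hmap_comul hmap_comp[OF hmap_tensor_map[OF hsp hsp, of A f A g \<Phi> \<Phi>] hmap_mu]]
  by (simp add: comp_def conv_def[abs_def])

lemma conv_cong:
  assumes "\<And>x. x \<in> carr A \<Longrightarrow> f x = f' x" "\<And>x. x \<in> carr A \<Longrightarrow> g x = g' x"
  shows "conv f g = conv f' g'"
  unfolding conv_def[abs_def] using tensor_map_cong[of A f f' A g g' A A, OF assms] by simp

lemma yd_hom_conv:
  assumes "yd_hom A A f" "yd_hom A A g"
  shows "yd_hom A A (conv f g)"
proof -
  note hm = yd_hom_hmap[OF assms(1)] yd_hom_hmap[OF assms(2)]
  have "conv f g (act A e x) = act A e (conv f g x)" if x: "x \<in> carr A" for e x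
  proof -
    have "comul A (act A e x) = act AA e (comul A x)"
      using yd_hom_comul x by (simp add: yd_hom_def)
    then show ?thesis
      unfolding conv_def
      using tensor_map_act[OF hsp hsp hsp hsp hmap_act hmap_act hmap_act hmap_act assms comul_carr[OF x], of e]
        mu_act[OF linear_onD(1)[OF Lin_tensor_map(1)[OF vsp vsp hmapD(1)[OF hm(1)] hmapD(1)[OF hm(2)]] comul_carr[OF x]], of e]
      by simp
  qed
  then show ?thesis using hmap_conv[OF hm] unfolding hmap_def yd_hom_def by blast
qed

text \<open>Convolution is strictly associative although the category is not: associativity of the
  product and coassociativity of the coproduct involve the same associator, and naturality moves
  \<open>f\<close>, \<open>g\<close>, \<open>h\<close> across it. This is where the maps must
  preserve degrees.\<close>

lemma conv_assoc:
  assumes f: "hmap A A f" and g: "hmap A A g" and h: "hmap A A h" and x: "x \<in> carr A"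
  shows "conv (conv f g) h x = conv f (conv g h) x"
proof -
  note L = f[THEN hmapD(1)] g[THEN hmapD(1)] h[THEN hmapD(1)]
  note fg = hmap_tensor_map[OF hsp hsp f g, of \<Phi> \<Phi>] note gh = hmap_tensor_map[OF hsp hsp g h, of \<Phi> \<Phi>]
  note id = linear_on_id[of "scl A" "carr A"]
  note D = comul_carr[OF x]
  define T where "T = tensor_map A A AA A (comul A) id (comul A x)"
  have T: "T \<in> carr (yd_tensor \<Phi> AA A)"
    unfolding T_def by (rule linear_onD(1)[OF Lin_tensor_map(1)[OF vsp vsp Lin_comul id] D])
  have "tensor_map A A A A (conv f g) h (comul A x) =
      tensor_map AA A A A (mu A) id (tensor_map AA A AA A (tensor_map A A A A f g) h T)"
    unfolding T_def tensor_map_comp[OF vsp vsp vsp2 vsp Lin_comul id hmapD(1)[OF fg] L(3) D]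
    unfolding tensor_map_comp[OF vsp vsp vsp2 vsp linear_on_comp[OF Lin_comul hmapD(1)[OF fg]]
        linear_on_comp[OF id L(3)] Lin_mu id D]
    unfolding conv_def[abs_def] id_apply ..
  then have "conv (conv f g) h x = mu A (tensor_map AA A A A (mu A) id (tensor_map AA A AA A (tensor_map A A A A f g) h T))"
    unfolding conv_def[of "conv f g"] by (rule arg_cong)
  also have "\<dots> = mu A (tensor_map A AA A A id (mu A) (associator \<Phi> A A A (tensor_map AA A AA A (tensor_map A A A A f g) h T)))"
    by (rule mu_assoc[OF linear_onD(1)[OF Lin_tensor_map(1)[OF vsp2 vsp hmapD(1)[OF fg] L(3)] T]])
  also have "associator \<Phi> A A A (tensor_map AA A AA A (tensor_map A A A A f g) h T) =
      tensor_map A AA A AA f (tensor_map A A A A g h) (associator \<Phi> A A A T)"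
    by (rule associator_natural[OF hsp hsp hsp hsp hsp hsp f g h T])
  also have "associator \<Phi> A A A T = tensor_map A A A AA id (comul A) (comul A x)"
    unfolding T_def by (rule coassoc[OF x])
  also have "tensor_map A AA A A id (mu A) (tensor_map A AA A AA f (tensor_map A A A A g h)
      (tensor_map A A A AA id (comul A) (comul A x))) = tensor_map A A A A f (conv g h) (comul A x)"
    unfolding tensor_map_comp[OF vsp vsp vsp vsp2 id Lin_comul L(1) hmapD(1)[OF gh] D]
    unfolding tensor_map_comp[OF vsp vsp vsp vsp2 linear_on_comp[OF id L(1)]
        linear_on_comp[OF Lin_comul hmapD(1)[OF gh]] id Lin_mu D]
    unfolding conv_def[abs_def] id_apply ..
  finally show ?thesis unfolding conv_def[of f] .
qed

lemma yd_hom_eta: "yd_hom A A eta"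
proof -
  have c: "counit A x = 0" if "x \<in> hpart A g" "g \<noteq> 0" for x g
    using hmapD(2)[OF yd_hom_hmap[OF yd_hom_counit] that(1)] that(2) by simp
  have "eta x \<in> hpart A g" if x: "x \<in> hpart A g" for x g
  proof (cases "g = 0")
    case True
    then show ?thesis unfolding eta_def using vs.subspace_scale[OF hpart_subspace unt_hpart] by simp
  next
    case False
    then show ?thesis unfolding eta_def using c[OF x] vs.subspace_0[OF hpart_subspace] by simp
  qed
  moreover have "eta (act A e x) = act A e (eta x)" if "x \<in> carr A" for e x
    using yd_hom_counit that linear_onD(3)[OF Lin_act unt_carr]
    unfolding eta_def yd_hom_def yd_unit_simps by (simp add: act_unt)
  moreover have "Lin A A eta"
    using Lin_counit vs.subspace_scale[OF carr_subspace unt_carr]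
    by (simp add: linear_on_def eta_def vs.scale_left_distrib)
  ultimately show ?thesis unfolding yd_hom_def by blast
qed

lemmas Lin_eta = hmapD(1)[OF yd_hom_hmap[OF yd_hom_eta]]

text \<open>On \<open>y \<otimes> z\<close> both sides give \<open>counit A z\<close> times
  \<open>f y\<close>, so the claim is \<open>f\<close> applied to the right counit axiom.\<close>

lemma conv_eta_right:
  assumes f: "Lin A A f" and x: "x \<in> carr A"
  shows "conv f eta x = f x"
proof -
  note id = linear_on_id[of "scl A" "carr A"]
  note tm = Lin_tensor_map[OF vsp vsp id Lin_counit]
  have F: "linear_on tensor_scale (scl A) (carr AA) (carr A) (\<lambda>T. f (right_unitor A (tensor_map A A A yd_unit id (counit A) T)))"
    using linear_on_comp[OF tm(1)[of \<Phi> \<Phi>] linear_on_comp[OF Lin_right_unitor[OF vsp] f]] by simp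
  have "mu A (tensor_map A A A A f eta T) = f (right_unitor A (tensor_map A A A yd_unit id (counit A) T))"
    if "T \<in> carr AA" for T
  proof (rule tensor_eqI[OF hsp hsp Lin_mu_tensor_map[OF f Lin_eta] F _ that])
    fix e g y z assume "y \<in> hpart A e" "z \<in> hpart A g"
    note c = this[THEN hcarr]
    show "mu A (tensor_map A A A A f eta (ptens A A y z)) = f (right_unitor A (tensor_map A A A yd_unit id (counit A) (ptens A A y z)))"
      unfolding tensor_map_A[OF f Lin_eta c] tm(2)[OF c] eta_def id_apply right_unitor_ptens[OF vsp c(1)]
        prd_scale_right[OF linear_onD(1)[OF f c(1)] unt_carr] prd_unt(2)[OF linear_onD(1)[OF f c(1)]] linear_onD(3)[OF f c(1)] ..
  qed
  from this[OF comul_carr[OF x]] show ?thesis unfolding conv_def counit_right[OF x] .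
qed

lemma conv_eta_left:
  assumes f: "Lin A A f" and x: "x \<in> carr A"
  shows "conv eta f x = f x"
proof -
  note id = linear_on_id[of "scl A" "carr A"]
  note tm = Lin_tensor_map[OF vsp vsp Lin_counit id]
  have F: "linear_on tensor_scale (scl A) (carr AA) (carr A) (\<lambda>T. f (left_unitor A (tensor_map A A yd_unit A (counit A) id T)))"
    using linear_on_comp[OF tm(1)[of \<Phi> \<Phi>] linear_on_comp[OF Lin_left_unitor[OF vsp] f]] by simp
  have "mu A (tensor_map A A A A eta f T) = f (left_unitor A (tensor_map A A yd_unit A (counit A) id T))"
    if "T \<in> carr AA" for T
  proof (rule tensor_eqI[OF hsp hsp Lin_mu_tensor_map[OF Lin_eta f] F _ that])
    fix e g y z assume "y \<in> hpart A e" "z \<in> hpart A g"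
    note c = this[THEN hcarr]
    show "mu A (tensor_map A A A A eta f (ptens A A y z)) = f (left_unitor A (tensor_map A A yd_unit A (counit A) id (ptens A A y z)))"
      unfolding tensor_map_A[OF Lin_eta f c] tm(2)[OF c] eta_def id_apply left_unitor_ptens[OF vsp c(2)]
        prd_scale_left[OF unt_carr linear_onD(1)[OF f c(2)]] prd_unt(1)[OF linear_onD(1)[OF f c(2)]] linear_onD(3)[OF f c(2)] ..
  qed
  from this[OF comul_carr[OF x]] show ?thesis unfolding conv_def counit_left[OF x] .
qed

lemma Lin_add: "Lin A A f \<Longrightarrow> Lin A A g \<Longrightarrow> Lin A A (\<lambda>x. f x + g x)"
  using vs.subspace_add[OF carr_subspace] by (simp add: linear_on_def vs.scale_right_distrib ac_simps)

lemma Lin_diff: "Lin A A f \<Longrightarrow> Lin A A g \<Longrightarrow> Lin A A (\<lambda>x. f x - g x)"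
  using vs.subspace_diff[OF carr_subspace] by (simp add: linear_on_def vs.scale_right_diff_distrib algebra_simps)

lemma conv_add_left:
  assumes f: "Lin A A f" "Lin A A f'" and g: "Lin A A g" and x: "x \<in> carr A"
  shows "conv (\<lambda>x. f x + f' x) g x = conv f g x + conv f' g x"
  unfolding conv_def
proof (rule tensor_eqI[OF hsp hsp Lin_mu_tensor_map[OF Lin_add[OF f] g] _ _ comul_carr[OF x]])
  show "linear_on tensor_scale (scl A) (carr AA) UNIV
      (\<lambda>T. mu A (tensor_map A A A A f g T) + mu A (tensor_map A A A A f' g T))"
    by (rule linear_on_add[OF hspD(1)[OF hsp] linear_on_weaken[OF Lin_mu_tensor_map[OF f(1) g] order_refl subset_UNIV]
        linear_on_weaken[OF Lin_mu_tensor_map[OF f(2) g] order_refl subset_UNIV]])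
  fix e h y z assume "y \<in> hpart A e" "z \<in> hpart A h"
  note c = this[THEN hcarr]
  show "mu A (tensor_map A A A A (\<lambda>x. f x + f' x) g (ptens A A y z)) =
      mu A (tensor_map A A A A f g (ptens A A y z)) + mu A (tensor_map A A A A f' g (ptens A A y z))"
    unfolding tensor_map_A[OF Lin_add[OF f] g c] tensor_map_A[OF f(1) g c] tensor_map_A[OF f(2) g c]
    by (rule prd_add_left[OF linear_onD(1)[OF f(1) c(1)] linear_onD(1)[OF f(2) c(1)] linear_onD(1)[OF g c(2)]])
qed

lemma conv_add_right:
  assumes f: "Lin A A f" "Lin A A f'" and g: "Lin A A g" and x: "x \<in> carr A"
  shows "conv g (\<lambda>x. f x + f' x) x = conv g f x + conv g f' x"
  unfolding conv_def
proof (rule tensor_eqI[OF hsp hsp Lin_mu_tensor_map[OF g Lin_add[OF f]] _ _ comul_carr[OF x]])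
  show "linear_on tensor_scale (scl A) (carr AA) UNIV
      (\<lambda>T. mu A (tensor_map A A A A g f T) + mu A (tensor_map A A A A g f' T))"
    by (rule linear_on_add[OF hspD(1)[OF hsp] linear_on_weaken[OF Lin_mu_tensor_map[OF g f(1)] order_refl subset_UNIV]
        linear_on_weaken[OF Lin_mu_tensor_map[OF g f(2)] order_refl subset_UNIV]])
  fix e h y z assume "y \<in> hpart A e" "z \<in> hpart A h"
  note c = this[THEN hcarr]
  show "mu A (tensor_map A A A A g (\<lambda>x. f x + f' x) (ptens A A y z)) =
      mu A (tensor_map A A A A g f (ptens A A y z)) + mu A (tensor_map A A A A g f' (ptens A A y z))"
    unfolding tensor_map_A[OF g Lin_add[OF f] c] tensor_map_A[OF g f(1) c] tensor_map_A[OF g f(2) c]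
    by (rule prd_add_right[OF linear_onD(1)[OF g c(1)] linear_onD(1)[OF f(1) c(2)] linear_onD(1)[OF f(2) c(2)]])
qed

end

section \<open>The convolution inverse of the identity\<close>

locale connected_yd_bialg = yd_bialg \<Phi> A
  for \<Phi> :: "'g::ab_group_add \<Rightarrow> 'g \<Rightarrow> 'g \<Rightarrow> 'k::field"
    and A :: "('g, 'k, 'v::ab_group_add, 'z) hopf_scheme" +
  fixes gr :: "nat \<Rightarrow> 'v set"
  assumes gr: "internal_direct_sum (scl A) (carr A) gr"
    and gr_0: "gr 0 = range (\<lambda>c. scl A c (unt A))"
    and prd_gr: "\<And>m n x y. x \<in> gr m \<Longrightarrow> y \<in> gr n \<Longrightarrow> prd A x y \<in> gr (m + n)"
    and comul_gr: "\<And>m x. x \<in> gr m \<Longrightarrow> comul A x \<in>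
      module.span tensor_scale {ptens A A y z |y z p q. y \<in> gr p \<and> z \<in> gr q \<and> p + q = m}"
    and counit_gr: "\<And>m x. m \<noteq> 0 \<Longrightarrow> x \<in> gr m \<Longrightarrow> counit A x = 0"
begin

lemmas gr_subspace = internal_direct_sum_subspace(1)[OF hspD(1)[OF hsp] gr]
lemmas gr_carr = subsetD[OF internal_direct_sum_subspace(3)[OF hspD(1)[OF hsp] gr]]
lemmas carr_gr = internal_direct_sum_subspace(4)[OF hspD(1)[OF hsp] gr]

definition dfct :: "'v \<Rightarrow> 'v" where "dfct x = eta x - x"

lemma yd_hom_dfct: "yd_hom A A dfct"
  unfolding yd_hom_def
proof (intro conjI allI ballI)
  show "Lin A A dfct"
    unfolding dfct_def[abs_def] using Lin_diff[OF Lin_eta linear_on_id[of "scl A" "carr A"]] by simp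
  show "dfct v \<in> hpart A g" if "v \<in> hpart A g" for v g
    unfolding dfct_def using vs.subspace_diff[OF hpart_subspace hmapD(2)[OF yd_hom_hmap[OF yd_hom_eta] that] that] .
  show "dfct (act A e v) = act A e (dfct v)" if v: "v \<in> carr A" for e v
  proof -
    have "act A e (eta v - v + v) = act A e (eta v - v) + act A e v"
      by (rule linear_onD(2)[OF Lin_act vs.subspace_diff[OF carr_subspace linear_onD(1)[OF Lin_eta v] v] v])
    moreover have "eta (act A e v) = act A e (eta v)" using yd_hom_eta v by (simp add: yd_hom_def)
    ultimately show ?thesis by (simp add: dfct_def)
  qed
qed

lemmas Lin_dfct = hmapD(1)[OF yd_hom_hmap[OF yd_hom_dfct]]

lemma dfct_gr_0: "x \<in> gr 0 \<Longrightarrow> dfct x = 0"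
  using linear_onD(3)[OF Lin_counit unt_carr] by (auto simp: gr_0 dfct_def eta_def counit_unt)

lemma dfct_gr: "x \<in> gr m \<Longrightarrow> dfct x \<in> gr m"
proof (cases "m = 0")
  case True
  moreover assume "x \<in> gr m"
  ultimately show ?thesis using dfct_gr_0 vs.subspace_0[OF gr_subspace] by simp
next
  case False
  moreover assume "x \<in> gr m"
  ultimately show ?thesis using vs.subspace_neg[OF gr_subspace] by (simp add: dfct_def eta_def counit_gr)
qed

lemma mu_tensor_map_gr:
  assumes "Lin A A f" "Lin A A g" "x \<in> gr m" "module.subspace (scl A) E"
    and "\<And>y z p q. y \<in> gr p \<Longrightarrow> z \<in> gr q \<Longrightarrow> p + q = m \<Longrightarrow> prd A (f y) (g z) \<in> E"
  shows "conv f g x \<in> E"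
  unfolding conv_def
proof (rule linear_on_span_into[OF vector_space_tensor_scale hspD(1)[OF hsp] Lin_mu_tensor_map[OF assms(1,2)]
      _ _ assms(4) _ comul_gr[OF assms(3)]])
  show "tensor.subspace (carr AA)" by simp
  show "{ptens A A y z |y z p q. y \<in> gr p \<and> z \<in> gr q \<and> p + q = m} \<subseteq> carr AA"
    by (intro subsetI, elim CollectE exE conjE, simp only: ptens_carr gr_carr)
  fix T assume "T \<in> {ptens A A y z |y z p q. y \<in> gr p \<and> z \<in> gr q \<and> p + q = m}"
  then obtain y z p q where T: "T = ptens A A y z" and yz: "y \<in> gr p" "z \<in> gr q" "p + q = m" by blast
  show "mu A (tensor_map A A A A f g T) \<in> E"
    unfolding T tensor_map_A[OF assms(1,2) gr_carr[OF yz(1)] gr_carr[OF yz(2)]] by (rule assms(5)[OF yz])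
qed

primrec pw :: "nat \<Rightarrow> 'v \<Rightarrow> 'v" where
  "pw 0 = eta"
| "pw (Suc n) = conv (pw n) dfct"

lemma yd_hom_pw: "yd_hom A A (pw n)"
  by (induction n) (simp_all add: yd_hom_eta yd_hom_conv yd_hom_dfct)

lemmas hmap_pw = yd_hom_hmap[OF yd_hom_pw]
lemmas Lin_pw = hmapD(1)[OF hmap_pw]

text \<open>The powers are built by multiplying on the right. The left inverse and the right inverse
  property of the geometric series need the new factor on different sides, and associativity of
  convolution supplies the other one.\<close>

lemma pw_Suc': "x \<in> carr A \<Longrightarrow> pw (Suc n) x = conv dfct (pw n) x"
proof (induction n arbitrary: x)
  case 0
  then show ?case by (simp add: conv_eta_left[OF Lin_dfct] conv_eta_right[OF Lin_dfct])
next
  case (Suc n)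
  have "pw (Suc (Suc n)) x = conv (conv dfct (pw n)) dfct x"
    using conv_cong[of "pw (Suc n)" "conv dfct (pw n)" dfct dfct] Suc.IH by simp
  also have "\<dots> = conv dfct (pw (Suc n)) x"
    using conv_assoc[OF yd_hom_hmap[OF yd_hom_dfct] hmap_pw yd_hom_hmap[OF yd_hom_dfct] Suc.prems] by simp
  finally show ?case .
qed

lemma pw_gr: "x \<in> gr m \<Longrightarrow> pw n x \<in> gr m"
proof (induction n arbitrary: x m)
  case 0
  show ?case
  proof (cases "m = 0")
    case True
    then show ?thesis unfolding True gr_0 pw.simps eta_def by (intro rangeI)
  next
    case False
    then show ?thesis using counit_gr[OF False 0] vs.subspace_0[OF gr_subspace] by (simp add: eta_def)
  qed
next
  case (Suc n)
  show ?case
    unfolding pw.simps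
  proof (rule mu_tensor_map_gr[OF Lin_pw Lin_dfct Suc.prems gr_subspace])
    fix y z p q assume "y \<in> gr p" "z \<in> gr q" "p + q = m"
    then show "prd A (pw n y) (dfct z) \<in> gr m" using prd_gr[OF Suc.IH dfct_gr] by blast
  qed
qed

text \<open>Every factor \<open>dfct\<close> must consume a positive degree. In the induction a
  right factor of degree 0 is killed by \<open>dfct\<close>, and otherwise the left factor has
  degree \<open>p < m\<close>, hence \<open>p < n\<close>.\<close>

lemma pw_vanish: "x \<in> gr m \<Longrightarrow> m < n \<Longrightarrow> pw n x = 0"
proof (induction n arbitrary: x m)
  case (Suc n)
  have "pw (Suc n) x \<in> {0}"
    unfolding pw.simps
  proof (rule mu_tensor_map_gr[OF Lin_pw Lin_dfct Suc.prems(1) vs.subspace_single_0])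
    fix y z p q assume yz: "y \<in> gr p" "z \<in> gr q" "p + q = m"
    show "prd A (pw n y) (dfct z) \<in> {0}"
    proof (cases "q = 0")
      case True
      then show ?thesis using dfct_gr_0 yz linear_on_0[OF linear_on_prd(2)[OF linear_onD(1)[OF Lin_pw gr_carr[OF yz(1)]]]]
          vs.subspace_0[OF carr_subspace] by simp
    next
      case False
      then have "pw n y = 0" using yz Suc by auto
      then show ?thesis
        using linear_on_0[OF linear_on_prd(1)[OF linear_onD(1)[OF Lin_dfct gr_carr[OF yz(2)]]]]
          vs.subspace_0[OF carr_subspace] by simp
    qed
  qed
  then show ?case by simp
qed simp

definition psum :: "nat \<Rightarrow> 'v \<Rightarrow> 'v" where "psum N x = (\<Sum>n<N. pw n x)"

text \<open>
  On \<open>A\<close> we have \<open>id = \<eta>\<epsilon> - dfct\<close> with \<open>\<eta>\<epsilon>\<close> the unit for convolution, so the geometric series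
  of convolution powers of \<open>dfct\<close> inverts \<open>id\<close>. It is locally finite since \<open>dfct\<close> vanishes in degree 0.
\<close>

definition S :: "'v \<Rightarrow> 'v" where "S x = (\<Sum>n | pw n x \<noteq> 0. pw n x)"

lemma yd_hom_psum: "yd_hom A A (psum N)"
proof (induction N)
  case 0
  show ?case using vs.subspace_0[OF carr_subspace] vs.subspace_0[OF hpart_subspace]
      linear_on_0[OF Lin_act vs.subspace_0[OF carr_subspace]]
    by (simp add: yd_hom_def linear_on_def psum_def)
next
  case (Suc N)
  have eq: "psum (Suc N) = (\<lambda>x. psum N x + pw N x)" by (simp add: psum_def fun_eq_iff)
  show ?case
    unfolding eq yd_hom_def
  proof (intro conjI allI ballI)
    show "Lin A A (\<lambda>x. psum N x + pw N x)"
      by (rule Lin_add[OF hmapD(1)[OF yd_hom_hmap[OF Suc]] Lin_pw])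
    show "psum N v + pw N v \<in> hpart A g" if "v \<in> hpart A g" for v g
      by (rule vs.subspace_add[OF hpart_subspace hmapD(2)[OF yd_hom_hmap[OF Suc] that] hmapD(2)[OF hmap_pw that]])
    show "psum N (act A e v) + pw N (act A e v) = act A e (psum N v + pw N v)" if "v \<in> carr A" for e v
      using Suc yd_hom_pw[of N] that
        linear_onD(2)[OF Lin_act linear_onD(1)[OF hmapD(1)[OF yd_hom_hmap[OF Suc]] that] linear_onD(1)[OF Lin_pw that]]
      by (simp add: yd_hom_def)
  qed
qed

lemmas Lin_psum = hmapD(1)[OF yd_hom_hmap[OF yd_hom_psum]]

lemma S_psum:
  assumes "\<And>n. n \<ge> N \<Longrightarrow> pw n x = 0"
  shows "S x = psum N x"
  unfolding S_def psum_def
  by (rule sum.mono_neutral_left) (use assms in \<open>auto simp: not_le[symmetric]\<close>)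

text \<open>An element is a finite sum of homogeneous ones, each killed by all powers beyond its
  degree; the elements with some such bound form a subspace.\<close>

lemma eventually_psum:
  assumes "x \<in> carr A"
  obtains N where "\<And>n. n \<ge> N \<Longrightarrow> pw n x = 0"
proof -
  have "carr A \<subseteq> {x \<in> carr A. \<exists>N. \<forall>n\<ge>N. pw n x = 0}"
    unfolding carr_gr
  proof (rule vs.span_minimal; fold carr_gr)
    show "(\<Union>m. gr m) \<subseteq> {x \<in> carr A. \<exists>N. \<forall>n\<ge>N. pw n x = 0}"
    proof (clarify, intro conjI gr_carr)
      fix x m assume x: "x \<in> gr m"
      show "\<exists>N. \<forall>n\<ge>N. pw n x = 0" using pw_vanish[OF x] by (intro exI[of _ "Suc m"]) simp
    qed
    show "vs.subspace {x \<in> carr A. \<exists>N. \<forall>n\<ge>N. pw n x = 0}"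
    proof (rule vs.subspaceI)
      show "0 \<in> {x \<in> carr A. \<exists>N. \<forall>n\<ge>N. pw n x = 0}"
        using vs.subspace_0[OF carr_subspace] linear_on_0[OF Lin_pw] by simp
      fix x y assume xy: "x \<in> {x \<in> carr A. \<exists>N. \<forall>n\<ge>N. pw n x = 0}" "y \<in> {x \<in> carr A. \<exists>N. \<forall>n\<ge>N. pw n x = 0}"
      then obtain N M where "\<And>n. n \<ge> N \<Longrightarrow> pw n x = 0" "\<And>n. n \<ge> M \<Longrightarrow> pw n y = 0" by blast
      then have "pw n (x + y) = 0" if "n \<ge> max N M" for n
        using linear_onD(2)[OF Lin_pw, of x y n] xy that by simp
      then show "x + y \<in> {x \<in> carr A. \<exists>N. \<forall>n\<ge>N. pw n x = 0}"
        using vs.subspace_add[OF carr_subspace] xy by blast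
    next
      fix c x assume x: "x \<in> {x \<in> carr A. \<exists>N. \<forall>n\<ge>N. pw n x = 0}"
      then obtain N where "\<And>n. n \<ge> N \<Longrightarrow> pw n x = 0" by blast
      then have "pw n (scl A c x) = 0" if "n \<ge> N" for n
        using linear_onD(3)[OF Lin_pw, of x n] x that by simp
      then show "scl A c x \<in> {x \<in> carr A. \<exists>N. \<forall>n\<ge>N. pw n x = 0}"
        using vs.subspace_scale[OF carr_subspace] x by blast
    qed
  qed
  then show ?thesis using assms that by blast
qed

text \<open>The finitely many elements in each identity share a bound \<open>N\<close>, and beyond
  it \<open>S\<close> agrees on them with the morphism \<open>psum N\<close>.\<close>

lemma yd_hom_S: "yd_hom A A S"
proof -
  have "S x \<in> carr A" if "x \<in> carr A" for x
    using eventually_psum[OF that] S_psum linear_onD(1)[OF Lin_psum that] by metis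
  moreover have "S x \<in> hpart A g" if "x \<in> hpart A g" for x g
    using eventually_psum[OF hcarr[OF that]] S_psum hmapD(2)[OF yd_hom_hmap[OF yd_hom_psum] that] by metis
  moreover have "S (x + y) = S x + S y" if xy: "x \<in> carr A" "y \<in> carr A" for x y
  proof -
    obtain N where N: "\<And>n. n \<ge> N \<Longrightarrow> pw n x = 0" by (rule eventually_psum[OF xy(1)]) blast
    obtain M where M: "\<And>n. n \<ge> M \<Longrightarrow> pw n y = 0" by (rule eventually_psum[OF xy(2)]) blast
    have "pw n (x + y) = 0" if "n \<ge> max N M" for n
      using linear_onD(2)[OF Lin_pw xy, of n] N M that by simp
    then show ?thesis
      using S_psum[of "max N M" x] S_psum[of "max N M" y] S_psum[of "max N M" "x + y"] N M linear_onD(2)[OF Lin_psum xy]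
      by simp
  qed
  moreover have "S (scl A c x) = scl A c (S x)" if x: "x \<in> carr A" for c x
  proof -
    obtain N where N: "\<And>n. n \<ge> N \<Longrightarrow> pw n x = 0" by (rule eventually_psum[OF x]) blast
    then have "pw n (scl A c x) = 0" if "n \<ge> N" for n
      using linear_onD(3)[OF Lin_pw x, of n] that by simp
    then show ?thesis using S_psum[of N x] S_psum[of N "scl A c x"] N linear_onD(3)[OF Lin_psum x] by simp
  qed
  moreover have "S (act A e x) = act A e (S x)" if x: "x \<in> carr A" for e x
  proof -
    obtain N where N: "\<And>n. n \<ge> N \<Longrightarrow> pw n x = 0" by (rule eventually_psum[OF x]) blast
    have "pw n (act A e x) = act A e (pw n x)" for n
      using yd_hom_pw x by (simp add: yd_hom_def)
    then have "pw n (act A e x) = 0" if "n \<ge> N" for n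
      using linear_on_0[OF Lin_act vs.subspace_0[OF carr_subspace]] N that by simp
    moreover have "psum N (act A e x) = act A e (psum N x)"
      using yd_hom_psum x by (simp add: yd_hom_def)
    ultimately show ?thesis using S_psum[of N x] S_psum[of N "act A e x"] N by simp
  qed
  ultimately show ?thesis unfolding yd_hom_def linear_on_def by blast
qed

lemmas Lin_S = hmapD(1)[OF yd_hom_hmap[OF yd_hom_S]]

lemma S_gr: "x \<in> gr m \<Longrightarrow> S x \<in> gr m"
  unfolding S_def using pw_gr by (intro vs.subspace_sum[OF gr_subspace]) blast

lemma S_gr_psum: "x \<in> gr p \<Longrightarrow> p \<le> m \<Longrightarrow> S x = psum (Suc m) x"
  using pw_vanish by (intro S_psum) simp

lemma conv_dfct_id:
  assumes x: "x \<in> carr A" and f: "Lin A A f"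
  shows "conv f id x + conv f dfct x = f x" and "conv id f x + conv dfct f x = f x"
proof -
  have eq: "(\<lambda>x. id x + dfct x) = eta" by (simp add: dfct_def fun_eq_iff)
  note id = linear_on_id[of "scl A" "carr A"]
  show "conv f id x + conv f dfct x = f x"
    unfolding conv_add_right[OF id Lin_dfct f x, symmetric] eq by (rule conv_eta_right[OF f x])
  show "conv id f x + conv dfct f x = f x"
    unfolding conv_add_left[OF id Lin_dfct f x, symmetric] eq by (rule conv_eta_left[OF f x])
qed

text \<open>Telescoping: convolution with \<open>id = eta - dfct\<close> turns each power into the
  difference of two consecutive ones.\<close>

lemma conv_psum:
  assumes x: "x \<in> carr A"
  shows "conv (psum N) id x = eta x - pw N x" and "conv id (psum N) x = eta x - pw N x"
proof -
  note id = linear_on_id[of "scl A" "carr A"]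
  have eq: "psum (Suc N) = (\<lambda>x. psum N x + pw N x)" for N by (simp add: psum_def fun_eq_iff)
  have Z: "Lin A A (\<lambda>x. 0)" using vs.subspace_0[OF carr_subspace] by (simp add: linear_on_def)
  have eq0: "psum 0 = (\<lambda>x. 0)" by (simp add: psum_def fun_eq_iff)
  show "conv (psum N) id x = eta x - pw N x"
  proof (induction N)
    case 0
    have 0: "conv (\<lambda>x. 0) id x = 0" using conv_add_left[OF Z Z id x] by (simp only: add_0 add_cancel_right_right)
    show ?case unfolding eq0 0 by simp
  next
    case (Suc N)
    show ?case
      unfolding eq conv_add_left[OF Lin_psum Lin_pw id x] Suc using conv_dfct_id(1)[OF x Lin_pw, of N]
      by (simp add: algebra_simps)
  qed
  show "conv id (psum N) x = eta x - pw N x"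
  proof (induction N)
    case 0
    have 0: "conv id (\<lambda>x. 0) x = 0" using conv_add_right[OF Z Z id x] by (simp only: add_0 add_cancel_right_right)
    show ?case unfolding eq0 0 by simp
  next
    case (Suc N)
    show ?case
      unfolding eq conv_add_right[OF Lin_psum Lin_pw id x] Suc using conv_dfct_id(2)[OF x Lin_pw, of N]
      unfolding pw_Suc'[OF x] by (simp add: algebra_simps)
  qed
qed

text \<open>A convolution evaluated in degree \<open>m\<close> sees its factors only in degrees up
  to \<open>m\<close>. This lets the finite sum \<open>psum (Suc m)\<close> replace
  \<open>S\<close>, although no single \<open>N\<close> works on all of \<open>A\<close>.\<close>

lemma conv_eq_gr:
  assumes "Lin A A f" "Lin A A f'" "Lin A A g" "Lin A A g'" "x \<in> gr m"
    and "\<And>y p. y \<in> gr p \<Longrightarrow> p \<le> m \<Longrightarrow> f y = f' y" "\<And>y p. y \<in> gr p \<Longrightarrow> p \<le> m \<Longrightarrow> g y = g' y"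
  shows "conv f g x = conv f' g' x"
  unfolding conv_def
proof (rule linear_on_eq_on_span[OF vector_space_tensor_scale Lin_mu_tensor_map[OF assms(1,3)]
      Lin_mu_tensor_map[OF assms(2,4)] _ _ _ comul_gr[OF assms(5)]])
  show "tensor.subspace (carr AA)" by simp
  show "{ptens A A y z |y z p q. y \<in> gr p \<and> z \<in> gr q \<and> p + q = m} \<subseteq> carr AA"
    by (intro subsetI, elim CollectE exE conjE, simp only: ptens_carr gr_carr)
  fix T assume "T \<in> {ptens A A y z |y z p q. y \<in> gr p \<and> z \<in> gr q \<and> p + q = m}"
  then obtain y z p q where T: "T = ptens A A y z" and yz: "y \<in> gr p" "z \<in> gr q" "p + q = m" by blast
  note c = gr_carr[OF yz(1)] gr_carr[OF yz(2)]
  have "p \<le> m" "q \<le> m" using yz(3) by auto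
  then show "mu A (tensor_map A A A A f g T) = mu A (tensor_map A A A A f' g' T)"
    unfolding T tensor_map_A[OF assms(1,3) c] tensor_map_A[OF assms(2,4) c] using assms(6,7) yz by simp
qed

lemma antipode_S: "antipode A S"
  unfolding antipode_def
proof (intro conjI ballI yd_hom_S)
  note id = linear_on_id[of "scl A" "carr A"]
  have ext: "f x = eta x" if f: "Lin A A f" and eq: "\<And>m x. x \<in> gr m \<Longrightarrow> f x = eta x" and x: "x \<in> carr A" for f x
    by (rule linear_on_eq_on_span[OF hspD(1)[OF hsp] f Lin_eta carr_subspace _ _ x[unfolded carr_gr]])
      (use eq gr_carr in blast)+
  fix x assume x: "x \<in> carr A"
  have "conv S id y = eta y" "conv id S y = eta y" if y: "y \<in> gr m" for y m
  proof -
    have "conv S id y = conv (psum (Suc m)) id y"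
      by (rule conv_eq_gr[OF Lin_S Lin_psum id id y]) (erule (1) S_gr_psum, rule refl)
    then show "conv S id y = eta y"
      unfolding conv_psum(1)[OF gr_carr[OF y]] using pw_vanish[OF y, of "Suc m"] by (simp del: pw.simps)
    have "conv id S y = conv id (psum (Suc m)) y"
      by (rule conv_eq_gr[OF id id Lin_S Lin_psum y]) (rule refl, erule (1) S_gr_psum)
    then show "conv id S y = eta y"
      unfolding conv_psum(2)[OF gr_carr[OF y]] using pw_vanish[OF y, of "Suc m"] by (simp del: pw.simps)
  qed
  then have "conv S id x = eta x" "conv id S x = eta x"
    using ext[OF Lin_conv[OF Lin_S id] _ x] ext[OF Lin_conv[OF id Lin_S] _ x] by blast+
  then show "mu A (tensor_map A A A A S id (comul A x)) = scl A (counit A x) (unt A)"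
    "mu A (tensor_map A A A A id S (comul A x)) = scl A (counit A x) (unt A)"
    by (simp_all only: conv_def eta_def)
qed

end

section \<open>Projecting the comultiplication\<close>

context yd_alg
begin

lemma yd_subobjectI:
  assumes U: "vs.subspace U" "U \<subseteq> carr A" and span: "U \<subseteq> vs.span (\<Union>g. hpart A g \<inter> U)"
    and act: "\<And>e x. x \<in> U \<Longrightarrow> act A e x \<in> U"
  shows "yd_subobject \<Phi> A U"
proof -
  have sub: "vs.subspace (hpart A g \<inter> U)" for g
    using vs.subspace_inter[OF hpart_subspace U(1)] .
  have eq: "U = vs.span (\<Union>g. hpart A g \<inter> U)"
    by (rule equalityI[OF span vs.span_minimal[OF _ U(1)]]) blast
  have "internal_direct_sum (scl A) U (\<lambda>g. hpart A g \<inter> U)"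
    by (rule internal_direct_sum_sub[OF hspD[OF hsp] _ sub eq]) blast
  moreover have "linear_on (scl A) (scl A) U U (act A e)" for e
    using linear_on_weaken[OF Lin_act U(2) order_refl] act by (simp add: linear_on_def)
  ultimately show ?thesis
    using U(2) module act unfolding yd_subobject_def yd_restrict_def yd_module_def
    by (simp add: subset_iff)
qed

lemma yd_subobjectD:
  assumes "yd_subobject \<Phi> A U"
  shows "vs.subspace U" and "U \<subseteq> carr A" and "U = vs.span (\<Union>g. hpart A g \<inter> U)"
    and "\<And>e x. x \<in> U \<Longrightarrow> act A e x \<in> U"
proof -
  have m: "yd_module \<Phi> (yd_restrict A U)" and "U \<subseteq> carr A"
    using assms by (auto simp: yd_subobject_def)
  then show "U \<subseteq> carr A" by simp
  have "internal_direct_sum (scl A) U (\<lambda>g. hpart A g \<inter> U)"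
    using hspD(2)[OF yd_module_hsp[OF m]] by (simp add: yd_restrict_def)
  note ids = internal_direct_sum_subspace[OF hspD(1)[OF hsp] this]
  show "vs.subspace U" "U = vs.span (\<Union>g. hpart A g \<inter> U)" by (fact ids)+
  show "act A e x \<in> U" if "x \<in> U" for e x
    using m that by (simp add: yd_module_def yd_restrict_def linear_on_def)
qed

text \<open>Reduces a claim about products to homogeneous factors, where the scalars
  \<open>\<Phi>\<close> are available. The map \<open>F\<close> is the identity, the action of a
  group element, or a left multiplication in the applications.\<close>

lemma prd_span_into:
  assumes F: "linear_on (scl A) (scl A) (carr A) D F" and E: "vs.subspace E"
    and U: "yd_subobject \<Phi> A U" and W: "yd_subobject \<Phi> A W"
    and into: "\<And>e f x y. x \<in> U \<Longrightarrow> y \<in> W \<Longrightarrow> x \<in> hpart A e \<Longrightarrow> y \<in> hpart A f \<Longrightarrow> F (prd A x y) \<in> E"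
    and x: "x \<in> U" and y: "y \<in> W"
  shows "F (prd A x y) \<in> E"
proof -
  note U' = yd_subobjectD[OF U] note W' = yd_subobjectD[OF W]
  have yc: "y \<in> carr A" using W'(2) y by blast
  have yW: "y \<in> vs.span (\<Union>g. hpart A g \<inter> W)" using y W'(3) by simp
  have "F (prd A x y) \<in> E" if x: "x \<in> (\<Union>g. hpart A g \<inter> U)" for x
  proof -
    obtain e where x: "x \<in> hpart A e" "x \<in> U" using x by blast
    show ?thesis
    proof (rule linear_on_span_into[OF hspD(1)[OF hsp] hspD(1)[OF hsp] linear_on_comp[OF linear_on_prd(2)[OF hcarr[OF x(1)]] F]
          carr_subspace _ E _ yW])
      show "(\<Union>g. hpart A g \<inter> W) \<subseteq> carr A" using W'(2) by blast
      show "F (prd A x y) \<in> E" if "y \<in> (\<Union>g. hpart A g \<inter> W)" for y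
        using that into[OF x(2) _ x(1)] by blast
    qed
  qed
  moreover have "x \<in> vs.span (\<Union>g. hpart A g \<inter> U)" using x U'(3) by simp
  moreover have "(\<Union>g. hpart A g \<inter> U) \<subseteq> carr A" using U'(2) by blast
  ultimately show ?thesis
    using linear_on_span_into[OF hspD(1)[OF hsp] hspD(1)[OF hsp] linear_on_comp[OF linear_on_prd(1)[OF yc] F]
          carr_subspace _ E] by blast
qed

lemma yd_subobject_prd:
  assumes U: "yd_subobject \<Phi> A U" and W: "yd_subobject \<Phi> A W"
  shows "yd_subobject \<Phi> A (vs.span {prd A x y |x y. x \<in> U \<and> y \<in> W})" (is "yd_subobject \<Phi> A ?X")
proof (rule yd_subobjectI)
  note U' = yd_subobjectD[OF U] note W' = yd_subobjectD[OF W]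
  have gen: "prd A x y \<in> ?X" if "x \<in> U" "y \<in> W" for x y
    by (rule vs.span_base) (use that in blast)
  have sc: "{prd A x y |x y. x \<in> U \<and> y \<in> W} \<subseteq> carr A"
    using prd_carr U'(2) W'(2) by blast
  show X: "?X \<subseteq> carr A" by (rule vs.span_minimal[OF sc carr_subspace])
  show "vs.subspace ?X" by simp
  show "?X \<subseteq> vs.span (\<Union>g. hpart A g \<inter> ?X)"
  proof (rule vs.span_minimal; (rule subsetI)?)
    fix z assume "z \<in> {prd A x y |x y. x \<in> U \<and> y \<in> W}"
    then obtain x y where z: "z = prd A x y" and xy: "x \<in> U" "y \<in> W" by blast
    show "z \<in> vs.span (\<Union>g. hpart A g \<inter> ?X)"
      unfolding z
    proof (rule prd_span_into[OF linear_on_id[of "scl A" "carr A"] _ U W _ xy, unfolded id_apply])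
      fix e f x y assume "x \<in> U" "y \<in> W" "x \<in> hpart A e" "y \<in> hpart A f"
      then have "prd A x y \<in> hpart A (e + f) \<inter> ?X" using gen prd_hpart by blast
      then show "prd A x y \<in> vs.span (\<Union>g. hpart A g \<inter> ?X)" by (intro vs.span_base) blast
    qed simp
  qed simp
  show "act A e z \<in> ?X" if z: "z \<in> ?X" for e z
  proof (rule linear_on_span_into[OF hspD(1)[OF hsp] hspD(1)[OF hsp] Lin_act carr_subspace sc _ _ z])
    fix z assume "z \<in> {prd A x y |x y. x \<in> U \<and> y \<in> W}"
    then obtain x y where z: "z = prd A x y" and xy: "x \<in> U" "y \<in> W" by blast
    show "act A e z \<in> ?X"
      unfolding z
    proof (rule prd_span_into[OF Lin_act _ U W _ xy])
      fix f g x y assume *: "x \<in> U" "y \<in> W" "x \<in> hpart A f" "y \<in> hpart A g"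
      show "act A e (prd A x y) \<in> ?X"
        unfolding act_prd[OF *(3,4)]
        by (rule vs.span_scale[OF gen[OF U'(4)[OF *(1)] W'(4)[OF *(2)]]])
    qed simp
  qed simp
qed

lemma tensor_span_hom:
  assumes "yd_subobject \<Phi> A U" "yd_subobject \<Phi> A W"
  shows "tensor_span (scl A) (scl A) U W = tensor_span (scl A) (scl A) (\<Union>g. hpart A g \<inter> U) (\<Union>g. hpart A g \<inter> W)"
  using tensor_span_span[OF hspD(1)[OF hsp] hspD(1)[OF hsp], of "\<Union>g. hpart A g \<inter> U" "\<Union>g. hpart A g \<inter> W"]
    yd_subobjectD(3)[OF assms(1)] yd_subobjectD(3)[OF assms(2)] by simp

lemma star_span_into:
  assumes "tensor.subspace E" "u \<in> tensor.span S" "v \<in> tensor.span T" "S \<subseteq> carr AA" "T \<subseteq> carr AA"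
    and "\<And>s t. s \<in> S \<Longrightarrow> t \<in> T \<Longrightarrow> star s t \<in> E"
  shows "star u v \<in> E"
proof -
  have sub: "tensor.subspace (carr AA)" by simp
  have v: "v \<in> carr AA" using tensor.span_minimal[OF assms(5) sub] assms(3) by blast
  have "star s v \<in> E" if s: "s \<in> S" for s
    by (rule linear_on_span_into[OF vector_space_tensor_scale vector_space_tensor_scale
        linear_on_star_right[OF subsetD[OF assms(4) s]] sub assms(5,1) _ assms(3)]) (rule assms(6)[OF s])
  then show ?thesis
    by (rule linear_on_span_into[OF vector_space_tensor_scale vector_space_tensor_scale
        linear_on_star_left[OF v] sub assms(4,1) _ assms(2)])
qed

text \<open>By \<open>star_ptens\<close>, the product of homogeneous pure tensors is a scalar times
  \<open>a (f \<triangleright> c) \<otimes> b d\<close>. Since \<open>W\<close> is stable under the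
  action, \<open>f \<triangleright> c\<close> is again an element of \<open>W\<close>, so
  containment in a subspace can be tested on the plain products
  \<open>a c \<otimes> b d\<close>.\<close>

lemma star_tensor_span_into:
  assumes "yd_subobject \<Phi> A U" "yd_subobject \<Phi> A U'" "yd_subobject \<Phi> A W" "yd_subobject \<Phi> A W'"
    and E: "tensor.subspace E"
    and into: "\<And>a b c d. a \<in> U \<Longrightarrow> b \<in> U' \<Longrightarrow> c \<in> W \<Longrightarrow> d \<in> W' \<Longrightarrow> ptens A A (prd A a c) (prd A b d) \<in> E"
    and u: "u \<in> tensor_span (scl A) (scl A) U U'" and v: "v \<in> tensor_span (scl A) (scl A) W W'"
  shows "star u v \<in> E"
proof (rule star_span_into[OF E u[unfolded tensor_span_hom[OF assms(1,2)]] v[unfolded tensor_span_hom[OF assms(3,4)]]])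
  show "{ptens A A x y |x y. x \<in> (\<Union>g. hpart A g \<inter> U) \<and> y \<in> (\<Union>g. hpart A g \<inter> U')} \<subseteq> carr AA"
    by (rule subsetI, elim CollectE exE conjE UN_E IntE, simp only: ptens_carr hcarr)
  show "{ptens A A x y |x y. x \<in> (\<Union>g. hpart A g \<inter> W) \<and> y \<in> (\<Union>g. hpart A g \<inter> W')} \<subseteq> carr AA"
    by (rule subsetI, elim CollectE exE conjE UN_E IntE, simp only: ptens_carr hcarr)
  fix s t
  assume "s \<in> {ptens A A x y |x y. x \<in> (\<Union>g. hpart A g \<inter> U) \<and> y \<in> (\<Union>g. hpart A g \<inter> U')}"
    "t \<in> {ptens A A x y |x y. x \<in> (\<Union>g. hpart A g \<inter> W) \<and> y \<in> (\<Union>g. hpart A g \<inter> W')}"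
  then obtain a b c d e f g h where st: "s = ptens A A a b" "t = ptens A A c d"
    and *: "a \<in> hpart A e" "b \<in> hpart A f" "c \<in> hpart A g" "d \<in> hpart A h"
    and **: "a \<in> U" "b \<in> U'" "c \<in> W" "d \<in> W'" by blast
  show "star s t \<in> E"
    unfolding st star_ptens[OF *]
    by (rule tensor.subspace_scale[OF E into[OF **(1,2) yd_subobjectD(4)[OF assms(3) **(3)] **(4)]])
qed

end

section \<open>The coarse grading by \<open>\<delta>\<close> and the ideal \<open>N\<close>\<close>

locale face_grading = yd_bialg \<Phi> P
  for \<Phi> :: "'g::ab_group_add \<Rightarrow> 'g \<Rightarrow> 'g \<Rightarrow> 'k::field"
    and P :: "('g, 'k, 'v::ab_group_add) hopf" +
  fixes gr :: "'m::comm_monoid_add \<Rightarrow> 'v set" and \<delta> :: "'m \<Rightarrow> int"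
  assumes cocycle: "normalized_3cocycle \<Phi>"
    and gr: "internal_direct_sum (scl P) (carr P) gr"
    and gr_sub: "\<And>m. yd_subobject \<Phi> P (gr m)"
    and unt_gr: "unt P \<in> gr 0"
    and prd_gr: "\<And>m n x y. x \<in> gr m \<Longrightarrow> y \<in> gr n \<Longrightarrow> prd P x y \<in> gr (m + n)"
    and comul_gr: "\<And>m x. x \<in> gr m \<Longrightarrow> comul P x \<in>
      module.span tensor_scale {ptens P P y z |y z p q. y \<in> gr p \<and> z \<in> gr q \<and> p + q = m}"
    and counit_gr: "\<And>m x. m \<noteq> 0 \<Longrightarrow> x \<in> gr m \<Longrightarrow> counit P x = 0"
    and \<delta>_add: "\<And>m n. \<delta> (m + n) = \<delta> m + \<delta> n"
begin

lemmas gr_subspace = internal_direct_sum_subspace(1)[OF hspD(1)[OF hsp] gr]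
lemmas gr_carr = subsetD[OF internal_direct_sum_subspace(3)[OF hspD(1)[OF hsp] gr]]
lemmas carr_gr = internal_direct_sum_subspace(4)[OF hspD(1)[OF hsp] gr]

lemma \<delta>_0: "\<delta> 0 = 0" using \<delta>_add[of 0 0] by simp

definition q :: "'v \<Rightarrow> 'v"
  where "q = (SOME h. Vector_Spaces.linear (scl P) (scl P) h \<and> (\<forall>m. \<forall>x\<in>gr m. h x = (if \<delta> m = 0 then x else 0)))"

lemma q_linear: "Vector_Spaces.linear (scl P) (scl P) q"
  and q_gr: "\<And>m x. x \<in> gr m \<Longrightarrow> q x = (if \<delta> m = 0 then x else 0)"
proof -
  obtain h where "Vector_Spaces.linear (scl P) (scl P) h" "\<And>m x. x \<in> gr m \<Longrightarrow> h x = (if \<delta> m = 0 then x else 0)"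
    by (rule internal_direct_sum_proj[OF hspD(1)[OF hsp] gr, of "\<lambda>m. \<delta> m = 0"]) blast
  then have "\<exists>h. Vector_Spaces.linear (scl P) (scl P) h \<and> (\<forall>m. \<forall>x\<in>gr m. h x = (if \<delta> m = 0 then x else 0))" by blast
  from someI_ex[OF this, folded q_def]
  show "Vector_Spaces.linear (scl P) (scl P) q" "\<And>m x. x \<in> gr m \<Longrightarrow> q x = (if \<delta> m = 0 then x else 0)" by blast+
qed

lemma q_into_gr: "x \<in> gr m \<Longrightarrow> q x \<in> gr m"
  using q_gr vs.subspace_0[OF gr_subspace] by simp

lemma Lin_q: "Lin P P q"
proof -
  have "q x \<in> carr P" if "x \<in> carr P" for x
    by (rule linear_on_span_into[OF hspD(1)[OF hsp] hspD(1)[OF hsp] linear_imp_linear_on[OF q_linear]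
          carr_subspace _ carr_subspace _ that[unfolded carr_gr]])
      (use gr_carr q_into_gr in blast)+
  then show ?thesis using linear_imp_linear_on[OF q_linear] by (simp add: linear_on_def)
qed

text \<open>Each \<open>gr m\<close> is a subobject, so vectors homogeneous for both gradings span
  \<open>P\<close>; \<open>internal_direct_sum_refine\<close> then sorts them by
  \<open>G\<close>-degree. This compatibility makes the projection \<open>q\<close> preserve
  \<open>G\<close>-degrees.\<close>

lemma hpart_span_gr: "hpart P g \<subseteq> vs.span (\<Union>m. gr m \<inter> hpart P g)"
proof
  fix x assume x: "x \<in> hpart P g"
  let ?U = "\<lambda>g. vs.span (\<Union>m. gr m \<inter> hpart P g)"
  have "gr m \<subseteq> vs.span (\<Union>g. ?U g)" for m
  proof -
    have "gr m = vs.span (\<Union>g. hpart P g \<inter> gr m)" by (rule yd_subobjectD(3)[OF gr_sub])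
    also have "\<dots> \<subseteq> vs.span (\<Union>g. ?U g)"
    proof (rule vs.span_mono, rule UN_mono[OF order_refl])
      fix g
      have "hpart P g \<inter> gr m \<subseteq> (\<Union>m. gr m \<inter> hpart P g)" by blast
      then show "hpart P g \<inter> gr m \<subseteq> ?U g" using vs.span_superset by (rule order_trans)
    qed
    finally show ?thesis .
  qed
  then have "carr P \<subseteq> vs.span (\<Union>g. ?U g)"
    unfolding carr_gr by (intro vs.span_minimal UN_least vs.subspace_span)
  then have xU: "x \<in> vs.span (\<Union>g. ?U g)" using hcarr[OF x] by blast
  show "x \<in> ?U g"
    by (rule internal_direct_sum_refine[OF hspD[OF hsp] _ vs.subspace_span xU x])
      (rule vs.span_minimal[OF _ hpart_subspace], blast)
qed

lemma yd_hom_q: "yd_hom P P q"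
proof -
  have "q x \<in> hpart P g" if x: "x \<in> hpart P g" for x g
    by (rule linear_on_span_into[OF hspD(1)[OF hsp] hspD(1)[OF hsp] linear_imp_linear_on[OF q_linear]
          carr_subspace _ hpart_subspace _ subsetD[OF hpart_span_gr x]])
      (use q_gr vs.subspace_0[OF hpart_subspace] gr_carr in auto)
  moreover have "q (act P e x) = act P e (q x)" if x: "x \<in> carr P" for e x
  proof (rule linear_on_eq_on_span[OF hspD(1)[OF hsp] linear_on_comp[OF Lin_act Lin_q] linear_on_comp[OF Lin_q Lin_act]
        carr_subspace _ _ x[unfolded carr_gr]])
    show "(\<Union>m. gr m) \<subseteq> carr P" using gr_carr by blast
    fix x assume "x \<in> (\<Union>m. gr m)"
    then obtain m where x: "x \<in> gr m" by blast
    show "q (act P e x) = act P e (q x)"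
      unfolding q_gr[OF x] q_gr[OF yd_subobjectD(4)[OF gr_sub x]]
      using linear_on_0[OF Lin_act vs.subspace_0[OF carr_subspace]] by simp
  qed
  ultimately show ?thesis unfolding yd_hom_def using Lin_q by blast
qed

lemmas hmap_q = yd_hom_hmap[OF yd_hom_q]

text \<open>Only the left factor is restricted. In a \<open>star\<close> product the left factors
  are multiplied with each other up to the action, which preserves every \<open>gr m\<close>, so
  left degrees add.\<close>

definition TD :: "'m set \<Rightarrow> ('k, 'v, 'v) tensor set"
  where "TD D = tensor.span {ptens P P y z |y z m. y \<in> gr m \<and> z \<in> carr P \<and> m \<in> D}"

abbreviation N where "N \<equiv> TD {m. \<delta> m > 0}"

lemma TD_subspace: "tensor.subspace (TD D)"
  unfolding TD_def by simp

lemma TD_ptens: "y \<in> gr m \<Longrightarrow> z \<in> carr P \<Longrightarrow> m \<in> D \<Longrightarrow> ptens P P y z \<in> TD D"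
  unfolding TD_def by (rule tensor.span_base, intro CollectI exI conjI, rule refl)

lemma TD_gens: "{ptens P P y z |y z m. y \<in> gr m \<and> z \<in> carr P \<and> m \<in> D} \<subseteq> carr AA"
  by (intro subsetI, elim CollectE exE conjE, simp only: ptens_carr gr_carr)

lemma TD_carr: "TD D \<subseteq> carr AA"
  unfolding TD_def by (rule tensor.span_minimal[OF TD_gens]) simp

lemma TD_mono: "D \<subseteq> D' \<Longrightarrow> TD D \<subseteq> TD D'"
  unfolding TD_def by (rule tensor.span_mono) blast

lemma yd_subobject_carr: "yd_subobject \<Phi> P (carr P)"
proof (rule yd_subobjectI[OF carr_subspace order_refl _ linear_onD(1)[OF Lin_act]])
  have "hpart P g \<inter> carr P = hpart P g" for g using hcarr by blast
  then show "carr P \<subseteq> vs.span (\<Union>g. hpart P g \<inter> carr P)"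
    using carr_span by simp
qed

lemma star_TD:
  assumes "u \<in> TD D" "v \<in> TD D'" "\<And>m n. m \<in> D \<Longrightarrow> n \<in> D' \<Longrightarrow> m + n \<in> D''"
  shows "star u v \<in> TD D''"
proof (rule star_span_into[OF TD_subspace assms(1,2)[unfolded TD_def] TD_gens TD_gens])
  fix s t
  assume "s \<in> {ptens P P y z |y z m. y \<in> gr m \<and> z \<in> carr P \<and> m \<in> D}"
    "t \<in> {ptens P P y z |y z m. y \<in> gr m \<and> z \<in> carr P \<and> m \<in> D'}"
  then obtain a b c d m n where st: "s = ptens P P a b" "t = ptens P P c d" and *: "a \<in> gr m" "c \<in> gr n"
    "b \<in> carr P" "d \<in> carr P" "m \<in> D" "n \<in> D'" by blast
  show "star s t \<in> TD D''"
  proof (rule star_tensor_span_into[OF gr_sub[of m] yd_subobject_carr gr_sub[of n] yd_subobject_carr TD_subspace])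
    show "s \<in> tensor_span (scl P) (scl P) (gr m) (carr P)" "t \<in> tensor_span (scl P) (scl P) (gr n) (carr P)"
      unfolding st by (rule pure_tensor_in_tensor_span[OF *(1,3)], rule pure_tensor_in_tensor_span[OF *(2,4)])
    fix a b c d assume "a \<in> gr m" "b \<in> carr P" "c \<in> gr n" "d \<in> carr P"
    then show "ptens P P (prd P a c) (prd P b d) \<in> TD D''"
      by (intro TD_ptens[OF prd_gr prd_carr assms(3)[OF *(5,6)]])
  qed
qed

text \<open>Write \<open>U V - u v = (U - u) V + u (V - v)\<close>. Here \<open>V\<close> has left
  weight at least 0 and \<open>u\<close> has left weight 0, so each product with an element of
  \<open>N\<close> stays in \<open>N\<close>.\<close>

lemma star_mod_N:
  assumes u: "u \<in> TD {m. \<delta> m = 0}" and v: "v \<in> TD {m. \<delta> m = 0}" and U: "U - u \<in> N" and V: "V - v \<in> N"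
  shows "star U V - star u v \<in> N"
proof -
  have c: "u \<in> carr AA" "v \<in> carr AA" "U - u \<in> carr AA" "V - v \<in> carr AA"
    using assms TD_carr by blast+
  have VT: "V \<in> TD {m. \<delta> m \<ge> 0}"
  proof -
    have "(V - v) + v \<in> TD {m. \<delta> m \<ge> 0}"
      by (rule tensor.subspace_add[OF TD_subspace subsetD[OF TD_mono V] subsetD[OF TD_mono v]]) auto
    then show ?thesis by simp
  qed
  have "star U V = star ((U - u) + u) V" by simp
  also have "\<dots> = star (U - u) V + star u ((V - v) + v)"
    unfolding linear_onD(2)[OF linear_on_star_left[OF subsetD[OF TD_carr VT]] c(3,1)] by simp
  also have "\<dots> = star (U - u) V + star u (V - v) + star u v"
    unfolding linear_onD(2)[OF linear_on_star_right[OF c(1)] c(4,2)] by (simp add: add.assoc)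
  finally have "star U V - star u v = star (U - u) V + star u (V - v)" by simp
  also have "\<dots> \<in> N"
    by (intro tensor.subspace_add[OF TD_subspace] star_TD[OF U VT] star_TD[OF u V]) (auto simp: \<delta>_add)
  finally show ?thesis .
qed

end

section \<open>The graded algebra generated by \<open>W\<close>\<close>

locale face_subalgebra = face_grading \<Phi> P gr \<delta>
  for \<Phi> :: "'g::ab_group_add \<Rightarrow> 'g \<Rightarrow> 'g \<Rightarrow> 'k::field"
    and P :: "('g, 'k, 'v::ab_group_add) hopf"
    and gr :: "'m::comm_monoid_add \<Rightarrow> 'v set" and \<delta> :: "'m \<Rightarrow> int" +
  fixes \<alpha> :: "nat \<Rightarrow> 'm" and W :: "'v set"
  assumes \<alpha>_0: "\<alpha> 0 = 0" and \<alpha>_add: "\<And>m n. \<alpha> (m + n) = \<alpha> m + \<alpha> n"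
    and inj_\<alpha>: "inj \<alpha>" and \<delta>_\<alpha>: "\<And>n. \<delta> (\<alpha> n) = 0"
    and W_sub: "yd_subobject \<Phi> P W" and W_gr: "W \<subseteq> gr (\<alpha> 1)"
    and W_prim: "\<And>w. w \<in> W \<Longrightarrow> comul P w - (ptens P P w (unt P) + ptens P P (unt P) w) \<in> N"
begin

text \<open>Spans of \<open>n\<close>-fold products of elements of \<open>W\<close>, bracketed to
  the left; they live in degree \<open>\<alpha> n\<close>. They become the grading of
  \<open>A(W)\<close> in which \<open>W\<close> has degree 1.\<close>

primrec B :: "nat \<Rightarrow> 'v set" where
  "B 0 = vs.span {unt P}"
| "B (Suc n) = vs.span {prd P x w |x w. x \<in> B n \<and> w \<in> W}"

lemma B_sub: "yd_subobject \<Phi> P (B n)"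
proof (induction n)
  case 0
  have u: "unt P \<in> hpart P 0 \<inter> vs.span {unt P}" using unt_hpart vs.span_base by simp
  show ?case
    unfolding B.simps
  proof (rule yd_subobjectI)
    show "vs.span {unt P} \<subseteq> carr P" by (rule vs.span_minimal[OF _ carr_subspace]) (simp add: unt_carr)
    have "{unt P} \<subseteq> (\<Union>g. hpart P g \<inter> vs.span {unt P})" using u by blast
    then show "vs.span {unt P} \<subseteq> vs.span (\<Union>g. hpart P g \<inter> vs.span {unt P})" by (rule vs.span_mono)
    show "act P e x \<in> vs.span {unt P}" if "x \<in> vs.span {unt P}" for e x
      by (rule linear_on_span_into[OF hspD(1)[OF hsp] hspD(1)[OF hsp] Lin_act carr_subspace _ _ _ that])
        (use unt_carr in \<open>simp_all add: act_unt vs.span_base\<close>)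
  qed simp
next
  case (Suc n)
  then show ?case unfolding B.simps by (rule yd_subobject_prd[OF _ W_sub])
qed

lemmas B_subD = yd_subobjectD[OF B_sub]

lemma W_carr: "w \<in> W \<Longrightarrow> w \<in> carr P" using yd_subobjectD(2)[OF W_sub] by blast

lemma B_gr: "B n \<subseteq> gr (\<alpha> n)"
proof (induction n)
  case 0
  show ?case unfolding B.simps \<alpha>_0 by (rule vs.span_minimal[OF _ gr_subspace]) (simp add: unt_gr)
next
  case (Suc n)
  have "\<alpha> (Suc n) = \<alpha> n + \<alpha> 1" using \<alpha>_add[of n 1] by simp
  then show ?case
    unfolding B.simps
    by (intro vs.span_minimal gr_subspace subsetI, elim CollectE exE conjE)
      (simp only: prd_gr[OF subsetD[OF Suc] subsetD[OF W_gr]])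
qed

lemma prd_B_Suc: "x \<in> B n \<Longrightarrow> w \<in> W \<Longrightarrow> prd P x w \<in> B (Suc n)"
  unfolding B.simps by (rule vs.span_base) blast

lemma unt_B: "unt P \<in> B 0"
  by (simp add: vs.span_base)

lemma W_B: "B 1 = W"
proof
  show "W \<subseteq> B 1"
  proof
    fix w assume "w \<in> W"
    then show "w \<in> B 1" using prd_B_Suc[OF unt_B] prd_unt(1)[OF W_carr] by simp
  qed
  have "prd P x w \<in> W" if x: "x \<in> B 0" and w: "w \<in> W" for x w
    by (rule linear_on_span_into[OF hspD(1)[OF hsp] hspD(1)[OF hsp] linear_on_prd(1)[OF W_carr[OF w]] carr_subspace
        _ yd_subobjectD(1)[OF W_sub] _ x[unfolded B.simps]])
      (simp_all add: unt_carr prd_unt(1)[OF W_carr[OF w]] w)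
  then show "B 1 \<subseteq> W"
    unfolding One_nat_def B.simps(2) by (intro vs.span_minimal yd_subobjectD(1)[OF W_sub]) blast
qed

text \<open>Induction on the right factor. On homogeneous elements \<open>x (y w)\<close> is
  \<open>(x y) w\<close> times the scalar \<open>\<Phi> e f g\<close>, so rebracketing to the left
  stays inside the span. The scalar has to be moved to the other side of \<open>prd_assoc\<close>,
  which uses that \<open>\<Phi>\<close> does not vanish.\<close>

lemma prd_B:
  assumes x: "x \<in> B m" and y: "y \<in> B n"
  shows "prd P x y \<in> B (m + n)"
  using assms
proof (induction n arbitrary: x y)
  case 0
  have "prd P x y \<in> B m"
    by (rule linear_on_span_into[OF hspD(1)[OF hsp] hspD(1)[OF hsp] linear_on_prd(2)[OF subsetD[OF B_subD(2) 0(1)]]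
        carr_subspace _ B_subD(1) _ 0(2)[unfolded B.simps]])
      (simp_all add: unt_carr prd_unt(2)[OF subsetD[OF B_subD(2) 0(1)]] 0)
  then show ?case by simp
next
  case (Suc n)
  have yc: "y \<in> carr P" using B_subD(2) Suc.prems(2) by blast
  have *: "prd P x y \<in> B (m + Suc n)" if x: "x \<in> (\<Union>g. hpart P g \<inter> B m)" for x
  proof -
    obtain e where xe: "x \<in> hpart P e" "x \<in> B m" using x by blast
    note Lx = linear_on_prd(2)[OF hcarr[OF xe(1)]]
    show ?thesis
    proof (rule linear_on_span_into[OF hspD(1)[OF hsp] hspD(1)[OF hsp] Lx carr_subspace _ B_subD(1) _
          Suc.prems(2)[unfolded B.simps]])
      show "{prd P x w |x w. x \<in> B n \<and> w \<in> W} \<subseteq> carr P"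
        using prd_carr B_subD(2) W_carr by blast
      fix z assume "z \<in> {prd P x w |x w. x \<in> B n \<and> w \<in> W}"
      then obtain y w where z: "z = prd P y w" and yw: "y \<in> B n" "w \<in> W" by blast
      show "prd P x z \<in> B (m + Suc n)"
        unfolding z
      proof (rule prd_span_into[OF Lx B_subD(1) B_sub W_sub _ yw])
        fix f g y w assume yw: "y \<in> B n" "w \<in> W" "y \<in> hpart P f" "w \<in> hpart P g"
        have "\<Phi> e f g \<noteq> 0" using cocycle by (simp add: normalized_3cocycle_def)
        then have "prd P x (prd P y w) = scl P (\<Phi> e f g) (prd P (prd P x y) w)"
          unfolding prd_assoc[OF xe(1) yw(3,4)] by simp
        also have "\<dots> \<in> B (m + Suc n)"
          using vs.subspace_scale[OF B_subD(1) prd_B_Suc[OF Suc.IH[OF xe(2) yw(1)] yw(2)]] by simp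
        finally show "prd P x (prd P y w) \<in> B (m + Suc n)" .
      qed
    qed
  qed
  have xs: "x \<in> vs.span (\<Union>g. hpart P g \<inter> B m)" using Suc.prems(1) B_subD(3) by simp
  have sc: "(\<Union>g. hpart P g \<inter> B m) \<subseteq> carr P" using hcarr by blast
  show ?case
    by (rule linear_on_span_into[OF hspD(1)[OF hsp] hspD(1)[OF hsp] linear_on_prd(1)[OF yc] carr_subspace sc B_subD(1) * xs])
qed

end

lemma left_unitor_sub:
  assumes sub: "sub_hsp V' V" and vs: "vsp V'" "vsp V" and T: "T \<in> carr (yd_tensor \<Phi> yd_unit V')"
  shows "left_unitor V' T = left_unitor V T"
proof (rule linear_on_eq_on_tensor_span[OF Lin_left_unitor[OF vs(1), unfolded yd_tensor_simps yd_unit_simps]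
      linear_on_weaken[OF Lin_left_unitor[OF vs(2), unfolded yd_tensor_simps yd_unit_simps, folded sub_hspD(1)[OF sub]] _ order_refl]
      _ order_refl order_refl T[unfolded yd_tensor_simps yd_unit_simps]])
  show "tensor_span (*) (scl V') UNIV (carr V') \<subseteq> tensor_span (*) (scl V') UNIV (carr V)"
    by (rule tensor_span_mono[OF order_refl sub_hspD(2)[OF sub]])
  fix c x assume x: "x \<in> carr V'"
  show "left_unitor V' (pure_tensor (*) (scl V') c x) = left_unitor V (pure_tensor (*) (scl V') c x)"
    unfolding left_unitor_ptens[OF vs(1) x, unfolded yd_unit_simps]
    unfolding sub_hspD(1)[OF sub] left_unitor_ptens[OF vs(2) subsetD[OF sub_hspD(2)[OF sub] x], unfolded yd_unit_simps] ..
qed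

lemma right_unitor_sub:
  assumes sub: "sub_hsp V' V" and vs: "vsp V'" "vsp V" and T: "T \<in> carr (yd_tensor \<Phi> V' yd_unit)"
  shows "right_unitor V' T = right_unitor V T"
proof (rule linear_on_eq_on_tensor_span[OF Lin_right_unitor[OF vs(1), unfolded yd_tensor_simps yd_unit_simps]
      linear_on_weaken[OF Lin_right_unitor[OF vs(2), unfolded yd_tensor_simps yd_unit_simps, folded sub_hspD(1)[OF sub]] _ order_refl]
      _ order_refl order_refl T[unfolded yd_tensor_simps yd_unit_simps]])
  show "tensor_span (scl V') (*) (carr V') UNIV \<subseteq> tensor_span (scl V') (*) (carr V) UNIV"
    by (rule tensor_span_mono[OF sub_hspD(2)[OF sub] order_refl])
  fix c x assume x: "x \<in> carr V'"
  show "right_unitor V' (pure_tensor (scl V') (*) x c) = right_unitor V (pure_tensor (scl V') (*) x c)"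
    unfolding right_unitor_ptens[OF vs(1) x, unfolded yd_unit_simps]
    unfolding sub_hspD(1)[OF sub] right_unitor_ptens[OF vs(2) subsetD[OF sub_hspD(2)[OF sub] x], unfolded yd_unit_simps] ..
qed

section \<open>The comultiplication of \<open>A(W)\<close> modulo \<open>N\<close>\<close>

context face_subalgebra
begin

definition GA :: "nat \<Rightarrow> ('k, 'v, 'v) tensor set"
  where "GA n = tensor.span {ptens P P x y |x y p r. x \<in> B p \<and> y \<in> B r \<and> p + r = n}"

lemma GA_subspace: "tensor.subspace (GA n)"
  unfolding GA_def by simp

lemma GA_ptens: "x \<in> B p \<Longrightarrow> y \<in> B r \<Longrightarrow> p + r = n \<Longrightarrow> ptens P P x y \<in> GA n"
  unfolding GA_def by (rule tensor.span_base, intro CollectI exI conjI, rule refl)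

lemma B_carr: "x \<in> B n \<Longrightarrow> x \<in> carr P"
  using B_subD(2) by blast

lemma GA_TD: "GA n \<subseteq> TD {m. \<delta> m = 0}"
  unfolding GA_def
proof (rule tensor.span_minimal[OF subsetI TD_subspace])
  fix T assume "T \<in> {ptens P P x y |x y p r. x \<in> B p \<and> y \<in> B r \<and> p + r = n}"
  then obtain x y p r where T: "T = ptens P P x y" and xy: "x \<in> B p" "y \<in> B r" by blast
  show "T \<in> TD {m. \<delta> m = 0}"
    unfolding T by (rule TD_ptens[OF subsetD[OF B_gr xy(1)] B_carr[OF xy(2)]]) (simp add: \<delta>_\<alpha>)
qed

lemma GA_gens: "{ptens P P x y |x y p r. x \<in> B p \<and> y \<in> B r \<and> p + r = n} \<subseteq> carr AA"
  by (intro subsetI, elim CollectE exE conjE, simp only: ptens_carr B_carr)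

lemma star_GA:
  assumes "u \<in> GA m" "v \<in> GA n"
  shows "star u v \<in> GA (m + n)"
proof (rule star_span_into[OF GA_subspace assms[unfolded GA_def] GA_gens GA_gens])
  fix s t
  assume "s \<in> {ptens P P x y |x y p r. x \<in> B p \<and> y \<in> B r \<and> p + r = m}"
    "t \<in> {ptens P P x y |x y p r. x \<in> B p \<and> y \<in> B r \<and> p + r = n}"
  then obtain a b c d p r p' r' where st: "s = ptens P P a b" "t = ptens P P c d"
    and *: "a \<in> B p" "b \<in> B r" "c \<in> B p'" "d \<in> B r'" and eq: "p + r = m" "p' + r' = n" by blast
  show "star s t \<in> GA (m + n)"
  proof (rule star_tensor_span_into[OF B_sub B_sub B_sub B_sub GA_subspace])
    show "s \<in> tensor_span (scl P) (scl P) (B p) (B r)" "t \<in> tensor_span (scl P) (scl P) (B p') (B r')"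
      unfolding st by (rule pure_tensor_in_tensor_span[OF *(1,2)], rule pure_tensor_in_tensor_span[OF *(3,4)])
    fix a b c d assume "a \<in> B p" "b \<in> B r" "c \<in> B p'" "d \<in> B r'"
    then show "ptens P P (prd P a c) (prd P b d) \<in> GA (m + n)"
      by (intro GA_ptens[OF prd_B prd_B]) (use eq in auto)
  qed
qed

text \<open>Existence of a representative in the right degree: peel off the last factor
  \<open>w\<close>, whose representative is \<open>w \<otimes> 1 + 1 \<otimes> w\<close>, and
  multiply by \<open>star_mod_N\<close>. Uniqueness follows later from the projection
  \<open>\<pi>\<close>, which separates \<open>N\<close> from left weight 0.\<close>

lemma comul_B:
  assumes "x \<in> B n"
  shows "\<exists>u\<in>GA n. comul P x - u \<in> N"
  using assms
proof (induction n arbitrary: x)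
  case 0
  then obtain c where x: "x = scl P c (unt P)" unfolding B.simps vs.span_singleton by blast
  have eq: "comul P x = tensor_scale c (ptens P P (unt P) (unt P))"
    unfolding x using linear_onD(3)[OF Lin_comul unt_carr] by (simp add: comul_unt)
  have mem: "tensor_scale c (ptens P P (unt P) (unt P)) \<in> GA 0"
    by (rule tensor.subspace_scale[OF GA_subspace GA_ptens[OF unt_B unt_B]]) simp
  have "T - T \<in> N" for T by (simp only: diff_self tensor.subspace_0[OF TD_subspace])
  then show ?case unfolding eq by (rule bexI[OF _ mem])
next
  case (Suc n)
  let ?S = "{x \<in> carr P. \<exists>u\<in>GA (Suc n). comul P x - u \<in> N}"
  have "B (Suc n) \<subseteq> ?S"
    unfolding B.simps
  proof (rule vs.span_minimal)
    show "{prd P x w |x w. x \<in> B n \<and> w \<in> W} \<subseteq> ?S"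
    proof
      fix z assume "z \<in> {prd P x w |x w. x \<in> B n \<and> w \<in> W}"
      then obtain y w where z: "z = prd P y w" and yw: "y \<in> B n" "w \<in> W" by blast
      note c = B_carr[OF yw(1)] W_carr[OF yw(2)]
      obtain u where u: "u \<in> GA n" "comul P y - u \<in> N" using Suc.IH[OF yw(1)] by blast
      define v where "v = ptens P P w (unt P) + ptens P P (unt P) w"
      have wB: "w \<in> B 1" using W_B yw(2) by simp
      have v: "v \<in> GA 1"
        unfolding v_def by (intro tensor.subspace_add[OF GA_subspace] GA_ptens[OF wB unt_B] GA_ptens[OF unt_B wB]) simp_all
      have wv: "comul P w - v \<in> N"
        using W_prim[OF yw(2)] unfolding v_def .
      have "comul P z - star u v \<in> N"
        unfolding z comul_prd[OF c] by (rule star_mod_N[OF subsetD[OF GA_TD u(1)] subsetD[OF GA_TD v] u(2) wv])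
      moreover have "star u v \<in> GA (Suc n)" using star_GA[OF u(1) v] by simp
      ultimately show "z \<in> ?S" using prd_carr[OF c] z by blast
    qed
    show "vs.subspace ?S"
    proof (rule vs.subspaceI)
      have "comul P 0 = 0" by (rule linear_on_0[OF Lin_comul vs.subspace_0[OF carr_subspace]])
      then show "0 \<in> ?S"
        using tensor.subspace_0[OF GA_subspace] tensor.subspace_0[OF TD_subspace] vs.subspace_0[OF carr_subspace] by force
      fix x y assume xy: "x \<in> ?S" "y \<in> ?S"
      then obtain u v where uv: "u \<in> GA (Suc n)" "comul P x - u \<in> N" "v \<in> GA (Suc n)" "comul P y - v \<in> N" by blast
      have e: "comul P (x + y) - (u + v) = (comul P x - u) + (comul P y - v)"
        using linear_onD(2)[OF Lin_comul, of x y] xy by simp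
      have "comul P (x + y) - (u + v) \<in> N" unfolding e by (rule tensor.subspace_add[OF TD_subspace uv(2,4)])
      then show "x + y \<in> ?S"
        using tensor.subspace_add[OF GA_subspace uv(1,3)] vs.subspace_add[OF carr_subspace] xy by blast
    next
      fix c x assume x: "x \<in> ?S"
      then obtain u where u: "u \<in> GA (Suc n)" "comul P x - u \<in> N" by blast
      have e: "comul P (scl P c x) - tensor_scale c u = tensor_scale c (comul P x - u)"
        using linear_onD(3)[OF Lin_comul, of x c] x by (simp add: tensor.scale_right_diff_distrib)
      have "comul P (scl P c x) - tensor_scale c u \<in> N" unfolding e by (rule tensor.subspace_scale[OF TD_subspace u(2)])
      then show "scl P c x \<in> ?S"
        using tensor.subspace_scale[OF GA_subspace u(1)] vs.subspace_scale[OF carr_subspace] x by blast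
    qed
  qed
  then show ?case using Suc.prems by blast
qed

section \<open>The projected comultiplication\<close>

definition \<pi> :: "('k, 'v, 'v) tensor \<Rightarrow> ('k, 'v, 'v) tensor"
  where "\<pi> = tensor_map P P P P q id"

text \<open>Defined on all of \<open>P\<close>, as a composite of maps preserving grading and
  action, so that both properties are inherited. It takes values in \<open>A \<otimes> A\<close> on
  \<open>A\<close>.\<close>

definition comul' :: "'v \<Rightarrow> ('k, 'v, 'v) tensor"
  where "comul' x = \<pi> (comul P x)"

lemma hmap_\<pi>: "hmap AA AA \<pi>"
  unfolding \<pi>_def by (rule hmap_tensor_map[OF hsp hsp hmap_q hmap_id])

lemma Lin_\<pi>: "linear_on tensor_scale tensor_scale (carr AA) (carr AA) \<pi>"
  using hmapD(1)[OF hmap_\<pi>] by (simp only: yd_tensor_simps(1))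

lemma \<pi>_ptens: "x \<in> carr P \<Longrightarrow> y \<in> carr P \<Longrightarrow> \<pi> (ptens P P x y) = ptens P P (q x) y"
  unfolding \<pi>_def by (simp only: Lin_tensor_map(2)[OF vsp vsp Lin_q linear_on_id[of "scl P" "carr P"]] id_apply)

lemma \<pi>_N: 
  assumes "u \<in> N"
  shows "\<pi> u = 0"
proof -
  have "\<pi> u \<in> {0}"
  proof (rule linear_on_span_into[OF vector_space_tensor_scale vector_space_tensor_scale Lin_\<pi> _ TD_gens
        tensor.subspace_single_0 _ assms[unfolded TD_def]])
    fix T assume "T \<in> {ptens P P y z |y z m. y \<in> gr m \<and> z \<in> carr P \<and> m \<in> {m. \<delta> m > 0}}"
    then obtain y z m where T: "T = ptens P P y z" and *: "y \<in> gr m" "z \<in> carr P" "\<delta> m > 0" by blast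
    show "\<pi> T \<in> {0}" unfolding T \<pi>_ptens[OF gr_carr[OF *(1)] *(2)] q_gr[OF *(1)] using *(3) by simp
  qed simp
  then show ?thesis by simp
qed

lemma \<pi>_fix:
  assumes "u \<in> TD {m. \<delta> m = 0}"
  shows "\<pi> u = u"
proof (rule linear_on_eq_on_span[OF vector_space_tensor_scale Lin_\<pi> linear_on_id[of tensor_scale "carr AA", unfolded id_def] _ TD_gens _
      assms[unfolded TD_def]])
  fix T assume "T \<in> {ptens P P y z |y z m. y \<in> gr m \<and> z \<in> carr P \<and> m \<in> {m. \<delta> m = 0}}"
  then obtain y z m where T: "T = ptens P P y z" and *: "y \<in> gr m" "z \<in> carr P" "\<delta> m = 0" by blast
  show "\<pi> T = T" unfolding T \<pi>_ptens[OF gr_carr[OF *(1)] *(2)] q_gr[OF *(1)] using *(3) by simp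
qed simp

lemma N_carr: "u \<in> N \<Longrightarrow> u \<in> carr AA"
  using TD_carr by blast

text \<open>\<open>\<pi>\<close> kills \<open>N\<close> and fixes tensors of left weight 0. To
  compute \<open>comul'\<close> it therefore suffices to exhibit one representative of this kind;
  degrees, multiplicativity and primitivity of \<open>W\<close> are all obtained in this
  way.\<close>

lemma comul'_unique:
  assumes "x \<in> carr P" "u \<in> TD {m. \<delta> m = 0}" "comul P x - u \<in> N"
  shows "comul' x = u"
proof -
  have "\<pi> ((comul P x - u) + u) = \<pi> (comul P x - u) + \<pi> u"
    using assms(2,3) TD_carr by (intro linear_onD(2)[OF Lin_\<pi>]) blast+
  then show ?thesis unfolding comul'_def using \<pi>_N[OF assms(3)] \<pi>_fix[OF assms(2)] by simp
qed

lemma comul'_B: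
  assumes "x \<in> B n"
  shows "comul' x \<in> GA n" and "comul P x - comul' x \<in> N"
proof -
  obtain u where u: "u \<in> GA n" "comul P x - u \<in> N" using comul_B[OF assms] by blast
  have "comul' x = u" by (rule comul'_unique[OF B_carr[OF assms] subsetD[OF GA_TD u(1)] u(2)])
  then show "comul' x \<in> GA n" "comul P x - comul' x \<in> N" using u by auto
qed

lemma hmap_comul': "hmap P AA comul'"
  using hmap_comp[OF hmap_comul hmap_\<pi>] by (simp add: comp_def comul'_def[abs_def])

lemmas Lin_comul' = hmapD(1)[OF hmap_comul']

lemma comul'_act:
  assumes x: "x \<in> carr P"
  shows "comul' (act P e x) = act AA e (comul' x)"
proof -
  have "yd_hom P P id" by (simp add: yd_hom_def linear_on_id)
  moreover have "comul P (act P e x) = act AA e (comul P x)"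
    using yd_hom_comul x by (simp add: yd_hom_def)
  ultimately show ?thesis
    unfolding comul'_def \<pi>_def
    using tensor_map_act[OF hsp hsp hsp hsp hmap_act hmap_act hmap_act hmap_act yd_hom_q _ comul_carr[OF x], of id e] by simp
qed

definition A :: "'v set" where "A = vs.span (\<Union>n. B n)"

lemma A_subspace: "vs.subspace A" unfolding A_def by simp

lemma B_A: "x \<in> B n \<Longrightarrow> x \<in> A"
  unfolding A_def by (rule vs.span_base) blast

lemma UN_B_carr: "(\<Union>n. B n) \<subseteq> carr P"
  using B_carr by blast

lemma A_carr: "A \<subseteq> carr P"
  unfolding A_def by (rule vs.span_minimal[OF UN_B_carr carr_subspace])

lemma A_carrD: "x \<in> A \<Longrightarrow> x \<in> carr P" using A_carr by blast

lemma A_sub: "yd_subobject \<Phi> P A"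
proof (rule yd_subobjectI[OF A_subspace A_carr])
  have "B n \<subseteq> vs.span (\<Union>g. hpart P g \<inter> A)" for n
  proof -
    have "vs.span (\<Union>g. hpart P g \<inter> B n) \<subseteq> vs.span (\<Union>g. hpart P g \<inter> A)"
      by (rule vs.span_mono) (use B_A in blast)
    then show ?thesis using B_subD(3)[of n] by simp
  qed
  then have "vs.span (\<Union>n. B n) \<subseteq> vs.span (\<Union>g. hpart P g \<inter> A)"
    by (intro vs.span_minimal UN_least vs.subspace_span)
  then show "A \<subseteq> vs.span (\<Union>g. hpart P g \<inter> A)"
    unfolding A_def[symmetric] .
  show "act P e x \<in> A" if x: "x \<in> A" for e x
    by (rule linear_on_span_into[OF hspD(1)[OF hsp] hspD(1)[OF hsp] Lin_act carr_subspace UN_B_carr A_subspace _ x[unfolded A_def]])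
      (use B_A B_subD(4) in blast)
qed

lemma prd_A:
  assumes x: "x \<in> A" and y: "y \<in> A"
  shows "prd P x y \<in> A"
proof -
  have "prd P x y \<in> A" if x: "x \<in> (\<Union>n. B n)" for x
  proof -
    obtain n where x: "x \<in> B n" using x by blast
    show ?thesis
      by (rule linear_on_span_into[OF hspD(1)[OF hsp] hspD(1)[OF hsp] linear_on_prd(2)[OF B_carr[OF x]] carr_subspace
            UN_B_carr A_subspace _ y[unfolded A_def]])
        (use B_A prd_B[OF x] in blast)
  qed
  then show ?thesis
    by (rule linear_on_span_into[OF hspD(1)[OF hsp] hspD(1)[OF hsp] linear_on_prd(1)[OF A_carrD[OF y]] carr_subspace
            UN_B_carr A_subspace _ x[unfolded A_def]])
qed

lemma q_A:
  assumes x: "x \<in> A"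
  shows "q x = x"
proof -
  have qB: "q y = y" if y: "y \<in> (\<Union>n. B n)" for y
  proof -
    obtain n where "y \<in> B n" using y by blast
    then show ?thesis using q_gr[OF subsetD[OF B_gr]] \<delta>_\<alpha> by simp
  qed
  show ?thesis
    by (rule linear_on_eq_on_span[OF hspD(1)[OF hsp] Lin_q linear_on_id[of "scl P" "carr P", unfolded id_def] carr_subspace UN_B_carr qB
        x[unfolded A_def]])
qed

abbreviation TA where "TA \<equiv> tensor_span (scl P) (scl P) A A"

lemma GA_TA: "GA n \<subseteq> TA"
  unfolding GA_def
proof (rule tensor.span_minimal[OF subsetI tensor.subspace_span])
  fix T assume "T \<in> {ptens P P x y |x y p r. x \<in> B p \<and> y \<in> B r \<and> p + r = n}"
  then obtain x y p r where T: "T = ptens P P x y" and xy: "x \<in> B p" "y \<in> B r" by blast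
  show "T \<in> TA" unfolding T by (rule pure_tensor_in_tensor_span[OF B_A[OF xy(1)] B_A[OF xy(2)]])
qed

lemma TA_carr: "TA \<subseteq> carr AA"
  unfolding yd_tensor_simps by (rule tensor_span_mono[OF A_carr A_carr])

lemma TA_TD: "TA \<subseteq> TD {m. \<delta> m = 0}"
proof -
  have "TA = tensor_span (scl P) (scl P) (\<Union>n. B n) (\<Union>n. B n)"
    unfolding A_def by (rule tensor_span_span[OF hspD(1)[OF hsp] hspD(1)[OF hsp]])
  also have "\<dots> \<subseteq> TD {m. \<delta> m = 0}"
  proof (rule tensor.span_minimal[OF subsetI TD_subspace])
    fix T assume "T \<in> {ptens P P x y |x y. x \<in> (\<Union>n. B n) \<and> y \<in> (\<Union>n. B n)}"
    then obtain x y p r where T: "T = ptens P P x y" and xy: "x \<in> B p" "y \<in> B r" by blast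
    show "T \<in> TD {m. \<delta> m = 0}"
      unfolding T by (rule TD_ptens[OF subsetD[OF B_gr xy(1)] B_carr[OF xy(2)]]) (simp add: \<delta>_\<alpha>)
  qed
  finally show ?thesis .
qed

lemma comul'_A:
  assumes x: "x \<in> A"
  shows "comul' x \<in> TA" and "comul P x - comul' x \<in> N"
proof -
  show "comul' x \<in> TA"
    by (rule linear_on_span_into[OF hspD(1)[OF hsp] vector_space_tensor_scale Lin_comul'[unfolded yd_tensor_simps(1)] carr_subspace UN_B_carr
          tensor.subspace_span _ x[unfolded A_def]])
      (use comul'_B(1) GA_TA in blast)
  have L: "linear_on (scl P) tensor_scale (carr P) UNIV (\<lambda>x. comul P x - comul' x)"
    using linear_onD[OF Lin_comul] linear_onD[OF Lin_comul']
    by (simp add: linear_on_def tensor.scale_right_diff_distrib)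
  show "comul P x - comul' x \<in> N"
    by (rule linear_on_span_into[OF hspD(1)[OF hsp] vector_space_tensor_scale L carr_subspace UN_B_carr
          TD_subspace _ x[unfolded A_def]])
      (use comul'_B(2) in blast)
qed

end

lemma yd_module_cong:
  assumes "yd_module \<Phi> V" "scl V' = scl V" "carr V' = carr V" "\<And>g. hpart V' g = hpart V g" "act V' = act V"
  shows "yd_module \<Phi> V'"
proof -
  have "hpart V' = hpart V" using assms(4) by (rule ext)
  then show ?thesis using assms(1) unfolding yd_module_def assms(2,3,5) by simp
qed

section \<open>The bialgebra structure on \<open>A(W)\<close>\<close>

context face_subalgebra
begin

definition Pr :: "('g, 'k, 'v) hopf"
  where "Pr = yd_restrict P A\<lparr>comul := comul', counit := counit P\<rparr>"

lemma Pr_simps [simp]: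
  "scl Pr = scl P" "carr Pr = A" "hpart Pr g = hpart P g \<inter> A" "act Pr = act P" "mu Pr = mu P"
  "unt Pr = unt P" "comul Pr = comul'" "counit Pr = counit P"
  by (simp_all add: Pr_def yd_restrict_def)

lemma carr_Pr2: "carr (yd_tensor \<Phi> Pr Pr) = TA"
  by simp

lemma sub_Pr: "sub_hsp Pr P"
  using A_carr by (simp add: sub_hsp_def)

lemma yd_module_Pr: "yd_module \<Phi> Pr"
  using A_sub unfolding yd_subobject_def
  by (elim conjE) (erule yd_module_cong, simp_all add: yd_restrict_def)

lemma unt_A: "unt P \<in> A"
  by (rule B_A[OF unt_B])

lemma yd_alg_Pr: "yd_alg \<Phi> Pr"
proof
  show "yd_module \<Phi> Pr" by (rule yd_module_Pr)
  have "mu P T \<in> A" if T: "T \<in> TA" for T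
    by (rule linear_on_tensor_span_into[OF hspD(1)[OF hsp] Lin_mu[unfolded yd_tensor_simps] A_subspace _ A_carr A_carr T])
      (rule prd_A)
  then show "Lin (yd_tensor \<Phi> Pr Pr) Pr (mu Pr)"
    using linear_onD(2,3)[OF Lin_mu subsetD[OF TA_carr]] subsetD[OF TA_carr]
    by (simp add: linear_on_def)
  show "prd Pr x y \<in> hpart Pr (e + f)" if "x \<in> hpart Pr e" "y \<in> hpart Pr f" for e f x y
    using that prd_hpart prd_A by simp
  show "act Pr e (prd Pr x y) = scl Pr (cocycle_at \<Phi> e f g) (prd Pr (act Pr e x) (act Pr e y))"
    if "x \<in> hpart Pr f" "y \<in> hpart Pr g" for e f g x y
    using that act_prd by simp
  show "unt Pr \<in> hpart Pr 0" using unt_hpart unt_A by simp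
  show "act Pr e (unt Pr) = unt Pr" for e by (simp add: act_unt)
  show "prd Pr (prd Pr x y) z = scl Pr (inverse (\<Phi> e f g)) (prd Pr x (prd Pr y z))"
    if "x \<in> hpart Pr e" "y \<in> hpart Pr f" "z \<in> hpart Pr g" for e f g x y z
    using that prd_assoc by simp
  show "prd Pr (unt Pr) x = x" "prd Pr x (unt Pr) = x" if "x \<in> carr Pr" for x
    using that prd_unt A_carrD by simp_all
qed

text \<open>The product of \<open>Pr \<otimes> Pr\<close> is assembled from maps chosen for
  \<open>Pr\<close>, but \<open>star_ptens\<close> gives the same formula on homogeneous pure
  tensors for \<open>Pr\<close> and for \<open>P\<close>.\<close>

lemma star_Pr:
  assumes u: "u \<in> TA" and v: "v \<in> TA"
  shows "yd_alg.star \<Phi> Pr u v = star u v"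
proof -
  interpret Pr: yd_alg \<Phi> Pr by (rule yd_alg_Pr)
  have TA: "TA \<subseteq> carr AA" by (rule TA_carr)
  have weak: "linear_on tensor_scale tensor_scale (carr Pr.AA) (carr AA) f"
    if "linear_on tensor_scale tensor_scale (carr AA) (carr AA) f" for f
    unfolding carr_Pr2 by (rule linear_on_weaken[OF that TA order_refl])
  note Prc = ptens_carr[where V = Pr and W = Pr and \<Phi> = \<Phi>]
  have *: "Pr.star (ptens Pr Pr a b) v = star (ptens Pr Pr a b) v"
    if ab: "a \<in> hpart Pr e" "b \<in> hpart Pr f" for a b e f
  proof -
    have c: "ptens Pr Pr a b \<in> carr Pr.AA" by (rule Prc[OF Pr.hcarr[OF ab(1)] Pr.hcarr[OF ab(2)]])
    then have c': "ptens Pr Pr a b \<in> carr AA" using TA unfolding carr_Pr2 by blast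
    show ?thesis
    proof (rule tensor_eqI[OF Pr.hsp Pr.hsp Pr.linear_on_star_right[OF c] weak[OF linear_on_star_right[OF c']] _ v[folded carr_Pr2]])
      fix g h x y assume xy: "x \<in> hpart Pr g" "y \<in> hpart Pr h"
      have "a \<in> hpart P e" "b \<in> hpart P f" "x \<in> hpart P g" "y \<in> hpart P h" using ab xy by simp_all
      from star_ptens[OF this] Pr.star_ptens[OF ab xy]
      show "Pr.star (ptens Pr Pr a b) (ptens Pr Pr x y) = star (ptens Pr Pr a b) (ptens Pr Pr x y)" by simp
    qed
  qed
  show ?thesis
    by (rule tensor_eqI[OF Pr.hsp Pr.hsp Pr.linear_on_star_left[OF v[folded carr_Pr2]]
          weak[OF linear_on_star_left[OF subsetD[OF TA v]]] * u[folded carr_Pr2]])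
qed

text \<open>Carries coalgebra identities from \<open>comul P\<close> to \<open>comul'\<close>. The
  map \<open>F\<close> is taken with enough projections \<open>q\<close> or counits built in to
  vanish on \<open>N\<close>; on \<open>A \<otimes> A\<close> these projections are invisible, so
  \<open>G\<close> can omit them.\<close>

lemma comul_transfer:
  fixes F G :: "('k, 'v, 'v) tensor \<Rightarrow> 'x::ab_group_add"
  assumes r: "vector_space r"
    and F: "linear_on tensor_scale r (carr AA) D F" and G: "linear_on tensor_scale r (carr AA) D' G"
    and N: "\<And>y z m. y \<in> gr m \<Longrightarrow> z \<in> carr P \<Longrightarrow> \<delta> m > 0 \<Longrightarrow> F (ptens P P y z) = 0"
    and eq: "\<And>a b. a \<in> A \<Longrightarrow> b \<in> A \<Longrightarrow> F (ptens P P a b) = G (ptens P P a b)"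
    and x: "x \<in> A"
  shows "F (comul P x) = G (comul' x)"
proof -
  interpret r: vector_space r by fact
  note u = comul'_A[OF x]
  have sub: "tensor.subspace (carr AA)" by simp
  have "F (comul P x - comul' x) \<in> {0}"
    by (rule linear_on_span_into[OF vector_space_tensor_scale r F sub TD_gens r.subspace_single_0 _ u(2)[unfolded TD_def]])
      (elim CollectE exE conjE, simp only: N singleton_iff)
  moreover have "F ((comul P x - comul' x) + comul' x) = F (comul P x - comul' x) + F (comul' x)"
    by (rule linear_onD(2)[OF F N_carr[OF u(2)] subsetD[OF TA_carr u(1)]])
  moreover have "F (comul' x) = G (comul' x)"
    by (rule linear_on_eq_on_tensor_span[OF F[unfolded yd_tensor_simps] G[unfolded yd_tensor_simps] eq A_carr A_carr u(1)])
  ultimately show ?thesis by simp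
qed

text \<open>Both sides equal \<open>q \<otimes> (q \<otimes> id)\<close> applied to the
  coassociativity of \<open>P\<close> at \<open>x\<close>. In the left bracketing it turns the inner
  coproduct into \<open>qq\<close> after \<open>comul P\<close>, in the right bracketing into
  \<open>comul'\<close>; \<open>comul_transfer\<close> then replaces the outer coproduct.\<close>

lemma comul'_coassoc:
  assumes x: "x \<in> A"
  shows "associator \<Phi> P P P (tensor_map P P AA P comul' id (comul' x)) = tensor_map P P P AA id comul' (comul' x)"
proof -
  note id = linear_on_id[of "scl P" "carr P"]
  \<comment> \<open>Two projections are needed: on \<open>A\<close>, one would already turn
    \<open>comul P\<close> into \<open>comul'\<close>, but only both together kill the coproduct of
    every element of positive weight, as \<open>comul_transfer\<close> demands.\<close>
  define qq where "qq = tensor_map P P P P q q"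
  have hqq: "hmap AA AA qq" unfolding qq_def by (rule hmap_tensor_map[OF hsp hsp hmap_q hmap_q])
  have qq: "qq (ptens P P y z) = ptens P P (q y) (q z)" if "y \<in> carr P" "z \<in> carr P" for y z
    unfolding qq_def by (rule Lin_tensor_map(2)[OF vsp vsp Lin_q Lin_q that])
  have qq_A: "qq (comul P a) = comul' a" if "a \<in> A" for a
  proof (rule comul_transfer[OF vector_space_tensor_scale hmapD(1)[OF hqq, unfolded yd_tensor_simps(1)]
        linear_on_id[of tensor_scale "carr AA", unfolded id_def] _ _ that])
    show "qq (ptens P P y z) = 0" if "y \<in> gr m" "z \<in> carr P" "\<delta> m > 0" for y z m
      unfolding qq[OF gr_carr[OF that(1)] that(2)] q_gr[OF that(1)] using that(3) by simp
    show "qq (ptens P P a b) = ptens P P a b" if "a \<in> A" "b \<in> A" for a b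
      unfolding qq[OF A_carrD[OF that(1)] A_carrD[OF that(2)]] q_A[OF that(1)] q_A[OF that(2)] ..
  qed
  \<comment> \<open>The weights of the two tensor factors add up to \<open>\<delta> m > 0\<close>,
    so they cannot both be 0, and one of the two projections vanishes.\<close>
  have qq_N: "qq (comul P y) = 0" if y: "y \<in> gr m" and m: "\<delta> m > 0" for y m
  proof -
    have "qq (comul P y) \<in> {0}"
    proof (rule linear_on_span_into[OF vector_space_tensor_scale vector_space_tensor_scale
          hmapD(1)[OF hqq, unfolded yd_tensor_simps(1)] _ _ tensor.subspace_single_0 _ comul_gr[OF y]])
      show "{ptens P P y z |y z p q. y \<in> gr p \<and> z \<in> gr q \<and> p + q = m} \<subseteq> carr AA"
        by (intro subsetI, elim CollectE exE conjE, simp only: ptens_carr gr_carr)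
      fix T assume "T \<in> {ptens P P y z |y z p q. y \<in> gr p \<and> z \<in> gr q \<and> p + q = m}"
      then obtain y z p p' where T: "T = ptens P P y z" and *: "y \<in> gr p" "z \<in> gr p'" "p + p' = m" by blast
      have "\<delta> p \<noteq> 0 \<or> \<delta> p' \<noteq> 0" using m \<delta>_add[of p p'] *(3) by auto
      then show "qq T \<in> {0}"
        unfolding T qq[OF gr_carr[OF *(1)] gr_carr[OF *(2)]] q_gr[OF *(1)] q_gr[OF *(2)] by auto
    qed simp
    then show ?thesis by simp
  qed
  note D = comul_carr[OF A_carrD[OF x]]
  define T0 where "T0 = tensor_map P P AA P (comul P) id (comul P x)"
  have T0: "T0 \<in> carr (yd_tensor \<Phi> AA P)"
    unfolding T0_def by (rule linear_onD(1)[OF Lin_tensor_map(1)[OF vsp vsp Lin_comul id] D])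
  note L1 = Lin_tensor_map[OF vsp vsp linear_on_comp[OF Lin_comul hmapD(1)[OF hqq]] id]
  note L2 = Lin_tensor_map[OF vsp vsp Lin_comul' id]
  note R1 = Lin_tensor_map[OF vsp vsp Lin_q Lin_comul']
  note R2 = Lin_tensor_map[OF vsp vsp id Lin_comul']
  note as = hmapD(1)[OF hmap_associator[OF hsp hsp hsp, of \<Phi>]]
  \<comment> \<open>Naturality of the associator, with \<open>q\<close> on the first two factors and
    the identity on the third.\<close>
  have "tensor_map P AA P AA q \<pi> (associator \<Phi> P P P T0) = associator \<Phi> P P P (tensor_map AA P AA P qq id T0)"
    unfolding \<pi>_def qq_def by (rule associator_natural[OF hsp hsp hsp hsp hsp hsp hmap_q hmap_q hmap_id T0, symmetric])
  also have "tensor_map AA P AA P qq id T0 = tensor_map P P AA P (\<lambda>y. qq (comul P y)) id (comul P x)"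
    unfolding T0_def tensor_map_comp[OF vsp vsp vsp2 vsp Lin_comul id hmapD(1)[OF hqq] id D]
    unfolding id_def ..
  also have "associator \<Phi> P P P \<dots> = associator \<Phi> P P P (tensor_map P P AA P comul' id (comul' x))"
  proof (rule comul_transfer[OF vector_space_tensor_scale linear_on_comp[OF L1(1)[of \<Phi> \<Phi>] as, unfolded yd_tensor_simps(1)]
        linear_on_comp[OF L2(1)[of \<Phi> \<Phi>] as, unfolded yd_tensor_simps(1)] _ _ x])
    show "associator \<Phi> P P P (tensor_map P P AA P (\<lambda>y. qq (comul P y)) id (ptens P P y z)) = 0"
      if "y \<in> gr m" "z \<in> carr P" "\<delta> m > 0" for y z m
      unfolding L1(2)[OF gr_carr[OF that(1)] that(2)] qq_N[OF that(1,3)] pure_tensor_zero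
      by (rule linear_on_0[OF linear_imp_linear_on[OF associator_linear[OF hsp hsp hsp]] UNIV_I])
    show "associator \<Phi> P P P (tensor_map P P AA P (\<lambda>y. qq (comul P y)) id (ptens P P a b)) =
        associator \<Phi> P P P (tensor_map P P AA P comul' id (ptens P P a b))"
      if "a \<in> A" "b \<in> A" for a b
      unfolding L1(2)[OF A_carrD[OF that(1)] A_carrD[OF that(2)]] L2(2)[OF A_carrD[OF that(1)] A_carrD[OF that(2)]]
        qq_A[OF that(1)] ..
  qed
  finally have 1: "tensor_map P AA P AA q \<pi> (associator \<Phi> P P P T0) =
    associator \<Phi> P P P (tensor_map P P AA P comul' id (comul' x))" .
  have "tensor_map P AA P AA q \<pi> (associator \<Phi> P P P T0) =
      tensor_map P AA P AA q \<pi> (tensor_map P P P AA id (comul P) (comul P x))"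
    unfolding T0_def coassoc[OF A_carrD[OF x]] ..
  also have "\<dots> = tensor_map P P P AA q comul' (comul P x)"
    unfolding tensor_map_comp[OF vsp vsp vsp vsp2 id Lin_comul Lin_q hmapD(1)[OF hmap_\<pi>] D]
    unfolding id_apply comul'_def[abs_def] ..
  also have "\<dots> = tensor_map P P P AA id comul' (comul' x)"
  proof (rule comul_transfer[OF vector_space_tensor_scale R1(1)[of \<Phi> \<Phi>, unfolded yd_tensor_simps(1)]
        R2(1)[of \<Phi> \<Phi>, unfolded yd_tensor_simps(1)] _ _ x])
    show "tensor_map P P P AA q comul' (ptens P P y z) = 0" if "y \<in> gr m" "z \<in> carr P" "\<delta> m > 0" for y z m
      unfolding R1(2)[OF gr_carr[OF that(1)] that(2)] q_gr[OF that(1)] using that(3) by simp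
    show "tensor_map P P P AA q comul' (ptens P P a b) = tensor_map P P P AA id comul' (ptens P P a b)"
      if "a \<in> A" "b \<in> A" for a b
      unfolding R1(2)[OF A_carrD[OF that(1)] A_carrD[OF that(2)]] R2(2)[OF A_carrD[OF that(1)] A_carrD[OF that(2)]]
        q_A[OF that(1)] id_apply ..
  qed
  finally show ?thesis unfolding 1 .
qed

lemma counit_gr_pos: "y \<in> gr m \<Longrightarrow> \<delta> m > 0 \<Longrightarrow> counit P y = 0"
  by (rule counit_gr[rotated]) (auto simp: \<delta>_0)

text \<open>The counit acts on the left factor, which has nonzero degree in the generators of
  \<open>N\<close>, so it kills \<open>N\<close> by itself.\<close>

lemma comul'_counit_left:
  assumes x: "x \<in> A"
  shows "left_unitor P (tensor_map P P yd_unit P (counit P) id (comul' x)) = x"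
proof -
  note id = linear_on_id[of "scl P" "carr P"]
  note tm = Lin_tensor_map[OF vsp vsp Lin_counit id]
  have L: "linear_on tensor_scale (scl P) (carr AA) (carr P) (\<lambda>T. left_unitor P (tensor_map P P yd_unit P (counit P) id T))"
    using linear_on_comp[OF tm(1)[of \<Phi> \<Phi>] Lin_left_unitor[OF vsp]] by simp
  have "left_unitor P (tensor_map P P yd_unit P (counit P) id (comul P x)) =
      left_unitor P (tensor_map P P yd_unit P (counit P) id (comul' x))"
  proof (rule comul_transfer[OF hspD(1)[OF hsp] L L _ refl x])
    fix y z m assume *: "y \<in> gr m" "z \<in> carr P" "\<delta> m > 0"
    show "left_unitor P (tensor_map P P yd_unit P (counit P) id (ptens P P y z)) = 0"
      unfolding tm(2)[OF gr_carr[OF *(1)] *(2)] counit_gr_pos[OF *(1,3)] id_apply left_unitor_ptens[OF vsp *(2)] by simp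
  qed
  then show ?thesis unfolding counit_left[OF A_carrD[OF x]] by (rule sym)
qed

text \<open>Here the counit does not see the left factor and \<open>N\<close> need not vanish. The
  elements of \<open>N\<close> are instead sent to positive weights, so \<open>q\<close> is applied
  afterwards; it fixes \<open>x\<close>.\<close>

lemma comul'_counit_right:
  assumes x: "x \<in> A"
  shows "right_unitor P (tensor_map P P P yd_unit id (counit P) (comul' x)) = x"
proof -
  note id = linear_on_id[of "scl P" "carr P"]
  note tm = Lin_tensor_map[OF vsp vsp id Lin_counit]
  have L: "linear_on tensor_scale (scl P) (carr AA) (carr P) (\<lambda>T. right_unitor P (tensor_map P P P yd_unit id (counit P) T))"
    using linear_on_comp[OF tm(1)[of \<Phi> \<Phi>] Lin_right_unitor[OF vsp]] by simp
  have "q (right_unitor P (tensor_map P P P yd_unit id (counit P) (comul P x))) =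
      right_unitor P (tensor_map P P P yd_unit id (counit P) (comul' x))"
  proof (rule comul_transfer[OF hspD(1)[OF hsp] linear_on_comp[OF L Lin_q] L _ _ x])
    fix y z m assume *: "y \<in> gr m" "z \<in> carr P" "\<delta> m > 0"
    note c = gr_carr[OF *(1)]
    show "q (right_unitor P (tensor_map P P P yd_unit id (counit P) (ptens P P y z))) = 0"
      unfolding tm(2)[OF c *(2)] id_apply right_unitor_ptens[OF vsp c] linear_onD(3)[OF Lin_q c] q_gr[OF *(1)]
      using *(3) by simp
  next
    fix a b assume *: "a \<in> A" "b \<in> A"
    note c = A_carrD[OF *(1)] A_carrD[OF *(2)]
    show "q (right_unitor P (tensor_map P P P yd_unit id (counit P) (ptens P P a b))) =
        right_unitor P (tensor_map P P P yd_unit id (counit P) (ptens P P a b))"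
      unfolding tm(2)[OF c] id_apply right_unitor_ptens[OF vsp c(1)] linear_onD(3)[OF Lin_q c(1)] q_A[OF *(1)] ..
  qed
  then show ?thesis unfolding counit_right[OF A_carrD[OF x]] q_A[OF x] by (rule sym)
qed

lemma yd_hom_comul_Pr: "yd_hom Pr (yd_tensor \<Phi> Pr Pr) comul'"
proof -
  interpret Pr: yd_alg \<Phi> Pr by (rule yd_alg_Pr)
  have "Lin Pr Pr.AA comul'"
    using linear_onD(2,3)[OF Lin_comul' A_carrD] A_carrD comul'_A(1) unfolding linear_on_def
    by (simp del: yd_tensor_simps(2) add: carr_Pr2)
  \<comment> \<open>Homogeneity is known in \<open>P \<otimes> P\<close>; since
    \<open>comul' x\<close> lies in the span of the graded parts of \<open>Pr \<otimes> Pr\<close>,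
    it has the same degree there.\<close>
  moreover have "comul' x \<in> hpart Pr.AA g" if x: "x \<in> hpart Pr g" for g x
  proof (rule internal_direct_sum_refine[OF vector_space_tensor_scale hspD(2)[OF hsp2, unfolded yd_tensor_simps(1)]])
    show "hpart Pr.AA m \<subseteq> hpart AA m" for m by (rule sub_hspD(3)[OF sub_hsp_tensor[OF sub_Pr sub_Pr]])
    show "tensor.subspace (hpart Pr.AA m)" for m by simp
    have "comul' x \<in> carr Pr.AA" unfolding carr_Pr2 using x comul'_A(1) by simp
    then show "comul' x \<in> tensor.span (\<Union>m. hpart Pr.AA m)"
      using internal_direct_sum_subspace(4)[OF hspD[OF Pr.hsp2]] by (simp only: yd_tensor_simps(1))
    show "comul' x \<in> hpart AA g" using hmapD(2)[OF hmap_comul'] x by simp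
  qed
  moreover have "comul' (act Pr e x) = act Pr.AA e (comul' x)" if x: "x \<in> carr Pr" for e x
  proof -
    have xA: "x \<in> A" using x by simp
    have "comul' x \<in> carr Pr.AA" unfolding carr_Pr2 by (rule comul'_A(1)[OF xA])
    then have "act Pr.AA e (comul' x) = act AA e (comul' x)"
      by (rule tensor_act_sub[OF sub_Pr sub_Pr Pr.hsp Pr.hsp hsp hsp Pr.hmap_act Pr.hmap_act hmap_act hmap_act Pr_simps(4) Pr_simps(4)])
    then show ?thesis using comul'_act[OF A_carrD[OF xA]] by simp
  qed
  ultimately show ?thesis unfolding yd_hom_def by blast
qed

lemma braided_coalgebra_Pr: "braided_coalgebra \<Phi> Pr"
proof -
  interpret Pr: yd_alg \<Phi> Pr by (rule yd_alg_Pr)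
  note id = linear_on_id[of "scl P" "carr P"] and idPr = linear_on_id[of "scl Pr" "carr Pr"]
  note hm = hmapD(1)[OF yd_hom_hmap[OF yd_hom_comul_Pr]]
  have weak: "linear_on s t (carr P) UNIV f" if "linear_on s t (carr P) D f" for s t f D
    by (rule linear_on_weaken[OF that order_refl subset_UNIV])
  have counit: "yd_hom Pr yd_unit (counit P)"
    using yd_hom_counit A_carrD unfolding yd_hom_def linear_on_def by simp
  note cu = hmapD(1)[OF yd_hom_hmap[OF counit]]
  show ?thesis
    unfolding braided_coalgebra_def
  proof (intro conjI ballI yd_module_Pr)
    show "yd_hom Pr Pr.AA (comul Pr)" using yd_hom_comul_Pr by simp
    show "yd_hom Pr yd_unit (counit Pr)" using counit by simp
    fix x assume "x \<in> carr Pr"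
    then have x: "x \<in> A" by simp
    have u: "comul' x \<in> carr Pr.AA" unfolding carr_Pr2 by (rule comul'_A(1)[OF x])
    have "tensor_map Pr Pr Pr.AA Pr comul' id (comul' x) \<in> carr (yd_tensor \<Phi> Pr.AA Pr)"
      by (rule linear_onD(1)[OF Lin_tensor_map(1)[OF Pr.vsp Pr.vsp hm idPr] u])
    then have a: "associator \<Phi> Pr Pr Pr (tensor_map Pr Pr Pr.AA Pr comul' id (comul' x)) =
        associator \<Phi> P P P (tensor_map Pr Pr Pr.AA Pr comul' id (comul' x))"
      by (rule associator_sub[OF sub_Pr sub_Pr sub_Pr Pr.hsp Pr.hsp Pr.hsp hsp hsp hsp])
    have e1: "tensor_map Pr Pr Pr.AA Pr comul' id (comul' x) = tensor_map P P AA P comul' id (comul' x)"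
      by (rule tensor_map_sub[OF sub_Pr sub_Pr Pr.vsp Pr.vsp vsp vsp _ _ weak[OF Lin_comul'] weak[OF id] u]) simp_all
    have e2: "tensor_map P P P AA id comul' (comul' x) = tensor_map Pr Pr Pr Pr.AA id comul' (comul' x)"
      by (rule tensor_map_sub[OF sub_Pr sub_Pr Pr.vsp Pr.vsp vsp vsp _ _ weak[OF id] weak[OF Lin_comul'] u, symmetric]) simp_all
    show "associator \<Phi> Pr Pr Pr (tensor_map Pr Pr Pr.AA Pr (comul Pr) id (comul Pr x)) =
        tensor_map Pr Pr Pr Pr.AA id (comul Pr) (comul Pr x)"
      unfolding Pr_simps(7) a unfolding e1 comul'_coassoc[OF x] e2 ..
    have "tensor_map Pr Pr yd_unit Pr (counit P) id (comul' x) \<in> carr (yd_tensor \<Phi> yd_unit Pr)"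
      by (rule linear_onD(1)[OF Lin_tensor_map(1)[OF Pr.vsp Pr.vsp cu idPr] u])
    then have aleft: "left_unitor Pr (tensor_map Pr Pr yd_unit Pr (counit P) id (comul' x)) =
        left_unitor P (tensor_map Pr Pr yd_unit Pr (counit P) id (comul' x))"
      by (rule left_unitor_sub[OF sub_Pr Pr.vsp vsp])
    have eleft: "tensor_map Pr Pr yd_unit Pr (counit P) id (comul' x) = tensor_map P P yd_unit P (counit P) id (comul' x)"
      by (rule tensor_map_sub[OF sub_Pr sub_Pr Pr.vsp Pr.vsp vsp vsp _ _ weak[OF Lin_counit] weak[OF id] u]) simp_all
    show "left_unitor Pr (tensor_map Pr Pr yd_unit Pr (counit Pr) id (comul Pr x)) = x"
      unfolding Pr_simps(7,8) aleft unfolding eleft by (rule comul'_counit_left[OF x])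
    have "tensor_map Pr Pr Pr yd_unit id (counit P) (comul' x) \<in> carr (yd_tensor \<Phi> Pr yd_unit)"
      by (rule linear_onD(1)[OF Lin_tensor_map(1)[OF Pr.vsp Pr.vsp idPr cu] u])
    then have aright: "right_unitor Pr (tensor_map Pr Pr Pr yd_unit id (counit P) (comul' x)) =
        right_unitor P (tensor_map Pr Pr Pr yd_unit id (counit P) (comul' x))"
      by (rule right_unitor_sub[OF sub_Pr Pr.vsp vsp])
    have eright: "tensor_map Pr Pr Pr yd_unit id (counit P) (comul' x) = tensor_map P P P yd_unit id (counit P) (comul' x)"
      by (rule tensor_map_sub[OF sub_Pr sub_Pr Pr.vsp Pr.vsp vsp vsp _ _ weak[OF id] weak[OF Lin_counit] u]) simp_all
    show "right_unitor Pr (tensor_map Pr Pr Pr yd_unit id (counit Pr) (comul Pr x)) = x"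
      unfolding Pr_simps(7,8) aright unfolding eright by (rule comul'_counit_right[OF x])
  qed
qed

lemma yd_bialg_Pr: "yd_bialg \<Phi> Pr"
proof -
  interpret Pr: yd_alg \<Phi> Pr by (rule yd_alg_Pr)
  show ?thesis
  proof
    show "braided_coalgebra \<Phi> Pr" by (rule braided_coalgebra_Pr)
    fix x y assume "x \<in> carr Pr" "y \<in> carr Pr"
    then have xy: "x \<in> A" "y \<in> A" by simp_all
    note c = xy[THEN A_carrD]
    note ux = comul'_A[OF xy(1)] and uy = comul'_A[OF xy(2)]
    have "comul' (prd P x y) = star (comul' x) (comul' y)"
    \<comment> \<open>The product of the two projected coproducts is a representative for the
      coproduct of the product, so no multiplicativity of \<open>\<pi>\<close> itself has to be
      proved.\<close>
    proof (rule comul'_unique[OF prd_carr[OF c]])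
      show "star (comul' x) (comul' y) \<in> TD {m. \<delta> m = 0}"
        by (rule star_TD[OF subsetD[OF TA_TD ux(1)] subsetD[OF TA_TD uy(1)]]) (simp add: \<delta>_add)
      show "comul P (prd P x y) - star (comul' x) (comul' y) \<in> N"
        unfolding comul_prd[OF c] by (rule star_mod_N[OF subsetD[OF TA_TD ux(1)] subsetD[OF TA_TD uy(1)] ux(2) uy(2)])
    qed
    then show "comul Pr (prd Pr x y) = Pr.star (comul Pr x) (comul Pr y)"
      using star_Pr[OF ux(1) uy(1)] by simp
    show "counit Pr (prd Pr x y) = counit Pr x * counit Pr y" using counit_prd[OF c] by simp
  next
    have "comul' (unt P) = ptens P P (unt P) (unt P)"
      unfolding comul'_def comul_unt \<pi>_ptens[OF unt_carr unt_carr] q_A[OF unt_A] ..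
    then show "comul Pr (unt Pr) = ptens Pr Pr (unt Pr) (unt Pr)" by simp
    show "counit Pr (unt Pr) = 1" by (simp add: counit_unt)
  qed
qed

section \<open>Grading, connectedness and generation by \<open>W\<close>\<close>

lemma B_0: "B 0 = range (\<lambda>c. scl P c (unt P))"
  unfolding B.simps by (rule vs.span_singleton)

text \<open>\<open>B n\<close> lies in \<open>gr (\<alpha> n)\<close>, and \<open>\<alpha>\<close>
  is injective, so the projection of \<open>P\<close> onto \<open>gr (\<alpha> n)\<close> separates
  \<open>B n\<close> from the other parts.\<close>

lemma internal_direct_sum_B: "internal_direct_sum (scl P) A B"
proof (rule internal_direct_sumI[OF hspD(1)[OF hsp] B_subD(1) A_def])
  fix n
  obtain h where h: "Vector_Spaces.linear (scl P) (scl P) h" "\<And>m x. x \<in> gr m \<Longrightarrow> h x = (if m = \<alpha> n then x else 0)"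
    by (rule internal_direct_sum_proj[OF hspD(1)[OF hsp] gr, of "\<lambda>m. m = \<alpha> n"]) blast
  have "h x = (if k = n then x else 0)" if "x \<in> B k" for k x
    unfolding h(2)[OF subsetD[OF B_gr that]] using inj_\<alpha> by (simp add: inj_eq)
  with h(1) show "\<exists>h. Vector_Spaces.linear (scl P) (scl P) h \<and> (\<forall>k. \<forall>x\<in>B k. h x = (if k = n then x else 0))" by blast
qed

lemma counit_B: "n \<noteq> 0 \<Longrightarrow> x \<in> B n \<Longrightarrow> counit P x = 0"
proof -
  assume n: "n \<noteq> 0" and x: "x \<in> B n"
  have "\<alpha> n \<noteq> \<alpha> 0" using n inj_\<alpha> by (simp add: inj_eq)
  then show ?thesis using counit_gr[OF _ subsetD[OF B_gr x]] \<alpha>_0 by simp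
qed

lemma connected_Pr: "connected_yd_bialg \<Phi> Pr B"
proof -
  interpret Pr: yd_bialg \<Phi> Pr by (rule yd_bialg_Pr)
  show ?thesis
  proof
    show "internal_direct_sum (scl Pr) (carr Pr) B" using internal_direct_sum_B by simp
    show "B 0 = range (\<lambda>c. scl Pr c (unt Pr))" using B_0 by simp
    show "prd Pr x y \<in> B (m + n)" if "x \<in> B m" "y \<in> B n" for m n x y using prd_B[OF that] by simp
    show "comul Pr x \<in> tensor.span {ptens Pr Pr y z |y z p r. y \<in> B p \<and> z \<in> B r \<and> p + r = m}"
      if "x \<in> B m" for m x using comul'_B(1)[OF that] unfolding GA_def Pr_simps .
    show "counit Pr x = 0" if "m \<noteq> 0" "x \<in> B m" for m x using counit_B[OF that] by simp
  qed
qed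

lemma graded_braided_hopf_Pr: "graded_braided_hopf \<Phi> Pr B"
proof -
  interpret Pr: connected_yd_bialg \<Phi> Pr B by (rule connected_Pr)
  have "yd_subobject \<Phi> Pr (B m)" for m
  proof -
    have "yd_module \<Phi> (yd_restrict P (B m))" using B_sub by (simp add: yd_subobject_def)
    then have "yd_module \<Phi> (yd_restrict Pr (B m))"
      by (rule yd_module_cong) (use B_A in \<open>auto simp: yd_restrict_def Pr_def\<close>)
    then show ?thesis using B_A by (auto simp: yd_subobject_def)
  qed
  then show ?thesis
    unfolding graded_braided_hopf_def
    using Pr.braided_bialgebra Pr.gr unt_B prd_B Pr.comul_gr Pr.counit_gr Pr.antipode_S Pr.S_gr by auto
qed

text \<open>Any subalgebra containing \<open>W\<close> contains each \<open>B n\<close> by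
  induction. The argument involves only the product and the unit, which \<open>P\<close> and
  \<open>Pr\<close> share.\<close>

lemma subalgebra_W_A: "subalgebra P hull W = A" and subalgebra_Pr_W: "subalgebra Pr hull W = A"
proof -
  have WA: "W \<subseteq> A" using B_A[of _ 1] W_B by blast
  have min: "A \<subseteq> C" if C: "vs.subspace C" "unt P \<in> C" "\<And>x y. x \<in> C \<Longrightarrow> y \<in> C \<Longrightarrow> prd P x y \<in> C" "W \<subseteq> C" for C
  proof -
    have "B n \<subseteq> C" for n
    proof (induction n)
      case 0
      show ?case unfolding B.simps by (rule vs.span_minimal[OF _ C(1)]) (simp add: C(2))
    next
      case (Suc n)
      then show ?case unfolding B.simps by (intro vs.span_minimal C(1)) (use C(3,4) in blast)
    qed
    then show ?thesis unfolding A_def by (intro vs.span_minimal C(1)) blast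
  qed
  have A: "subalgebra P A" "subalgebra Pr A"
    using A_subspace A_carr unt_A prd_A by (simp_all add: subalgebra_def)
  show "subalgebra P hull W = A"
  proof (rule hull_unique)
    show "W \<subseteq> A" "subalgebra P A" by (fact WA A)+
    show "A \<subseteq> C" if "W \<subseteq> C" "subalgebra P C" for C
      using min[of C] that by (simp add: subalgebra_def)
  qed
  show "subalgebra Pr hull W = A"
  proof (rule hull_unique)
    show "W \<subseteq> A" "subalgebra Pr A" by (fact WA A)+
    show "A \<subseteq> C" if "W \<subseteq> C" "subalgebra Pr C" for C
      using min[of C] that by (simp add: subalgebra_def)
  qed
qed

text \<open>Primitivity modulo \<open>N\<close> becomes exact primitivity:
  \<open>w \<otimes> 1 + 1 \<otimes> w\<close> has left weight 0, so it is the projected coproduct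
  of \<open>w\<close>.\<close>

lemma pre_Nichols_Pr:
  assumes "finite F" "W = vs.span F"
  shows "pre_Nichols \<Phi> Pr W"
proof -
  have "comul' w = ptens P P w (unt P) + ptens P P (unt P) w" if w: "w \<in> W" for w
  proof (rule comul'_unique[OF W_carr[OF w]])
    have wB: "w \<in> B 1" using w W_B by simp
    have "ptens P P w (unt P) + ptens P P (unt P) w \<in> GA 1"
      by (intro tensor.subspace_add[OF GA_subspace] GA_ptens[OF wB unt_B] GA_ptens[OF unt_B wB]) simp_all
    then show "ptens P P w (unt P) + ptens P P (unt P) w \<in> TD {m. \<delta> m = 0}" using GA_TD by blast
    show "comul P w - (ptens P P w (unt P) + ptens P P (unt P) w) \<in> N"
      by (rule W_prim[OF w])
  qed
  then have "\<forall>w\<in>W. primitive Pr w" by (simp add: primitive_def)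
  moreover have "\<exists>gr. graded_braided_hopf \<Phi> Pr gr \<and> gr 0 = range (\<lambda>c. scl Pr c (unt Pr)) \<and> gr (1 :: nat) = W"
    using graded_braided_hopf_Pr B_0 W_B by (intro exI[of _ B]) simp
  moreover have "\<exists>F. finite F \<and> W = module.span (scl Pr) F"
    using assms unfolding Pr_simps by blast
  moreover have "subalgebra Pr hull W = carr Pr" unfolding subalgebra_Pr_W by simp
  ultimately show ?thesis unfolding pre_Nichols_def by (intro conjI)
qed

end

section \<open>Braided commutators\<close>

text \<open>The outer normalizations follow from the middle one by the cocycle identity at
  \<open>(f, 0, f, g)\<close> and at \<open>(f, g, 0, f)\<close>.\<close>

lemma normalized_3cocycle_units:
  assumes "normalized_3cocycle \<Phi>"
  shows "\<Phi> f 0 g = 1" and "\<Phi> 0 f g = 1" and "\<Phi> f g 0 = 1"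
proof -
  have ne: "\<Phi> e f g \<noteq> 0" for e f g using assms by (simp add: normalized_3cocycle_def)
  have co: "\<Phi> (e + f) g h * \<Phi> e f (g + h) = \<Phi> e f g * \<Phi> e (f + g) h * \<Phi> f g h" for e f g h
    using assms unfolding normalized_3cocycle_def by blast
  show 1: "\<Phi> f 0 g = 1" for f g using assms by (simp add: normalized_3cocycle_def)
  show "\<Phi> 0 f g = 1" using co[of f 0 f g] ne by (simp add: 1)
  show "\<Phi> f g 0 = 1" using co[of f g 0 f] ne by (simp add: 1)
qed

text \<open>This symmetry makes the braided commutator equivariant.\<close>

lemma cocycle_at_swap:
  assumes "normalized_3cocycle \<Phi>"
  shows "cocycle_at \<Phi> e g h * cocycle_at \<Phi> h g e = cocycle_at \<Phi> e h g * cocycle_at \<Phi> h e g"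
    and "cocycle_at \<Phi> e g h \<noteq> 0"
proof -
  have ne: "\<Phi> e f g \<noteq> 0" for e f g using assms by (simp add: normalized_3cocycle_def)
  then show "cocycle_at \<Phi> e g h \<noteq> 0" by (simp add: cocycle_at_def)
  show "cocycle_at \<Phi> e g h * cocycle_at \<Phi> h g e = cocycle_at \<Phi> e h g * cocycle_at \<Phi> h e g"
    using ne by (simp add: cocycle_at_def field_simps)
qed

lemma finite_span_subspace:
  assumes "vector_space s" "finite F" "U \<subseteq> module.span s F" "module.subspace s U"
  obtains F' where "finite F'" "U = module.span s F'"
proof -
  interpret vector_space s by fact
  obtain B where B: "B \<subseteq> U" "independent B" "U \<subseteq> span B" "card B = dim U" by (rule basis_exists)
  have "finite B" using independent_span_bound[OF assms(2) B(2)] B(1) assms(3) by blast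
  moreover have "U = span B" using span_minimal[OF B(1) assms(4)] B(3) by blast
  ultimately show ?thesis by (rule that)
qed

section \<open>Braided commutators of subobjects\<close>

context yd_alg
begin

text \<open>\<open>g\<close> is frozen. It is the degree of \<open>X\<close> in a commutator, but
  decoupling the two makes the expression linear in \<open>X\<close> on the whole carrier.\<close>

lemma linear_on_ad:
  shows "Y \<in> carr A \<Longrightarrow> linear_on (scl A) (scl A) (carr A) (carr A) (\<lambda>X. prd A X Y - prd A (act A g Y) X)"
    and "X \<in> carr A \<Longrightarrow> linear_on (scl A) (scl A) (carr A) (carr A) (\<lambda>Y. prd A X Y - prd A (act A g Y) X)"
proof -
  have ac: "act A g Y \<in> carr A" if "Y \<in> carr A" for Y using linear_onD(1)[OF Lin_act that] .
  show "linear_on (scl A) (scl A) (carr A) (carr A) (\<lambda>X. prd A X Y - prd A (act A g Y) X)" if "Y \<in> carr A"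
    unfolding linear_on_def
    by (simp add: that ac prd_carr vs.subspace_diff[OF carr_subspace] prd_add_left prd_add_right
        prd_scale_left prd_scale_right vs.scale_right_diff_distrib)
  show "linear_on (scl A) (scl A) (carr A) (carr A) (\<lambda>Y. prd A X Y - prd A (act A g Y) X)" if "X \<in> carr A"
    unfolding linear_on_def
    by (simp add: that ac prd_carr vs.subspace_diff[OF carr_subspace] prd_add_left prd_add_right
        prd_scale_left prd_scale_right vs.scale_right_diff_distrib linear_onD(2,3)[OF Lin_act])
qed

lemma ad_span_base: "X \<in> U \<Longrightarrow> X \<in> hpart A g \<Longrightarrow> Y \<in> S \<Longrightarrow> prd A X Y - prd A (act A g Y) X \<in> ad_span A U S"
  unfolding ad_span_def by (rule vs.span_base) blast

lemma ad_span_gens_carr: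
  "U \<subseteq> carr A \<Longrightarrow> S \<subseteq> carr A \<Longrightarrow>
    {prd A X Y - prd A (act A g Y) X |X Y g. X \<in> U \<and> X \<in> hpart A g \<and> Y \<in> S} \<subseteq> carr A"
  using linear_onD(1)[OF linear_on_ad(1)] by blast

lemma ad_span_into:
  assumes F: "linear_on (scl A) (scl A) (carr A) D F" and E: "vs.subspace E"
    and U: "U \<subseteq> carr A" and S: "yd_subobject \<Phi> A S"
    and into: "\<And>g h X Y. X \<in> U \<Longrightarrow> X \<in> hpart A g \<Longrightarrow> Y \<in> S \<Longrightarrow> Y \<in> hpart A h \<Longrightarrow>
      F (prd A X Y - prd A (act A g Y) X) \<in> E"
    and x: "x \<in> ad_span A U S"
  shows "F x \<in> E"
proof -
  note S' = yd_subobjectD[OF S]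
  show ?thesis
  proof (rule linear_on_span_into[OF hspD(1)[OF hsp] hspD(1)[OF hsp] F carr_subspace ad_span_gens_carr[OF U S'(2)] E _ x[unfolded ad_span_def]])
    fix z assume "z \<in> {prd A X Y - prd A (act A g Y) X |X Y g. X \<in> U \<and> X \<in> hpart A g \<and> Y \<in> S}"
    then obtain X Y g where z: "z = prd A X Y - prd A (act A g Y) X" and *: "X \<in> U" "X \<in> hpart A g" "Y \<in> S" by blast
    have Y: "Y \<in> vs.span (\<Union>g. hpart A g \<inter> S)" using *(3) S'(3) by simp
    have sc: "(\<Union>g. hpart A g \<inter> S) \<subseteq> carr A" using hcarr by blast
    show "F z \<in> E"
      unfolding z
      by (rule linear_on_span_into[OF hspD(1)[OF hsp] hspD(1)[OF hsp] linear_on_comp[OF linear_on_ad(2)[OF hcarr[OF *(2)]] F]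
            carr_subspace sc E _ Y])
        (use into[OF *(1,2)] in blast)
  qed
qed

text \<open>The first product picks up \<open>cocycle_at \<Phi> e g h\<close>. In the second,
  \<open>e \<triangleright> (g \<triangleright> Y)\<close> has to be rewritten as
  \<open>g \<triangleright> (e \<triangleright> Y)\<close>; both are multiples of
  \<open>(e + g) \<triangleright> Y\<close>, and \<open>cocycle_at_swap\<close> says that the
  resulting scalar is the same one.\<close>

lemma act_ad:
  assumes co: "normalized_3cocycle \<Phi>" and X: "X \<in> hpart A g" and Y: "Y \<in> hpart A h"
  shows "act A e (prd A X Y - prd A (act A g Y) X) =
    scl A (cocycle_at \<Phi> e g h) (prd A (act A e X) (act A e Y) - prd A (act A g (act A e Y)) (act A e X))"
proof -
  note gY = act_hpart[OF Y, of g]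
  note c = hcarr[OF X] hcarr[OF Y] hcarr[OF gY]
  define Z where "Z = act A (e + g) Y"
  have Z: "Z \<in> carr A" unfolding Z_def by (rule hcarr[OF act_hpart[OF Y]])
  note eX = hcarr[OF act_hpart[OF X, of e]]
  have "act A e (prd A X Y - prd A (act A g Y) X + prd A (act A g Y) X) =
      act A e (prd A X Y - prd A (act A g Y) X) + act A e (prd A (act A g Y) X)"
    by (rule linear_onD(2)[OF Lin_act vs.subspace_diff[OF carr_subspace prd_carr[OF c(1,2)] prd_carr[OF c(3,1)]] prd_carr[OF c(3,1)]])
  then have "act A e (prd A X Y - prd A (act A g Y) X) = act A e (prd A X Y) - act A e (prd A (act A g Y) X)"
    by simp
  also have "act A e (prd A (act A g Y) X) = scl A (cocycle_at \<Phi> e h g * cocycle_at \<Phi> h e g) (prd A Z (act A e X))"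
    unfolding act_prd[OF gY X] act_act[OF Y] Z_def[symmetric] prd_scale_left[OF Z eX] by simp
  also have "\<dots> = scl A (cocycle_at \<Phi> e g h) (prd A (act A g (act A e Y)) (act A e X))"
    unfolding act_act[OF Y] add.commute[of g e] Z_def[symmetric] prd_scale_left[OF Z eX]
      cocycle_at_swap(1)[OF co, symmetric] by simp
  finally show ?thesis unfolding act_prd[OF X Y] vs.scale_right_diff_distrib .
qed

lemma yd_subobject_ad_span:
  assumes co: "normalized_3cocycle \<Phi>" and U: "yd_subobject \<Phi> A U" and S: "yd_subobject \<Phi> A S"
  shows "yd_subobject \<Phi> A (ad_span A U S)"
proof (rule yd_subobjectI)
  note U' = yd_subobjectD[OF U] and S' = yd_subobjectD[OF S]
  show sub: "vs.subspace (ad_span A U S)" unfolding ad_span_def by simp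
  show "ad_span A U S \<subseteq> carr A"
    unfolding ad_span_def by (rule vs.span_minimal[OF ad_span_gens_carr[OF U'(2) S'(2)] carr_subspace])
  show "ad_span A U S \<subseteq> vs.span (\<Union>g. hpart A g \<inter> ad_span A U S)"
  proof
    fix x assume x: "x \<in> ad_span A U S"
    have "id x \<in> vs.span (\<Union>g. hpart A g \<inter> ad_span A U S)"
    proof (rule ad_span_into[OF linear_on_id _ U'(2) S _ x])
      fix g h X Y assume *: "X \<in> U" "X \<in> hpart A g" "Y \<in> S" "Y \<in> hpart A h"
      have "prd A X Y - prd A (act A g Y) X \<in> hpart A (g + h)"
        using prd_hpart[OF *(2,4)] prd_hpart[OF act_hpart[OF *(4)] *(2)]
        by (intro vs.subspace_diff[OF hpart_subspace]) (simp_all add: add.commute)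
      then show "id (prd A X Y - prd A (act A g Y) X) \<in> vs.span (\<Union>g. hpart A g \<inter> ad_span A U S)"
        using ad_span_base[OF *(1-3)] by (simp add: vs.span_base) (intro vs.span_base, blast)
    qed simp
    then show "x \<in> vs.span (\<Union>g. hpart A g \<inter> ad_span A U S)" by simp
  qed
  show "act A e x \<in> ad_span A U S" if x: "x \<in> ad_span A U S" for e x
  proof (rule ad_span_into[OF Lin_act sub U'(2) S _ x])
    fix g h X Y assume *: "X \<in> U" "X \<in> hpart A g" "Y \<in> S" "Y \<in> hpart A h"
    show "act A e (prd A X Y - prd A (act A g Y) X) \<in> ad_span A U S"
      unfolding act_ad[OF co *(2,4)]
      by (rule vs.subspace_scale[OF sub ad_span_base[OF U'(4)[OF *(1)] act_hpart[OF *(2)] S'(4)[OF *(3)]]])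
  qed
qed

lemma yd_subobject_sum:
  assumes U: "yd_subobject \<Phi> A U" and S: "yd_subobject \<Phi> A S"
  shows "yd_subobject \<Phi> A (vs.span (U \<union> S))"
proof (rule yd_subobjectI)
  note U' = yd_subobjectD[OF U] and S' = yd_subobjectD[OF S]
  have c: "U \<union> S \<subseteq> carr A" using U'(2) S'(2) by blast
  then show "vs.span (U \<union> S) \<subseteq> carr A" by (rule vs.span_minimal[OF _ carr_subspace])
  have "vs.span (\<Union>g. hpart A g \<inter> T) \<subseteq> vs.span (\<Union>g. hpart A g \<inter> vs.span (U \<union> S))" if "T \<subseteq> U \<union> S" for T
    by (rule vs.span_mono) (use that vs.span_superset[of "U \<union> S"] in blast)
  from this[of U] this[of S] have "U \<union> S \<subseteq> vs.span (\<Union>g. hpart A g \<inter> vs.span (U \<union> S))"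
    using U'(3) S'(3) by simp
  then show "vs.span (U \<union> S) \<subseteq> vs.span (\<Union>g. hpart A g \<inter> vs.span (U \<union> S))"
    by (rule vs.span_minimal) simp
  show "act A e x \<in> vs.span (U \<union> S)" if x: "x \<in> vs.span (U \<union> S)" for e x
    by (rule linear_on_span_into[OF hspD(1)[OF hsp] hspD(1)[OF hsp] Lin_act carr_subspace c _ _ x])
      (use U'(4) S'(4) in \<open>auto intro: vs.span_base\<close>)
qed simp

text \<open>The commutator depends on the degree of \<open>X\<close>, so a finite spanning set is
  chosen in each \<open>U \<inter> hpart A g\<close> separately; finiteness of the group keeps their
  union finite.\<close>

lemma finite_ad_span:
  assumes fin: "finite (UNIV :: 'g set)"
    and U: "vs.subspace U" "finite F" "U \<subseteq> vs.span F" "U \<subseteq> carr A" and S: "finite F'" "S = vs.span F'" "S \<subseteq> carr A"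
  shows "\<exists>E. finite E \<and> ad_span A U S = vs.span E"
proof -
  have "\<exists>B. finite B \<and> U \<inter> hpart A g = vs.span B" for g
    by (rule finite_span_subspace[OF hspD(1)[OF hsp] U(2), of "U \<inter> hpart A g"])
      (use U(3) vs.subspace_inter[OF U(1) hpart_subspace] in blast)+
  then obtain B where B: "\<And>g. finite (B g)" "\<And>g. U \<inter> hpart A g = vs.span (B g)" by metis
  have BU: "X \<in> U" "X \<in> hpart A g" if "X \<in> B g" for X g
    using vs.span_base[OF that] B(2)[of g] by blast+
  have FS: "Y \<in> S" if "Y \<in> F'" for Y using vs.span_base[OF that] S(2) by simp
  define E where "E = (\<Union>g. (\<lambda>(X, Y). prd A X Y - prd A (act A g Y) X) ` (B g \<times> F'))"
  have "finite E" unfolding E_def using fin B(1) S(1) by auto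
  moreover have "ad_span A U S = vs.span E"
  proof
    have "E \<subseteq> ad_span A U S" unfolding E_def using ad_span_base BU FS by auto
    then show "vs.span E \<subseteq> ad_span A U S" by (rule vs.span_minimal) (simp add: ad_span_def)
    show "ad_span A U S \<subseteq> vs.span E"
      unfolding ad_span_def
    proof (rule vs.span_minimal[OF subsetI])
      fix z assume "z \<in> {prd A X Y - prd A (act A g Y) X |X Y g. X \<in> U \<and> X \<in> hpart A g \<and> Y \<in> S}"
      then obtain X Y g where z: "z = prd A X Y - prd A (act A g Y) X" and *: "X \<in> U" "X \<in> hpart A g" "Y \<in> S" by blast
      have Bc: "B g \<subseteq> carr A" and Fc: "F' \<subseteq> carr A" using BU(2) hcarr FS S(3) by blast+
      have X: "X \<in> vs.span (B g)" using * B(2) by blast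
      have base: "prd A X Y - prd A (act A g Y) X \<in> vs.span E" if "X \<in> B g" "Y \<in> F'" for X Y
        by (rule vs.span_base) (use that in \<open>auto simp: E_def\<close>)
      have "prd A X Y - prd A (act A g Y) X \<in> vs.span E" if X: "X \<in> B g" for X
        by (rule linear_on_span_into[OF hspD(1)[OF hsp] hspD(1)[OF hsp] linear_on_ad(2)[OF subsetD[OF Bc X]] carr_subspace Fc
              vs.subspace_span base[OF X] *(3)[unfolded S(2)]])
      then show "z \<in> vs.span E"
        unfolding z
        by (rule linear_on_span_into[OF hspD(1)[OF hsp] hspD(1)[OF hsp] linear_on_ad(1)[OF subsetD[OF S(3) *(3)]] carr_subspace Bc
              vs.subspace_span _ X])
    qed simp
  qed
  ultimately show ?thesis by blast
qed

end

section \<open>Commutators and primitivity modulo \<open>N\<close>\<close>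

context face_grading
begin

definition prim_mod_N :: "'v \<Rightarrow> bool"
  where "prim_mod_N x \<longleftrightarrow> comul P x - (ptens P P x (unt P) + ptens P P (unt P) x) \<in> N"

lemma primitive_prim_mod_N: "primitive P x \<Longrightarrow> prim_mod_N x"
  unfolding primitive_def prim_mod_N_def by (simp only: diff_self tensor.subspace_0[OF TD_subspace])

lemma prim_mod_N_subspace: "vs.subspace {x \<in> carr P. prim_mod_N x}"
proof (rule vs.subspaceI)
  have 0: "comul P 0 = 0" by (rule linear_on_0[OF Lin_comul vs.subspace_0[OF carr_subspace]])
  show "0 \<in> {x \<in> carr P. prim_mod_N x}"
    unfolding mem_Collect_eq prim_mod_N_def 0 pure_tensor_zero add_0 diff_self
    using vs.subspace_0[OF carr_subspace] tensor.subspace_0[OF TD_subspace] by (rule conjI)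
  fix x y assume xy: "x \<in> {x \<in> carr P. prim_mod_N x}" "y \<in> {x \<in> carr P. prim_mod_N x}"
  have e: "comul P (x + y) - (ptens P P (x + y) (unt P) + ptens P P (unt P) (x + y)) =
      (comul P x - (ptens P P x (unt P) + ptens P P (unt P) x)) + (comul P y - (ptens P P y (unt P) + ptens P P (unt P) y))"
    using xy linear_onD(2)[OF Lin_comul, of x y] by (simp add: pure_tensor_bilinear)
  show "x + y \<in> {x \<in> carr P. prim_mod_N x}"
    using xy vs.subspace_add[OF carr_subspace, of x y]
      tensor.subspace_add[OF TD_subspace, of "comul P x - (ptens P P x (unt P) + ptens P P (unt P) x)" _
        "comul P y - (ptens P P y (unt P) + ptens P P (unt P) y)"]
    unfolding mem_Collect_eq prim_mod_N_def e by blast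
next
  fix c x assume x: "x \<in> {x \<in> carr P. prim_mod_N x}"
  have e: "comul P (scl P c x) - (ptens P P (scl P c x) (unt P) + ptens P P (unt P) (scl P c x)) =
      tensor_scale c (comul P x - (ptens P P x (unt P) + ptens P P (unt P) x))"
    using x linear_onD(3)[OF Lin_comul, of x c]
    by (simp add: pure_tensor_bilinear tensor.scale_right_diff_distrib tensor.scale_right_distrib)
  show "scl P c x \<in> {x \<in> carr P. prim_mod_N x}"
    using x vs.subspace_scale[OF carr_subspace, of x c]
      tensor.subspace_scale[OF TD_subspace, of "comul P x - (ptens P P x (unt P) + ptens P P (unt P) x)" _ c]
    unfolding mem_Collect_eq prim_mod_N_def e by blast
qed

lemma act_N:
  assumes "u \<in> N"
  shows "act AA e u \<in> N"
proof -
  have sub: "tensor.subspace (carr AA)" by simp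
  have T: "tensor_span (scl P) (scl P) (gr m) (carr P) = tensor_span (scl P) (scl P) (\<Union>g. hpart P g \<inter> gr m) (\<Union>g. hpart P g \<inter> carr P)" for m
    by (rule tensor_span_hom[OF gr_sub yd_subobject_carr])
  note L = hmapD(1)[OF hmap_tact, unfolded yd_tensor_simps(1)]
  show ?thesis
  proof (rule linear_on_span_into[OF vector_space_tensor_scale vector_space_tensor_scale L sub TD_gens TD_subspace _ assms[unfolded TD_def]])
    fix t assume "t \<in> {ptens P P y z |y z m. y \<in> gr m \<and> z \<in> carr P \<and> m \<in> {m. \<delta> m > 0}}"
    then obtain y z m where t: "t = ptens P P y z" and *: "y \<in> gr m" "z \<in> carr P" "\<delta> m > 0" by blast
    have "t \<in> tensor_span (scl P) (scl P) (\<Union>g. hpart P g \<inter> gr m) (\<Union>g. hpart P g \<inter> carr P)"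
      unfolding T[symmetric] t by (rule pure_tensor_in_tensor_span[OF *(1,2)])
    then show "act AA e t \<in> N"
    proof (rule linear_on_tensor_span_into[OF vector_space_tensor_scale L[unfolded yd_tensor_simps(2)] TD_subspace, rotated 3])
      fix y z assume "y \<in> (\<Union>g. hpart P g \<inter> gr m)" "z \<in> (\<Union>g. hpart P g \<inter> carr P)"
      then obtain f g where yz: "y \<in> hpart P f" "y \<in> gr m" "z \<in> hpart P g" "z \<in> carr P" by blast
      show "act AA e (ptens P P y z) \<in> N"
        unfolding tensor_act[OF yz(1,3)]
        by (rule tensor.subspace_scale[OF TD_subspace TD_ptens[OF yd_subobjectD(4)[OF gr_sub yz(2)] linear_onD(1)[OF Lin_act yz(4)]]])
          (simp add: *(3))
    qed (use hcarr in blast)+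
  qed
qed

text \<open>The action on \<open>x \<otimes> 1\<close> and \<open>1 \<otimes> x\<close> introduces
  no scalar, since a normalized cocycle is 1 as soon as one argument is \<open>0\<close>, and it
  preserves \<open>N\<close>. The statement is needed for \<open>g \<triangleright> Y\<close> in the
  commutator.\<close>

lemma act_prim_mod_N:
  assumes x: "x \<in> hpart P h" and pm: "prim_mod_N x"
  shows "prim_mod_N (act P e x)"
proof -
  note u = normalized_3cocycle_units[OF cocycle]
  note c = hcarr[OF x]
  define v where "v = ptens P P x (unt P) + ptens P P (unt P) x"
  have vc: "v \<in> carr AA" "ptens P P x (unt P) \<in> carr AA" "ptens P P (unt P) x \<in> carr AA"
    unfolding v_def using c unt_carr by (simp_all add: pure_tensor_in_tensor_span tensor.span_add)
  note L = hmapD(1)[OF hmap_tact, unfolded yd_tensor_simps(1)]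
  have "comul P x - v \<in> N" using pm unfolding prim_mod_N_def v_def .
  then have n: "act AA e (comul P x - v) \<in> N" by (rule act_N)
  have "act AA e (comul P x - v + v) = act AA e (comul P x - v) + act AA e v"
    by (rule linear_onD(2)[OF L _ vc(1)]) (use \<open>comul P x - v \<in> N\<close> TD_carr in blast)
  then have 1: "act AA e (comul P x) - act AA e v = act AA e (comul P x - v)" by simp
  have 2: "act AA e v = ptens P P (act P e x) (unt P) + ptens P P (unt P) (act P e x)"
    unfolding v_def linear_onD(2)[OF L vc(2,3)] tensor_act[OF x unt_hpart] tensor_act[OF unt_hpart x] act_unt
    by (simp add: cocycle_at_def u)
  have 3: "comul P (act P e x) = act AA e (comul P x)"
    using yd_hom_comul c by (simp add: yd_hom_def)
  show ?thesis unfolding prim_mod_N_def 3 2[symmetric] 1 by (rule n)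
qed

text \<open>\<open>X \<otimes> 1\<close> lies in \<open>N\<close> because \<open>X\<close> has
  positive weight, while \<open>1 \<otimes> X\<close>, \<open>1 \<otimes> Y\<close> and
  \<open>1 \<otimes> Y'\<close> have left weight 0. So after expansion every mixed product that
  involves \<open>N\<close> stays in \<open>N\<close>, the pure ones give the two primitive terms of
  the commutator, and no degree of \<open>Y\<close> for \<open>gr\<close> enters.\<close>

lemma ad_prim_mod_N:
  assumes X: "X \<in> hpart P g" "X \<in> gr m" "\<delta> m > 0" "primitive P X"
    and Y: "Y \<in> hpart P h" "prim_mod_N Y"
  shows "prim_mod_N (prd P X Y - prd P (act P g Y) X)"
proof -
  note u = normalized_3cocycle_units[OF cocycle]
  define Y' where "Y' = act P g Y"
  have Y': "Y' \<in> hpart P h" "prim_mod_N Y'"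
    unfolding Y'_def by (rule act_hpart[OF Y(1)], rule act_prim_mod_N[OF Y])
  note c = hcarr[OF X(1)] hcarr[OF Y(1)] hcarr[OF Y'(1)]
  define x1 x2 y1 y2 z1 z2 where "x1 = ptens P P X (unt P)" and "x2 = ptens P P (unt P) X"
    and "y1 = ptens P P Y (unt P)" and "y2 = ptens P P (unt P) Y"
    and "z1 = ptens P P Y' (unt P)" and "z2 = ptens P P (unt P) Y'"
  define \<nu> \<nu>' where "\<nu> = comul P Y - (y1 + y2)" and "\<nu>' = comul P Y' - (z1 + z2)"
  have \<nu>: "\<nu> \<in> N" "\<nu>' \<in> N" using Y(2) Y'(2) unfolding \<nu>_def \<nu>'_def prim_mod_N_def y1_def y2_def z1_def z2_def .
  have cX: "comul P X = x1 + x2" using X(4) unfolding primitive_def x1_def x2_def .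
  have cY: "comul P Y = (y1 + y2) + \<nu>" "comul P Y' = (z1 + z2) + \<nu>'" unfolding \<nu>_def \<nu>'_def by simp_all
  have cc: "x1 \<in> carr AA" "x2 \<in> carr AA" "y1 \<in> carr AA" "y2 \<in> carr AA" "z1 \<in> carr AA" "z2 \<in> carr AA"
    unfolding x1_def x2_def y1_def y2_def z1_def z2_def by (intro ptens_carr c unt_carr)+
  have cn: "\<nu> \<in> carr AA" "\<nu>' \<in> carr AA" using \<nu> TD_carr by blast+
  have sub: "tensor.subspace (carr AA)" by simp
  note add = tensor.subspace_add[OF sub]
  have addl: "star (a + b) w = star a w + star b w" if "a \<in> carr AA" "b \<in> carr AA" "w \<in> carr AA" for a b w
    by (rule linear_onD(2)[OF linear_on_star_left[OF that(3)] that(1,2)])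
  have addr: "star w (a + b) = star w a + star w b" if "a \<in> carr AA" "b \<in> carr AA" "w \<in> carr AA" for a b w
    by (rule linear_onD(2)[OF linear_on_star_right[OF that(3)] that(1,2)])
  have x1N: "x1 \<in> N" unfolding x1_def by (rule TD_ptens[OF X(2) unt_carr]) (simp add: X(3))
  have T0: "x2 \<in> TD {m. \<delta> m = 0}" "y2 \<in> TD {m. \<delta> m = 0}" "z2 \<in> TD {m. \<delta> m = 0}"
    unfolding x2_def y2_def z2_def by (intro TD_ptens[OF unt_gr] c; simp add: \<delta>_0)+
  have NN: "star a b \<in> N" if "a \<in> N" "b \<in> N" for a b by (rule star_TD[OF that]) (simp add: \<delta>_add)
  have N0: "star a b \<in> N" if "a \<in> N" "b \<in> TD {m. \<delta> m = 0}" for a b by (rule star_TD[OF that]) (simp add: \<delta>_add)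
  have ON: "star a b \<in> N" if "a \<in> TD {m. \<delta> m = 0}" "b \<in> N" for a b by (rule star_TD[OF that]) (simp add: \<delta>_add)
  \<comment> \<open>In each of these six products two of the four tensor entries are the unit, of
    degree \<open>0\<close>, so all associator scalars are 1.\<close>
  have s1: "star x1 y1 = ptens P P (prd P X Y) (unt P)"
    unfolding x1_def y1_def star_ptens[OF X(1) unt_hpart Y(1) unt_hpart] act_0[OF c(2)] prd_unt(1)[OF unt_carr] by (simp add: u)
  have s2: "star x2 y2 = ptens P P (unt P) (prd P X Y)"
    unfolding x2_def y2_def star_ptens[OF unt_hpart X(1) unt_hpart Y(1)] act_unt prd_unt(1)[OF unt_carr] by (simp add: u)
  have s3: "star x2 y1 = ptens P P Y' X"
    unfolding x2_def y1_def star_ptens[OF unt_hpart X(1) Y(1) unt_hpart] Y'_def[symmetric] prd_unt(1)[OF c(3)] prd_unt(2)[OF c(1)]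
    by (simp add: u)
  have s4: "star z1 x1 = ptens P P (prd P Y' X) (unt P)"
    unfolding x1_def z1_def star_ptens[OF Y'(1) unt_hpart X(1) unt_hpart] act_0[OF c(1)] prd_unt(1)[OF unt_carr] by (simp add: u)
  have s5: "star z2 x2 = ptens P P (unt P) (prd P Y' X)"
    unfolding x2_def z2_def star_ptens[OF unt_hpart Y'(1) unt_hpart X(1)] act_unt prd_unt(1)[OF unt_carr] by (simp add: u)
  have s6: "star z1 x2 = ptens P P Y' X"
    unfolding z1_def x2_def star_ptens[OF Y'(1) unt_hpart unt_hpart X(1)] act_unt prd_unt(1)[OF c(1)] prd_unt(2)[OF c(3)]
    by (simp add: u)
  have "comul P (prd P X Y) = star (x1 + x2) ((y1 + y2) + \<nu>)"
    unfolding comul_prd[OF c(1,2)] cX cY ..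
  also have "\<dots> = star x1 y1 + star x2 y1 + star x1 y2 + star x2 y2 + star x1 \<nu> + star x2 \<nu>"
    by (simp add: addl addr cc cn add del: yd_tensor_simps)
  finally have e1: "comul P (prd P X Y) = star x1 y1 + star x2 y1 + star x1 y2 + star x2 y2 + star x1 \<nu> + star x2 \<nu>" .
  have "comul P (prd P Y' X) = star ((z1 + z2) + \<nu>') (x1 + x2)"
    unfolding comul_prd[OF c(3,1)] cX cY ..
  also have "\<dots> = star z1 x1 + star z1 x2 + star z2 x1 + star z2 x2 + star \<nu>' x1 + star \<nu>' x2"
    by (simp add: addl addr cc cn add del: yd_tensor_simps)
  \<comment> \<open>The degree of \<open>Y'\<close> is arbitrary, so \<open>star x2 y1\<close> and \<open>star z1 x2\<close> need not lie in \<open>N\<close>, but they are equal.\<close>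
  finally have e2: "comul P (prd P Y' X) = star z1 x1 + star z1 x2 + star z2 x1 + star z2 x2 + star \<nu>' x1 + star \<nu>' x2" .
  note pc = prd_carr[OF c(1,2)] prd_carr[OF c(3,1)]
  have "comul P ((prd P X Y - prd P Y' X) + prd P Y' X) = comul P (prd P X Y - prd P Y' X) + comul P (prd P Y' X)"
    by (rule linear_onD(2)[OF Lin_comul vs.subspace_diff[OF carr_subspace pc] pc(2)])
  then have d: "comul P (prd P X Y - prd P Y' X) = comul P (prd P X Y) - comul P (prd P Y' X)" by simp
  have "comul P (prd P X Y - prd P Y' X) - (ptens P P (prd P X Y - prd P Y' X) (unt P) + ptens P P (unt P) (prd P X Y - prd P Y' X)) =
      (star x1 y2 + star x1 \<nu> + star x2 \<nu>) - (star z2 x1 + star \<nu>' x1 + star \<nu>' x2)"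
    unfolding d e1 e2 s1 s2 s3 s4 s5 s6 pure_tensor_diff by (simp only: algebra_simps)
  also have "\<dots> \<in> N"
    by (intro tensor.subspace_diff[OF TD_subspace] tensor.subspace_add[OF TD_subspace] NN N0 ON \<nu> x1N T0)
  finally show ?thesis unfolding prim_mod_N_def Y'_def[symmetric] .
qed

lemma ad_span_prim_mod_N:
  assumes U: "U \<subseteq> gr m" "\<delta> m > 0" "\<And>X. X \<in> U \<Longrightarrow> primitive P X"
    and S: "yd_subobject \<Phi> P S" "\<And>Y. Y \<in> S \<Longrightarrow> prim_mod_N Y" and x: "x \<in> ad_span P U S"
  shows "prim_mod_N x"
proof -
  have "id x \<in> {x \<in> carr P. prim_mod_N x}"
  proof (rule ad_span_into[OF linear_on_id prim_mod_N_subspace _ S(1) _ x])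
    show "U \<subseteq> carr P" using U(1) gr_carr by blast
    fix g h X Y assume *: "X \<in> U" "X \<in> hpart P g" "Y \<in> S" "Y \<in> hpart P h"
    have "prd P X Y - prd P (act P g Y) X \<in> carr P"
      by (rule linear_onD(1)[OF linear_on_ad(1)[OF hcarr[OF *(4)]] hcarr[OF *(2)]])
    moreover have "prim_mod_N (prd P X Y - prd P (act P g Y) X)"
      by (rule ad_prim_mod_N[OF *(2) subsetD[OF U(1) *(1)] U(2) U(3)[OF *(1)] *(4) S(2)[OF *(3)]])
    ultimately show "id (prd P X Y - prd P (act P g Y) X) \<in> {x \<in> carr P. prim_mod_N x}" by simp
  qed
  then show ?thesis by simp
qed

lemma ad_span_gr:
  assumes "U \<subseteq> gr m" "S \<subseteq> gr n" "yd_subobject \<Phi> P S"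
  shows "ad_span P U S \<subseteq> gr (m + n)"
  unfolding ad_span_def
proof (rule vs.span_minimal[OF subsetI gr_subspace])
  fix z assume "z \<in> {prd P X Y - prd P (act P g Y) X |X Y g. X \<in> U \<and> X \<in> hpart P g \<and> Y \<in> S}"
  then obtain X Y g where z: "z = prd P X Y - prd P (act P g Y) X" and *: "X \<in> U" "Y \<in> S" by blast
  note X = subsetD[OF assms(1) *(1)] and Y = subsetD[OF assms(2) *(2)]
    and gY = subsetD[OF assms(2) yd_subobjectD(4)[OF assms(3) *(2)], of g]
  show "z \<in> gr (m + n)"
    unfolding z using vs.subspace_diff[OF gr_subspace prd_gr[OF X Y]] prd_gr[OF gY X] by (simp add: add.commute)
qed

end

section \<open>The weights for three distinct indices\<close>

lemma sum_unit_vec: "(\<Sum>l\<in>UNIV. int (unit_vec i (l :: 'n::finite))) = 1"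
proof -
  have "(\<Sum>l\<in>UNIV. int (unit_vec i l)) = (\<Sum>l\<in>UNIV. if l = i then 1 else 0)"
    unfolding unit_vec_def by (rule sum.cong) auto
  then show ?thesis by simp
qed

theorem proposition3p11:
  fixes \<Phi> :: "'g::{finite,ab_group_add} \<Rightarrow> 'g \<Rightarrow> 'g \<Rightarrow> 'k::{alg_closed_field,field_char_0}"
    and P :: "('g, 'k, 'v::ab_group_add) hopf"
    and V :: "'v set" and Vs :: "'n::finite \<Rightarrow> 'v set"
    and i j k :: 'n
  assumes "normalized_3cocycle \<Phi>"
    and "card (UNIV :: 'n set) \<ge> 3"
    and "internal_direct_sum (scl P) V Vs"
    and "\<And>l. yd_simple \<Phi> (yd_restrict P (Vs l))"
    and "graded_pre_Nichols \<Phi> P V Vs"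
    and "i \<noteq> j" "j \<noteq> k" "i \<noteq> k"
    and W: "W = {a + b |a b. a \<in> ad_span P (Vs i) (ad_span P (Vs j) (Vs k)) \<and>
                          b \<in> ad_span P (Vs j) (ad_span P (Vs i) (Vs k))}"
    and "W \<noteq> {0}"
  shows "\<exists>\<Delta> \<epsilon>. pre_Nichols \<Phi>
           (yd_restrict P (subalgebra_generated P W)\<lparr>comul := \<Delta>, counit := \<epsilon>\<rparr>) W"
proof -
  note co = assms(1) and simple = assms(4) and ne = assms(6-8)
  have pN: "pre_Nichols \<Phi> P V" using assms(5) by (simp add: graded_pre_Nichols_def)
  obtain gr :: "('n \<Rightarrow> nat) \<Rightarrow> 'v set" where gbh: "graded_braided_hopf \<Phi> P gr"
    and Vs_gr: "\<And>l. Vs l \<subseteq> gr (unit_vec l)"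
    using assms(5) unfolding graded_pre_Nichols_def by blast
  obtain F where F: "finite F" "V = module.span (scl P) F" using pN unfolding pre_Nichols_def by blast
  have prim: "\<And>x. x \<in> V \<Longrightarrow> primitive P x" using pN unfolding pre_Nichols_def by blast
  \<comment> \<open>Total degree minus three times the coefficient at \<open>k\<close>: a closed
    form for the weights 1 away from \<open>k\<close> and \<open>1 - 3 = - 2\<close> at
    \<open>k\<close>.\<close>
  define \<delta> :: "('n \<Rightarrow> nat) \<Rightarrow> int" where "\<delta> m = (\<Sum>l\<in>UNIV. int (m l)) - 3 * int (m k)" for m
  define \<alpha> :: "nat \<Rightarrow> 'n \<Rightarrow> nat" where "\<alpha> n = (\<lambda>l. n * (unit_vec i l + unit_vec j l + unit_vec k l))" for n
  have \<delta>_add: "\<delta> (m + n) = \<delta> m + \<delta> n" for m n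
    by (simp add: \<delta>_def sum.distrib algebra_simps)
  interpret yd_bialg \<Phi> P
    using gbh by (intro braided_bialgebra_imp_yd_bialg) (simp add: graded_braided_hopf_def)
  interpret face_grading \<Phi> P gr \<delta>
    by unfold_locales (use co gbh \<delta>_add in \<open>auto simp: graded_braided_hopf_def\<close>)
  have \<delta>_unit: "\<delta> (unit_vec l) = (if l = k then - 2 else 1)" for l
    unfolding \<delta>_def sum_unit_vec by (simp add: unit_vec_def)
  note idsV = internal_direct_sum_subspace[OF hspD(1)[OF hsp] assms(3)]
  have Vs_sub: "yd_subobject \<Phi> P (Vs l)" for l
  proof -
    have "Vs l \<subseteq> carr P" using Vs_gr gr_carr by blast
    then show ?thesis using simple[of l] by (simp add: yd_simple_def yd_subobject_def)
  qed
  note sub = yd_subobject_ad_span[OF co]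
  have Vs_prim: "primitive P X" if "X \<in> Vs l" for X l using prim idsV(3) that by blast
  have pos: "\<delta> (unit_vec i) > 0" "\<delta> (unit_vec j) > 0" using ne by (simp_all add: \<delta>_unit)
  have fin: "\<exists>E. finite E \<and> ad_span P (Vs a) S = vs.span E"
    if "finite E'" "S = vs.span E'" "S \<subseteq> carr P" for a S E'
    by (rule finite_ad_span[OF finite_class.finite_UNIV idsV(1) F(1) _ yd_subobjectD(2)[OF Vs_sub] that])
      (use idsV(3) F(2) in blast)
  \<comment> \<open>Stated for arbitrary \<open>a\<close> and \<open>b\<close> of positive weight,
    so that the two summands of \<open>W\<close> are the cases \<open>(i, j)\<close> and
    \<open>(j, i)\<close>. The inner commutator has weight \<open>1 - 2 < 0\<close> in both cases,
    which is harmless since only the elements acting by \<open>ad\<close> must have positive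
    weight.\<close>
  have ad2: "yd_subobject \<Phi> P (ad_span P (Vs a) (ad_span P (Vs b) (Vs k)))"
      "ad_span P (Vs a) (ad_span P (Vs b) (Vs k)) \<subseteq> gr (unit_vec a + (unit_vec b + unit_vec k))"
      "\<And>x. x \<in> ad_span P (Vs a) (ad_span P (Vs b) (Vs k)) \<Longrightarrow> prim_mod_N x"
      "\<exists>E. finite E \<and> ad_span P (Vs a) (ad_span P (Vs b) (Vs k)) = vs.span E"
    if ab: "\<delta> (unit_vec a) > 0" "\<delta> (unit_vec b) > 0" for a b
  proof -
    let ?S = "ad_span P (Vs b) (Vs k)"
    have S: "yd_subobject \<Phi> P ?S" by (rule sub[OF Vs_sub Vs_sub])
    have Sg: "?S \<subseteq> gr (unit_vec b + unit_vec k)" by (rule ad_span_gr[OF Vs_gr Vs_gr Vs_sub])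
    have Sp: "prim_mod_N x" if "x \<in> ?S" for x
      by (rule ad_span_prim_mod_N[OF Vs_gr ab(2) Vs_prim Vs_sub primitive_prim_mod_N[OF Vs_prim] that])
    obtain E0 where E0: "finite E0" "Vs k = vs.span E0"
      by (rule finite_span_subspace[OF hspD(1)[OF hsp] F(1) _ idsV(1), of k]) (use idsV(3) F(2) in blast)+
    obtain E where E: "finite E" "?S = vs.span E"
      using fin[OF E0 yd_subobjectD(2)[OF Vs_sub]] by blast
    show "yd_subobject \<Phi> P (ad_span P (Vs a) ?S)" by (rule sub[OF Vs_sub S])
    show "ad_span P (Vs a) ?S \<subseteq> gr (unit_vec a + (unit_vec b + unit_vec k))" by (rule ad_span_gr[OF Vs_gr Sg S])
    show "prim_mod_N x" if "x \<in> ad_span P (Vs a) ?S" for x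
      by (rule ad_span_prim_mod_N[OF Vs_gr ab(1) Vs_prim S Sp that])
    show "\<exists>E. finite E \<and> ad_span P (Vs a) ?S = vs.span E" by (rule fin[OF E yd_subobjectD(2)[OF S]])
  qed
  define S T where "S = ad_span P (Vs i) (ad_span P (Vs j) (Vs k))" and "T = ad_span P (Vs j) (ad_span P (Vs i) (Vs k))"
  note S = ad2[OF pos, folded S_def] and T = ad2[OF pos(2,1), folded T_def]
  have "vs.span S = S" "vs.span T = T"
    unfolding vs.span_eq_iff by (rule yd_subobjectD(1)[OF S(1)], rule yd_subobjectD(1)[OF T(1)])
  then have W_span: "W = vs.span (S \<union> T)"
    unfolding vs.span_Un W S_def[symmetric] T_def[symmetric] by (simp only:)
  have \<alpha>1: "unit_vec i + (unit_vec j + unit_vec k) = \<alpha> 1" "unit_vec j + (unit_vec i + unit_vec k) = \<alpha> 1"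
    by (simp_all add: \<alpha>_def fun_eq_iff)
  interpret face_subalgebra \<Phi> P gr \<delta> \<alpha> W
  proof
    show "\<alpha> 0 = 0" "\<alpha> (m + n) = \<alpha> m + \<alpha> n" for m n by (simp_all add: \<alpha>_def fun_eq_iff algebra_simps)
    \<comment> \<open>The indices are distinct, so \<open>e_i\<close> occurs exactly once in
      \<open>e_i + e_j + e_k\<close> and \<open>n\<close> can be read off from the coefficient at
      \<open>i\<close>.\<close>
    have "\<alpha> n i = n" for n using ne by (simp add: \<alpha>_def unit_vec_def)
    then show "inj \<alpha>" by (intro injI) metis
    have "\<delta> (\<alpha> n) = int n * (\<delta> (unit_vec i) + \<delta> (unit_vec j) + \<delta> (unit_vec k))" for n
      by (simp add: \<delta>_def \<alpha>_def sum_distrib_left sum.distrib algebra_simps)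
    \<comment> \<open>The three weights are 1, 1 and -2, because \<open>i\<close> and
      \<open>j\<close> differ from \<open>k\<close>.\<close>
    then show "\<delta> (\<alpha> n) = 0" for n using ne by (simp add: \<delta>_unit)
    show "yd_subobject \<Phi> P W" unfolding W_span by (rule yd_subobject_sum[OF S(1) T(1)])
    show "W \<subseteq> gr (\<alpha> 1)"
      unfolding W_span using S(2) T(2) unfolding \<alpha>1 by (intro vs.span_minimal gr_subspace Un_least)
    have "vs.span (S \<union> T) \<subseteq> {x \<in> carr P. prim_mod_N x}"
      by (rule vs.span_minimal[OF _ prim_mod_N_subspace])
        (use S(3) T(3) yd_subobjectD(2)[OF S(1)] yd_subobjectD(2)[OF T(1)] in blast)
    then show "comul P w - (ptens P P w (unt P) + ptens P P (unt P) w) \<in> N" if "w \<in> W" for w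
      using that unfolding W_span prim_mod_N_def by blast
  qed
  obtain E E' where E: "finite E" "S = vs.span E" "finite E'" "T = vs.span E'" using S(4) T(4) by blast
  have "W = vs.span (E \<union> E')"
    unfolding W_span vs.span_Un E(2,4) vs.span_span ..
  then have "pre_Nichols \<Phi> Pr W" using E(1,3) by (intro pre_Nichols_Pr[of "E \<union> E'"]) simp_all
  then show ?thesis unfolding Pr_def subalgebra_W_A by blast
qed

end
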